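(* Let $p,q$ be primes with $p>2$, $q\equiv 1\pmod p$ and $q\not\equiv 1\pmod{p^2}$. For groups $X,Y$ of order $p^2q$ let $N(X,Y)$ be the number of isomorphism classes of skew braces $(B,+,\circ)$ with $(B,+)\cong X$ and $(B,\circ)\cong Y$. Then: (1) For $X=\mathbb{Z}_q\rtimes_r\mathbb{Z}_{p^2}$: $N(X,\mathbb{Z}_{p^2q})=2p$, $N(X,\mathbb{Z}_q\rtimes_r\mathbb{Z}_{p^2})=2p(p-1)$, $N(X,\mathbb{Z}_p^2\times\mathbb{Z}_q)=0$, $N(X,\mathbb{Z}_p\times(\mathbb{Z}_q\rtimes_r\mathbb{Z}_p))=0$. (2) For $X=\mathbb{Z}_p\times(\mathbb{Z}_q\rtimes_r\mathbb{Z}_p)$: $N(X,\mathbb{Z}_{p^2q})=0$, $N(X,\mathbb{Z}_q\rtimes_r\mathbb{Z}_{p^2})=0$, $N(X,\mathbb{Z}_p^2\times\mathbb{Z}_q)=4$, $N(X,\mathbb{Z}_p\times(\mathbb{Z}_q\rtimes_r\mathbb{Z}_p))=6p-4$.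
   Context: A skew (left) brace is a triple $(B,+,\circ)$ where $(B,+)$ and $(B,\circ)$ are groups (not necessarily abelian) such that $a\circ(b+c)=a\circ b-a+a\circ c$ for all $a,b,c\in B$; isomorphisms are bijections preserving both operations. Fix an element $r$ of order $p$ in $\mathbb{Z}_q^\times$. Groups: $\mathbb{Z}_q\rtimes_r\mathbb{Z}_{p^2}=\langle\sigma,\tau\mid\sigma^{p^2}=\tau^q=1,\ \sigma\tau\sigma^{-1}=\tau^r\rangle$ and $\mathbb{Z}_p\times(\mathbb{Z}_q\rtimes_r\mathbb{Z}_p)=\langle\sigma,\tau,\epsilon\mid\sigma^p=\tau^p=\epsilon^q=1,\ [\epsilon,\tau]=[\tau,\sigma]=1,\ \sigma\epsilon\sigma^{-1}=\epsilon^r\rangle$. *)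

theory Defs
  imports "HOL-Algebra.Elementary_Groups" "HOL-Number_Theory.Pocklington"
begin

section \<open>Skew braces\<close>

text \<open>
  The record type of rings is reused only as a signature with two binary operations on one
  carrier: \<open>\<oplus>\<close> is the additive operation \<open>+\<close> of the skew brace and \<open>\<otimes>\<close> is its
  multiplicative operation \<open>\<circ>\<close>. Neither operation is assumed to be commutative, and no
  ring axiom is assumed.
\<close>

locale skew_brace =
  fixes B :: "'a ring" (structure)
  assumes add_group: "group (add_monoid B)"
    and circ_group: "group B"
    and compat: "\<lbrakk>a \<in> carrier B; b \<in> carrier B; c \<in> carrier B\<rbrakk>
      \<Longrightarrow> a \<otimes> (b \<oplus> c) = ((a \<otimes> b) \<oplus> (\<ominus> a)) \<oplus> (a \<otimes> c)"

definition skew_brace_iso :: "'a ring \<Rightarrow> 'b ring \<Rightarrow> ('a \<Rightarrow> 'b) set" where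
  "skew_brace_iso B C =
    {f. bij_betw f (carrier B) (carrier C) \<and>
        (\<forall>x\<in>carrier B. \<forall>y\<in>carrier B.
           f (x \<oplus>\<^bsub>B\<^esub> y) = f x \<oplus>\<^bsub>C\<^esub> f y \<and> f (x \<otimes>\<^bsub>B\<^esub> y) = f x \<otimes>\<^bsub>C\<^esub> f y)}"

text \<open>
  Isomorphism classes are formed among the skew braces whose carrier is a set of natural
  numbers. For finite skew braces this loses nothing (lemma \<open>skew_brace_nat_copy\<close> below),
  and it yields a set of classes, which is finite if \<open>X\<close> is finite (lemma
  \<open>finite_skew_brace_classes\<close> below), so that its \<open>card\<close> is meaningful.
\<close>

definition skew_braces_of_type ::
    "('x, 'm) monoid_scheme \<Rightarrow> ('y, 'n) monoid_scheme \<Rightarrow> nat ring set" where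
  "skew_braces_of_type X Y = {B. skew_brace B \<and> add_monoid B \<cong> X \<and> B \<cong> Y}"

definition skew_brace_classes ::
    "('x, 'm) monoid_scheme \<Rightarrow> ('y, 'n) monoid_scheme \<Rightarrow> nat ring set set" where
  "skew_brace_classes X Y = skew_braces_of_type X Y //
    {(B, C) \<in> skew_braces_of_type X Y \<times> skew_braces_of_type X Y. skew_brace_iso B C \<noteq> {}}"

definition num_skew_braces ::
    "('x, 'm) monoid_scheme \<Rightarrow> ('y, 'n) monoid_scheme \<Rightarrow> nat" where
  "num_skew_braces X Y = card (skew_brace_classes X Y)"

section \<open>The groups\<close>

text \<open>
  \<open>\<int>\<^sub>q \<rtimes>\<^sub>r \<int>\<^sub>m\<close>, where \<open>r\<close> represents an element of \<open>\<int>\<^sub>q\<^sup>\<times>\<close> with \<open>r\<^sup>m = 1\<close>: the generator \<open>1\<close> of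
  \<open>\<int>\<^sub>m\<close> acts on \<open>\<int>\<^sub>q\<close> as multiplication by \<open>r\<close>. In terms of the presentation
  \<open>\<langle>\<sigma>, \<tau> | \<sigma>\<^sup>m = \<tau>\<^sup>q = 1, \<sigma>\<tau>\<sigma>\<^sup>-\<^sup>1 = \<tau>\<^sup>r\<rangle>\<close>, \<open>\<tau>\<close> is \<open>(1, 0)\<close>, \<open>\<sigma>\<close> is \<open>(0, 1)\<close>, and \<open>(a, i)\<close> is
  \<open>\<tau>\<^sup>a \<sigma>\<^sup>i\<close>.
\<close>

definition cyclic_semidirect :: "nat \<Rightarrow> nat \<Rightarrow> nat \<Rightarrow> (int \<times> int) monoid" where
  "cyclic_semidirect q m r =
    \<lparr>carrier = carrier (integer_mod_group q) \<times> carrier (integer_mod_group m),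
     monoid.mult = (\<lambda>(a, i) (b, j). ((a + int r ^ nat i * b) mod int q, (i + j) mod int m)),
     one = (0, 0)\<rparr>"

section \<open>Sanity checks\<close>

lemma pow_mod_exponent:
  fixes q m r :: nat
  assumes "[r ^ m = 1] (mod q)"
  shows "[int r ^ (k mod m) = int r ^ k] (mod int q)"
proof -
  have "[int r ^ m = 1] (mod int q)"
    using assms cong_int_iff[of "r ^ m" 1 q] by simp
  then have "[(int r ^ m) ^ (k div m) * int r ^ (k mod m) = 1 ^ (k div m) * int r ^ (k mod m)] (mod int q)"
    by (intro cong_mult cong_pow) auto
  moreover have "(int r ^ m) ^ (k div m) * int r ^ (k mod m) = int r ^ k"
    by (simp flip: power_mult power_add)
  ultimately show ?thesis by (simp add: cong_sym)
qed

lemma group_cyclic_semidirect: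
  assumes "q > 0" "m > 0" and r: "[r ^ m = 1] (mod q)"
  shows "group (cyclic_semidirect q m r)" (is "group ?G")
proof (rule groupI)
  have car: "carrier ?G = {0..<int q} \<times> {0..<int m}"
    using assms by (simp add: cyclic_semidirect_def carrier_integer_mod_group)
  have mul: "(a, i) \<otimes>\<^bsub>?G\<^esub> (b, j) = ((a + int r ^ nat i * b) mod int q, (i + j) mod int m)" for a b i j
    by (simp add: cyclic_semidirect_def)
  have one: "\<one>\<^bsub>?G\<^esub> = (0, 0)"
    by (simp add: cyclic_semidirect_def)
  have pw: "[int r ^ nat ((i + j) mod int m) = int r ^ nat i * int r ^ nat j] (mod int q)"
    if "0 \<le> i" "0 \<le> j" for i j
  proof -
    have "nat ((i + j) mod int m) = (nat i + nat j) mod m"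
      using that by (simp add: nat_mod_distrib nat_add_distrib)
    then show ?thesis using pow_mod_exponent[OF r, of "nat i + nat j"]
      by (simp add: power_add)
  qed
  show "x \<otimes>\<^bsub>?G\<^esub> y \<in> carrier ?G" if "x \<in> carrier ?G" "y \<in> carrier ?G" for x y
    using assms by (cases x; cases y) (simp add: car mul)
  show "\<one>\<^bsub>?G\<^esub> \<in> carrier ?G"
    using assms by (simp add: car one)
  show "\<one>\<^bsub>?G\<^esub> \<otimes>\<^bsub>?G\<^esub> x = x" if "x \<in> carrier ?G" for x
    using that by (cases x) (simp add: car one mul)
  show "x \<otimes>\<^bsub>?G\<^esub> y \<otimes>\<^bsub>?G\<^esub> z = x \<otimes>\<^bsub>?G\<^esub> (y \<otimes>\<^bsub>?G\<^esub> z)"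
    if "x \<in> carrier ?G" "y \<in> carrier ?G" "z \<in> carrier ?G" for x y z
  proof -
    obtain a i b j c k where x: "x = (a, i)" and y: "y = (b, j)" and z: "z = (c, k)"
      by (cases x; cases y; cases z) auto
    have ij: "0 \<le> i" "0 \<le> j" using that by (auto simp: x y car)
    have "[(a + int r ^ nat i * b) mod int q + int r ^ nat ((i + j) mod int m) * c
         = (a + int r ^ nat i * b) + (int r ^ nat i * int r ^ nat j) * c] (mod int q)"
      by (intro cong_add cong_mult pw ij) auto
    also have "(a + int r ^ nat i * b) + (int r ^ nat i * int r ^ nat j) * c
         = a + int r ^ nat i * (b + int r ^ nat j * c)"
      by (simp add: algebra_simps)
    also have "[\<dots> = a + int r ^ nat i * ((b + int r ^ nat j * c) mod int q)] (mod int q)"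
      by (intro cong_add cong_mult) (auto simp: cong_def)
    finally show ?thesis
      by (simp add: x y z mul cong_def mod_add_left_eq mod_add_right_eq add.assoc)
  qed
  show "\<exists>y\<in>carrier ?G. y \<otimes>\<^bsub>?G\<^esub> x = \<one>\<^bsub>?G\<^esub>" if "x \<in> carrier ?G" for x
  proof -
    obtain a i where x: "x = (a, i)" by (cases x)
    define j where "j = (- i) mod int m"
    define b where "b = (- (int r ^ nat j * a)) mod int q"
    have "(b + int r ^ nat j * a) mod int q = 0"
      unfolding b_def by (simp add: mod_add_left_eq)
    moreover have "(j + i) mod int m = 0"
      unfolding j_def by (simp add: mod_add_left_eq)
    moreover have "(b, j) \<in> carrier ?G"
      using assms by (simp add: car b_def j_def)
    ultimately show ?thesis
      by (intro bexI[of _ "(b, j)"]) (simp_all add: x mul one)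
  qed
qed

lemma order_cyclic_semidirect:
  assumes "q > 0" "m > 0"
  shows "order (cyclic_semidirect q m r) = m * q"
  using assms by (simp add: order_def cyclic_semidirect_def carrier_integer_mod_group)

text \<open>The next three lemmas say that the group has the presentation stated above.\<close>

lemma pow_cyclic_semidirect:
  assumes "q > 1" "m > 1"
  shows "(1, 0) [^]\<^bsub>cyclic_semidirect q m r\<^esub> (k::nat) = (int k mod int q, 0)"
    and "(0, 1) [^]\<^bsub>cyclic_semidirect q m r\<^esub> (k::nat) = (0, int k mod int m)"
proof -
  show "(1, 0) [^]\<^bsub>cyclic_semidirect q m r\<^esub> k = (int k mod int q, 0)"
    by (induction k) (simp_all add: cyclic_semidirect_def nat_pow_def mod_add_left_eq mod_add_right_eq add.commute)
  show "(0, 1) [^]\<^bsub>cyclic_semidirect q m r\<^esub> k = (0, int k mod int m)"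
    by (induction k) (simp_all add: cyclic_semidirect_def nat_pow_def mod_add_left_eq mod_add_right_eq add.commute)
qed

lemma cyclic_semidirect_relations:
  fixes q m r :: nat
  assumes "q > 1" "m > 1"
  defines G: "G \<equiv> cyclic_semidirect q m r"
  shows "(0, 1) [^]\<^bsub>G\<^esub> m = \<one>\<^bsub>G\<^esub>"
    and "(1, 0) [^]\<^bsub>G\<^esub> q = \<one>\<^bsub>G\<^esub>"
    and "(0, 1) \<otimes>\<^bsub>G\<^esub> (1, 0) = ((1, 0) [^]\<^bsub>G\<^esub> r) \<otimes>\<^bsub>G\<^esub> (0, 1)"
    and "\<lbrakk>a \<in> {0..<int q}; i \<in> {0..<int m}\<rbrakk>
      \<Longrightarrow> (a, i) = ((1, 0) [^]\<^bsub>G\<^esub> nat a) \<otimes>\<^bsub>G\<^esub> ((0, 1) [^]\<^bsub>G\<^esub> nat i)"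
  unfolding G pow_cyclic_semidirect[OF assms(1,2)]
  using assms(1,2) by (simp_all add: cyclic_semidirect_def)

lemma cyclic_semidirect_universal:
  fixes K (structure)
  assumes "group K" and s: "s \<in> carrier K" "s [^] m = \<one>" and t: "t \<in> carrier K" "t [^] q = \<one>"
    and rel: "s \<otimes> t \<otimes> inv s = t [^] r" and "q > 1" "m > 1"
  shows "\<exists>h \<in> hom (cyclic_semidirect q m r) K. h (0, 1) = s \<and> h (1, 0) = t"
proof -
  interpret group K by fact
  define h where "h = (\<lambda>(a, i). t [^] nat a \<otimes> s [^] nat i)"
  have pmod: "x [^] (k mod n) = x [^] k" if "x \<in> carrier K" "x [^] n = \<one>" for x and k n :: nat
  proof -
    have "x [^] k = x [^] (n * (k div n) + k mod n)" by simp
    also have "\<dots> = (x [^] n) [^] (k div n) \<otimes> x [^] (k mod n)"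
      using that(1) by (simp only: nat_pow_mult[symmetric] nat_pow_pow)
    finally show ?thesis using that by simp
  qed
  have st: "s \<otimes> t = t [^] r \<otimes> s"
    using rel s t by (metis inv_solve_right m_closed nat_pow_closed)
  have c1: "s \<otimes> t [^] b = t [^] (r * b) \<otimes> s" for b :: nat
  proof (induction b)
    case 0 then show ?case using s t by simp
  next
    case (Suc b)
    have "s \<otimes> t [^] Suc b = (s \<otimes> t [^] b) \<otimes> t" using s t by (simp add: m_assoc)
    also have "\<dots> = t [^] (r * b) \<otimes> (s \<otimes> t)" using s t by (simp add: Suc m_assoc)
    also have "\<dots> = t [^] (r * b) \<otimes> t [^] r \<otimes> s" using s t by (simp add: st m_assoc)
    also have "\<dots> = t [^] (r * Suc b) \<otimes> s" using t by (simp add: nat_pow_mult add.commute)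
    finally show ?case .
  qed
  have c2: "s [^] i \<otimes> t [^] b = t [^] (r ^ i * b) \<otimes> s [^] i" for i b :: nat
  proof (induction i arbitrary: b)
    case 0 then show ?case using t by simp
  next
    case (Suc i)
    have "s [^] Suc i \<otimes> t [^] b = s [^] i \<otimes> (s \<otimes> t [^] b)" using s t by (simp add: m_assoc)
    also have "\<dots> = (s [^] i \<otimes> t [^] (r * b)) \<otimes> s" using s t by (simp add: c1 m_assoc)
    also have "\<dots> = t [^] (r ^ Suc i * b) \<otimes> s [^] Suc i"
      using s t by (simp add: Suc m_assoc mult_ac)
    finally show ?case .
  qed
  have "h \<in> hom (cyclic_semidirect q m r) K"
  proof (rule homI)
    fix x assume "x \<in> carrier (cyclic_semidirect q m r)"
    show "h x \<in> carrier K" using s t by (cases x) (simp add: h_def)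
  next
    fix x y assume xy: "x \<in> carrier (cyclic_semidirect q m r)" "y \<in> carrier (cyclic_semidirect q m r)"
    obtain a i b j where x: "x = (a, i)" and y: "y = (b, j)" by (cases x; cases y) auto
    have nn: "0 \<le> a" "0 \<le> i" "0 \<le> b" "0 \<le> j"
      using xy assms by (auto simp: x y cyclic_semidirect_def carrier_integer_mod_group)
    have e1: "nat ((a + int r ^ nat i * b) mod int q) = (nat a + r ^ nat i * nat b) mod q"
      using nn by (simp add: nat_mod_distrib nat_add_distrib nat_mult_distrib nat_power_eq)
    have e2: "nat ((i + j) mod int m) = (nat i + nat j) mod m"
      using nn by (simp add: nat_mod_distrib nat_add_distrib)
    have "h (x \<otimes>\<^bsub>cyclic_semidirect q m r\<^esub> y)
        = t [^] (nat a + r ^ nat i * nat b) \<otimes> s [^] (nat i + nat j)"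
      using s t by (simp add: x y h_def cyclic_semidirect_def e1 e2 pmod)
    also have "\<dots> = t [^] nat a \<otimes> (t [^] (r ^ nat i * nat b) \<otimes> s [^] nat i) \<otimes> s [^] nat j"
      using s t by (simp add: nat_pow_mult[symmetric] m_assoc)
    also have "\<dots> = h x \<otimes> h y"
      using s t by (simp add: c2[symmetric] x y h_def m_assoc)
    finally show "h (x \<otimes>\<^bsub>cyclic_semidirect q m r\<^esub> y) = h x \<otimes> h y" .
  qed
  moreover have "h (0, 1) = s" "h (1, 0) = t" using s t by (simp_all add: h_def)
  ultimately show ?thesis by blast
qed

lemma skew_brace_iso_sym:
  assumes "skew_brace B" "skew_brace_iso B C \<noteq> {}"
  shows "skew_brace_iso C B \<noteq> {}"
proof -
  interpret ad: group "add_monoid B" using assms(1) by (rule skew_brace.add_group)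
  interpret ci: group B using assms(1) by (rule skew_brace.circ_group)
  obtain f where f: "bij_betw f (carrier B) (carrier C)"
    and hom: "\<And>x y. \<lbrakk>x \<in> carrier B; y \<in> carrier B\<rbrakk> \<Longrightarrow>
       f (x \<oplus>\<^bsub>B\<^esub> y) = f x \<oplus>\<^bsub>C\<^esub> f y \<and> f (x \<otimes>\<^bsub>B\<^esub> y) = f x \<otimes>\<^bsub>C\<^esub> f y"
    using assms(2) by (auto simp: skew_brace_iso_def)
  let ?g = "inv_into (carrier B) f"
  have g: "bij_betw ?g (carrier C) (carrier B)" by (rule bij_betw_inv_into[OF f])
  have gc: "?g x \<in> carrier B" "f (?g x) = x" if "x \<in> carrier C" for x
    using that g f by (auto simp: bij_betw_def f_inv_into_f inv_into_into)
  have gf: "?g (f x) = x" if "x \<in> carrier B" for x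
    using that f by (simp add: bij_betw_inv_into_left)
  have cl: "x \<oplus>\<^bsub>B\<^esub> y \<in> carrier B" "x \<otimes>\<^bsub>B\<^esub> y \<in> carrier B"
    if "x \<in> carrier B" "y \<in> carrier B" for x y
    using that ad.m_closed[of x y] ci.m_closed[of x y] by simp_all
  have "?g (x \<oplus>\<^bsub>C\<^esub> y) = ?g x \<oplus>\<^bsub>B\<^esub> ?g y \<and> ?g (x \<otimes>\<^bsub>C\<^esub> y) = ?g x \<otimes>\<^bsub>B\<^esub> ?g y"
    if "x \<in> carrier C" "y \<in> carrier C" for x y
    using hom[OF gc(1)[OF that(1)] gc(1)[OF that(2)]] gc(2)[OF that(1)] gc(2)[OF that(2)]
      gf[OF cl(1)[OF gc(1)[OF that(1)] gc(1)[OF that(2)]]]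
      gf[OF cl(2)[OF gc(1)[OF that(1)] gc(1)[OF that(2)]]] by simp
  then have "?g \<in> skew_brace_iso C B"
    unfolding skew_brace_iso_def using g by blast
  then show ?thesis by blast
qed

lemma skew_brace_iso_trans:
  assumes "skew_brace_iso B C \<noteq> {}" "skew_brace_iso C D \<noteq> {}"
  shows "skew_brace_iso B D \<noteq> {}"
proof -
  obtain f g where "f \<in> skew_brace_iso B C" "g \<in> skew_brace_iso C D" using assms by blast
  then have "g \<circ> f \<in> skew_brace_iso B D"
    by (auto simp: skew_brace_iso_def bij_betw_trans bij_betw_apply)
  then show ?thesis by blast
qed

lemma equiv_skew_brace_iso:
  "equiv (skew_braces_of_type X Y)
    {(B, C) \<in> skew_braces_of_type X Y \<times> skew_braces_of_type X Y. skew_brace_iso B C \<noteq> {}}"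
  (is "equiv _ ?R")
proof -
  have "id \<in> skew_brace_iso B B" for B :: "nat ring"
    by (simp add: skew_brace_iso_def)
  then have refl: "skew_brace_iso B B \<noteq> {}" for B :: "nat ring"
    by blast
  show ?thesis
  proof (rule equivI)
    show "refl_on (skew_braces_of_type X Y) ?R"
      using refl by (auto simp: refl_on_def)
    show "?R \<subseteq> skew_braces_of_type X Y \<times> skew_braces_of_type X Y"
      by auto
    show "sym ?R"
      using skew_brace_iso_sym by (fastforce simp: sym_def skew_braces_of_type_def)
    show "trans ?R"
      using skew_brace_iso_trans by (fastforce simp: trans_def)
  qed
qed

text \<open>A skew brace structure can be transported along a bijection.\<close>

lemma skew_brace_transport:
  fixes B :: "'a ring" and f :: "'a \<Rightarrow> 'b"
  assumes "skew_brace B" and inj: "inj_on f (carrier B)"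
  defines "g \<equiv> inv_into (carrier B) f"
  defines "C \<equiv> \<lparr>carrier = f ` carrier B,
     monoid.mult = (\<lambda>x y. f (g x \<otimes>\<^bsub>B\<^esub> g y)), one = f \<one>\<^bsub>B\<^esub>,
     zero = f \<zero>\<^bsub>B\<^esub>, add = (\<lambda>x y. f (g x \<oplus>\<^bsub>B\<^esub> g y))\<rparr>"
  shows "skew_brace C" and "f \<in> skew_brace_iso B C"
proof -
  interpret skew_brace B by fact
  interpret ad: group "add_monoid B" by (rule add_group)
  interpret ci: group B by (rule circ_group)
  have gf: "g (f x) = x" if "x \<in> carrier B" for x
    using that inj by (simp add: g_def)
  have acl: "x \<oplus>\<^bsub>B\<^esub> y \<in> carrier B" if "x \<in> carrier B" "y \<in> carrier B" for x y
    using ad.m_closed[of x y] that by simp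
  show iso: "f \<in> skew_brace_iso B C"
    using inj by (auto simp: skew_brace_iso_def C_def bij_betw_def gf)
  have "f \<in> iso B C" "f \<in> iso (add_monoid B) (add_monoid C)"
    using inj by (auto simp: iso_def hom_def C_def bij_betw_def gf acl)
  then have *: "f ` carrier B = carrier C" "f \<in> hom B C" "f \<in> hom (add_monoid B) (add_monoid C)"
    by (auto simp: iso_def C_def)
  have gC: "group C"
    using ci.iso_imp_img_group[OF \<open>f \<in> iso B C\<close>] by (simp add: C_def)
  have gaC: "group (add_monoid C)"
    using ad.iso_imp_img_group[OF \<open>f \<in> iso (add_monoid B) (add_monoid C)\<close>] by (simp add: C_def)
  interpret aC: group "add_monoid C" by (rule gaC)
  interpret h: group_hom "add_monoid B" "add_monoid C" f
    by unfold_locales (rule *(3))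
  have neg: "\<ominus>\<^bsub>C\<^esub> (f a) = f (\<ominus>\<^bsub>B\<^esub> a)" if "a \<in> carrier B" for a
    using h.hom_inv[of a] that by (simp add: a_inv_def)
  have ncl: "\<ominus>\<^bsub>B\<^esub> a \<in> carrier B" if "a \<in> carrier B" for a
    using ad.inv_closed[of a] that by (simp add: a_inv_def)
  have add: "f x \<oplus>\<^bsub>C\<^esub> f y = f (x \<oplus>\<^bsub>B\<^esub> y)" "f x \<otimes>\<^bsub>C\<^esub> f y = f (x \<otimes>\<^bsub>B\<^esub> y)"
    if "x \<in> carrier B" "y \<in> carrier B" for x y
    using that by (simp_all add: C_def gf)
  show "skew_brace C"
  proof (rule skew_brace.intro)
    fix x y z assume "x \<in> carrier C" "y \<in> carrier C" "z \<in> carrier C"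
    then have "x \<in> f ` carrier B" "y \<in> f ` carrier B" "z \<in> f ` carrier B"
      by (simp_all only: *(1))
    then obtain a b c where abc: "a \<in> carrier B" "b \<in> carrier B" "c \<in> carrier B"
      "x = f a" "y = f b" "z = f c"
      by (elim imageE)
    note mcl = ci.m_closed[OF abc(1,2)] ci.m_closed[OF abc(1,3)]
    have "x \<otimes>\<^bsub>C\<^esub> (y \<oplus>\<^bsub>C\<^esub> z) = f (a \<otimes>\<^bsub>B\<^esub> (b \<oplus>\<^bsub>B\<^esub> c))"
      by (simp only: abc add acl)
    also have "\<dots> = f (((a \<otimes>\<^bsub>B\<^esub> b) \<oplus>\<^bsub>B\<^esub> (\<ominus>\<^bsub>B\<^esub> a)) \<oplus>\<^bsub>B\<^esub> (a \<otimes>\<^bsub>B\<^esub> c))"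
      by (simp only: compat abc)
    also have "\<dots> = ((x \<otimes>\<^bsub>C\<^esub> y) \<oplus>\<^bsub>C\<^esub> (\<ominus>\<^bsub>C\<^esub> x)) \<oplus>\<^bsub>C\<^esub> (x \<otimes>\<^bsub>C\<^esub> z)"
      by (simp only: abc neg add acl ncl mcl)
    finally show "x \<otimes>\<^bsub>C\<^esub> (y \<oplus>\<^bsub>C\<^esub> z) = ((x \<otimes>\<^bsub>C\<^esub> y) \<oplus>\<^bsub>C\<^esub> (\<ominus>\<^bsub>C\<^esub> x)) \<oplus>\<^bsub>C\<^esub> (x \<otimes>\<^bsub>C\<^esub> z)" .
  qed (rule gaC gC)+
qed

lemma skew_brace_nat_copy:
  fixes B :: "'a ring"
  assumes "skew_brace B" "finite (carrier B)"
  shows "\<exists>C :: nat ring. skew_brace C \<and> skew_brace_iso B C \<noteq> {} \<and>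
    carrier C = {..<card (carrier B)}"
proof -
  obtain f :: "'a \<Rightarrow> nat" where f: "bij_betw f (carrier B) {..<card (carrier B)}"
    using ex_bij_betw_finite_nat[OF assms(2)] by (auto simp: atLeast0LessThan)
  then have "inj_on f (carrier B)" "f ` carrier B = {..<card (carrier B)}"
    by (auto simp: bij_betw_def)
  with skew_brace_transport[OF assms(1), of f] show ?thesis
    by (intro exI conjI) (assumption, auto)
qed

lemma finite_skew_brace_classes:
  assumes "finite (carrier X)"
  shows "finite (skew_brace_classes X Y)"
proof -
  define S where "S = skew_braces_of_type X Y"
  define R where "R = {(B, C) \<in> S \<times> S. skew_brace_iso B C \<noteq> {}}"
  define I where "I = {..<card (carrier X)}"
  have eqv: "equiv S R" unfolding S_def R_def by (rule equiv_skew_brace_iso)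
  define code where "code = (\<lambda>B :: nat ring.
     (restrict (\<lambda>(x, y). add B x y) (I \<times> I), restrict (\<lambda>(x, y). monoid.mult B x y) (I \<times> I)))"
  define F where "F = (\<Pi>\<^sub>E z \<in> I \<times> I. I) \<times> (\<Pi>\<^sub>E z \<in> I \<times> I. I)"
  have finF: "finite F" unfolding F_def I_def by (intro finite_cartesian_product finite_PiE) auto
  have rep: "\<exists>C \<in> S. (B, C) \<in> R \<and> carrier C = I \<and> code C \<in> F" if "B \<in> S" for B
  proof -
    have B: "skew_brace B" "add_monoid B \<cong> X" "B \<cong> Y"
      using that by (auto simp: S_def skew_braces_of_type_def)
    obtain \<phi> where "\<phi> \<in> iso (add_monoid B) X" using B(2) by (auto simp: is_iso_def)
    then have bij: "bij_betw \<phi> (carrier B) (carrier X)" by (simp add: iso_def)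
    then have fin: "finite (carrier B)" and card: "card (carrier B) = card (carrier X)"
      using assms by (auto simp: bij_betw_finite bij_betw_same_card)
    obtain C :: "nat ring" where C: "skew_brace C" "skew_brace_iso B C \<noteq> {}" "carrier C = I"
      using skew_brace_nat_copy[OF B(1) fin] by (auto simp: I_def card)
    obtain f where "f \<in> skew_brace_iso C B"
      using skew_brace_iso_sym[OF B(1) C(2)] by blast
    then have "f \<in> iso (add_monoid C) (add_monoid B)" "f \<in> iso C B"
      by (auto simp: skew_brace_iso_def iso_def hom_def bij_betw_apply)
    then have "add_monoid C \<cong> X" "C \<cong> Y"
      using B by (meson is_isoI iso_trans)+
    then have CS: "C \<in> S" using C by (simp add: S_def skew_braces_of_type_def)
    interpret ad: group "add_monoid C" using C(1) by (rule skew_brace.add_group)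
    interpret ci: group C using C(1) by (rule skew_brace.circ_group)
    have "code C \<in> F"
      using ad.m_closed ci.m_closed C(3) by (auto simp: code_def F_def PiE_def Pi_def)
    then show ?thesis using CS C that by (auto simp: R_def)
  qed
  have inR: "(C, D) \<in> R" if "C \<in> S" "D \<in> S" "carrier C = I" "carrier D = I" "code C = code D" for C D
  proof -
    have "add C x y = add D x y" "monoid.mult C x y = monoid.mult D x y" if "x \<in> I" "y \<in> I" for x y
      using \<open>code C = code D\<close> that by (auto simp: code_def restrict_def fun_eq_iff split: if_splits)
    then have "id \<in> skew_brace_iso C D"
      using that by (simp add: skew_brace_iso_def)
    then show ?thesis using that by (auto simp: R_def)
  qed
  have "S // R \<subseteq> (\<lambda>c. R `` {SOME C. C \<in> S \<and> carrier C = I \<and> code C = c}) ` F"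
  proof
    fix K assume "K \<in> S // R"
    then obtain B where B: "B \<in> S" "K = R `` {B}" by (auto elim: quotientE)
    obtain C where C: "C \<in> S" "(B, C) \<in> R" "carrier C = I" "code C \<in> F" using rep[OF B(1)] by blast
    define D where "D = (SOME D. D \<in> S \<and> carrier D = I \<and> code D = code C)"
    have "D \<in> S \<and> carrier D = I \<and> code D = code C"
      unfolding D_def by (rule someI[of _ C]) (use C in auto)
    then have "(C, D) \<in> R" using inR[of C D] C by auto
    then have "K = R `` {D}"
      using B(2) equiv_class_eq[OF eqv C(2)] equiv_class_eq[OF eqv] by simp
    then show "K \<in> (\<lambda>c. R `` {SOME C. C \<in> S \<and> carrier C = I \<and> code C = c}) ` F"
      using C(4) unfolding D_def by (rule image_eqI)
  qed
  then have "finite (S // R)" using finF by (rule finite_surj[rotated])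
  then show ?thesis by (simp add: skew_brace_classes_def S_def R_def)
qed

end

(*
Both additive groups are semidirect products of Z_q with an abelian group S of order p^2 acting
through a character r^h.  In such a skew brace the elements of Z_q act on the additive group as
inner automorphisms by k a with k = 0 or k = -1, and passing to the opposite skew brace
interchanges the two cases, so every count is twice the count for k = 0.  If k = 0, the action
factors through S, and an averaging argument (p is invertible modulo q) gives a complement of Z_q
that is closed under both operations.  Hence the skew brace is determined by a multiplication
s o t = s t z^(c h(s) h(t)) on S, where z generates the kernel of h, and by a character g of S with
values in the p-th roots of unity.  Isomorphisms correspond to automorphisms f of S that preserve
h, and transform c and g accordingly, and the multiplicative group is the semidirect product
defined by g.  It remains to count orbits of pairs (c, g) for S = Z_{p^2} and S = Z_p x Z_p.
*)
theory Submission
  imports Defs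
begin

section \<open>Preliminaries on skew braces\<close>

text \<open>Two hypotheses shape the result. As p is odd, 2 is invertible modulo p, so the symmetric
  form c h(s) h(t) comes from a quadratic map, and s -> s z^(-c h(s)^2 / 2) is an isomorphism from
  (S, o) to S. Hence the multiplicative group is again a semidirect product of Z_q with the same S;
  this is the source of the four zeros, since cyclic and elementary Sylow p-subgroups never mix. As
  p^2 does not divide q - 1, every p^2-th root of unity modulo q is a power of r, so a character can
  be recorded by natural exponents that matter only modulo p. The two orbit counts differ for one
  reason. An automorphism of Z_{p^2} preserving h is multiplication by a unit congruent to 1 modulo
  p; it fixes z and all characters, so all p * p pairs (c, g) are inequivalent. On Z_p x Z_p the
  vector z can be rescaled, and a vector with h = 1 can be shifted by multiples of z, which leaves
  3p orbits, two of them with trivial g. Skew braces are handled through coordinates (a, s) with a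
  an integer modulo q, so that most steps become congruences.\<close>

lemma (in group) left_cancel:
  "x \<in> carrier G \<Longrightarrow> y \<in> carrier G \<Longrightarrow> z \<in> carrier G \<Longrightarrow> x \<otimes> y = x \<otimes> z \<longleftrightarrow> y = z"
  by simp

lemma (in group) right_cancel:
  "x \<in> carrier G \<Longrightarrow> y \<in> carrier G \<Longrightarrow> z \<in> carrier G \<Longrightarrow> y \<otimes> x = z \<otimes> x \<longleftrightarrow> y = z"
  by simp

section \<open>The lambda map of a skew brace\<close>

context skew_brace
begin

sublocale group B
  by (rule circ_group)

sublocale add: group "add_monoid B"
  rewrites "carrier (add_monoid B) = carrier B"
    and "monoid.mult (add_monoid B) = add B"
    and "one (add_monoid B) = zero B"
    and "m_inv (add_monoid B) = a_inv B"
    and "pow (add_monoid B) = (\<lambda>a k. add_pow B k a)"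
  by (rule add_group) (auto simp: a_inv_def m_inv_def add_pow_def)

text \<open>The lambda map: an action of the multiplicative group on the additive group by
  automorphisms (\<open>lam_add\<close>, \<open>lam_comp\<close>). Together with the addition it
  determines the multiplication.\<close>

definition lam where "lam x y = \<ominus> x \<oplus> (x \<otimes> y)"

lemma lam_closed [simp]: "x \<in> carrier B \<Longrightarrow> y \<in> carrier B \<Longrightarrow> lam x y \<in> carrier B"
  by (simp add: lam_def)

lemma circ_eq: "x \<in> carrier B \<Longrightarrow> y \<in> carrier B \<Longrightarrow> x \<otimes> y = x \<oplus> lam x y"
  by (simp add: lam_def add.m_assoc[symmetric])

lemma lam_add:
  assumes "x \<in> carrier B" "y \<in> carrier B" "z \<in> carrier B"
  shows "lam x (y \<oplus> z) = lam x y \<oplus> lam x z"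
  using assms by (simp add: lam_def compat add.m_assoc)

lemma lam_inj:
  assumes "lam x y = lam x z" "x \<in> carrier B" "y \<in> carrier B" "z \<in> carrier B"
  shows "y = z"
  using assms by (metis add.inv_closed add.left_cancel left_cancel lam_def m_closed)

lemma zero_eq_one: "\<zero> = \<one>"
proof -
  have "\<zero> \<otimes> (\<zero> \<oplus> \<zero>) = ((\<zero> \<otimes> \<zero>) \<oplus> \<ominus> \<zero>) \<oplus> (\<zero> \<otimes> \<zero>)"
    by (rule compat) auto
  then have "\<zero> \<otimes> \<zero> = \<zero>"
    by simp
  then show ?thesis
    by (metis add.one_closed l_cancel_one')
qed

lemma lam_zero: "x \<in> carrier B \<Longrightarrow> lam x \<zero> = \<zero>"
  by (metis add.l_inv lam_def r_one zero_eq_one)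

lemma lam_comp:
  assumes "x \<in> carrier B" "y \<in> carrier B" "z \<in> carrier B"
  shows "lam (x \<otimes> y) z = lam x (lam y z)"
proof -
  have "(x \<otimes> y) \<oplus> lam (x \<otimes> y) z = x \<otimes> (y \<oplus> lam y z)"
    using assms by (simp add: circ_eq[symmetric] m_assoc)
  also have "\<dots> = (x \<otimes> y) \<oplus> lam x (lam y z)"
    using assms by (simp add: compat lam_def[of x "lam y z"] add.m_assoc)
  finally show ?thesis
    using assms by (metis add.left_cancel lam_closed m_closed)
qed

lemma lam_pow:
  assumes "x \<in> carrier B" "y \<in> carrier B"
  shows "lam x (add_pow B (n::nat) y) = add_pow B n (lam x y)"
  by (induction n) (use assms in \<open>simp_all add: lam_zero lam_add\<close>)

end

text \<open>Once \<open>x \<otimes> y = x \<oplus> L x y\<close>, the term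
  \<open>\<ominus> a\<close> in the brace identity cancels the leading \<open>a\<close> of
  \<open>a \<otimes> c\<close>, and only additivity of \<open>L a\<close> remains. The models are
  verified in this form.\<close>

lemma skew_braceI:
  fixes B (structure)
  assumes "group (add_monoid B)" "group B"
    and L: "\<And>x y. x \<in> carrier B \<Longrightarrow> y \<in> carrier B \<Longrightarrow> L x y \<in> carrier B"
    and eq: "\<And>x y. x \<in> carrier B \<Longrightarrow> y \<in> carrier B \<Longrightarrow> x \<otimes> y = x \<oplus> L x y"
    and add: "\<And>x y z. x \<in> carrier B \<Longrightarrow> y \<in> carrier B \<Longrightarrow> z \<in> carrier B \<Longrightarrow>
      L x (y \<oplus> z) = L x y \<oplus> L x z"
  shows "skew_brace B"
proof (rule skew_brace.intro[OF assms(1,2)])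
  fix a b c assume abc: "a \<in> carrier B" "b \<in> carrier B" "c \<in> carrier B"
  interpret add: group "add_monoid B"
    rewrites "carrier (add_monoid B) = carrier B"
    and "monoid.mult (add_monoid B) = add B"
    and "one (add_monoid B) = zero B"
    and "m_inv (add_monoid B) = a_inv B"
    by (rule assms(1)) (auto simp: a_inv_def m_inv_def)
  have cancel: "\<ominus> a \<oplus> (a \<oplus> x) = x" if "x \<in> carrier B" for x
    using abc that by (metis add.inv_closed add.l_inv add.l_one add.m_assoc)
  show "a \<otimes> (b \<oplus> c) = ((a \<otimes> b) \<oplus> (\<ominus> a)) \<oplus> (a \<otimes> c)"
    using abc L by (simp add: eq add add.m_assoc cancel)
qed

section \<open>Opposite skew braces\<close>

definition opposite_brace :: "('a, 'm) ring_scheme \<Rightarrow> ('a, 'm) ring_scheme" where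
  "opposite_brace B = B\<lparr>add := \<lambda>x y. add B y x\<rparr>"

lemma opposite_brace_simps [simp]:
  "carrier (opposite_brace B) = carrier B"
  "monoid.mult (opposite_brace B) = monoid.mult B"
  "one (opposite_brace B) = one B"
  "zero (opposite_brace B) = zero B"
  "add (opposite_brace B) = (\<lambda>x y. add B y x)"
  "opposite_brace (opposite_brace B) = B"
  by (simp_all add: opposite_brace_def)

lemma opposite_brace_iso_mult: "opposite_brace B \<cong> C \<longleftrightarrow> B \<cong> C"
  by (simp add: is_iso_def iso_def hom_def)

lemma skew_brace_iso_opposite:
  "skew_brace_iso (opposite_brace B) (opposite_brace C) = skew_brace_iso B C"
  by (auto simp: skew_brace_iso_def)

lemma (in skew_brace) opposite_brace: "skew_brace (opposite_brace B)"
  and opposite_brace_iso_add: "add_monoid (opposite_brace B) \<cong> add_monoid B"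
  and add_pow_opposite_brace: "x \<in> carrier B \<Longrightarrow> add_pow (opposite_brace B) (n::nat) x = add_pow B n x"
proof -
  have ga: "group (add_monoid (opposite_brace B))"
  proof (rule groupI)
    show "\<exists>y\<in>carrier (add_monoid (opposite_brace B)).
        y \<otimes>\<^bsub>add_monoid (opposite_brace B)\<^esub> x = \<one>\<^bsub>add_monoid (opposite_brace B)\<^esub>"
      if "x \<in> carrier (add_monoid (opposite_brace B))" for x
      using that by (intro bexI[of _ "\<ominus> x"]) auto
  qed (auto simp: add.m_assoc)
  interpret op: group "add_monoid (opposite_brace B)" by (rule ga)
  have inv: "\<ominus>\<^bsub>opposite_brace B\<^esub> x = \<ominus> x" if "x \<in> carrier B" for x
    using that op.inv_equality[of "\<ominus> x" x] by (simp add: a_inv_def[of "opposite_brace B"])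
  have "group (opposite_brace B)"
  proof (rule groupI)
    show "\<exists>y\<in>carrier (opposite_brace B). y \<otimes>\<^bsub>opposite_brace B\<^esub> x = \<one>\<^bsub>opposite_brace B\<^esub>"
      if "x \<in> carrier (opposite_brace B)" for x
      using that by (intro bexI[of _ "inv x"]) auto
  qed (auto simp: m_assoc)
  then show "skew_brace (opposite_brace B)"
    using ga by (intro skew_brace.intro) (auto simp: inv compat add.m_assoc)
  \<comment> \<open>Negation reverses sums, so it identifies the opposite additive group with the
    original one: passing to the opposite does not change the additive type.\<close>
  have "a_inv B \<in> iso (add_monoid (opposite_brace B)) (add_monoid B)"
    by (auto simp: iso_def hom_def add.inv_mult_group intro!: bij_betw_byWitness[where f' = "a_inv B"])
  then show "add_monoid (opposite_brace B) \<cong> add_monoid B"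
    by (rule is_isoI)
  show "add_pow (opposite_brace B) n x = add_pow B n x" if "x \<in> carrier B"
  proof -
    have "add_pow B n x \<oplus> x = x \<oplus> add_pow B n x" for n :: nat
      using add.nat_pow_comm[OF that, of n 1] that by simp
    then show ?thesis
      by (induction n) (simp_all add: add_pow_def)
  qed
qed

text \<open>Counting by a transversal whose members may live on any carrier type. The classes
  consist of braces on natural numbers, so each model is first replaced by a copy there.\<close>

lemma num_skew_braces_eq_card:
  fixes M :: "'i \<Rightarrow> 'm ring"
  assumes model: "\<And>i. i \<in> I \<Longrightarrow> skew_brace (M i) \<and> finite (carrier (M i)) \<and>
      add_monoid (M i) \<cong> X \<and> M i \<cong> Y"
    and distinct: "\<And>i j. i \<in> I \<Longrightarrow> j \<in> I \<Longrightarrow> skew_brace_iso (M i) (M j) \<noteq> {} \<Longrightarrow> i = j"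
    and complete: "\<And>B :: nat ring. B \<in> skew_braces_of_type X Y \<Longrightarrow>
      \<exists>i\<in>I. skew_brace_iso B (M i) \<noteq> {}"
  shows "num_skew_braces X Y = card I"
proof -
  define S where "S = skew_braces_of_type X Y"
  define R where "R = {(B, C) \<in> S \<times> S. skew_brace_iso B C \<noteq> {}}"
  have eqv: "equiv S R"
    unfolding S_def R_def by (rule equiv_skew_brace_iso)
  have "\<forall>i\<in>I. \<exists>C. skew_brace C \<and> skew_brace_iso (M i) C \<noteq> {} \<and> C \<in> S"
  proof
    fix i assume that: "i \<in> I"
    note M = model[OF that]
    obtain C :: "nat ring" where C: "skew_brace C" "skew_brace_iso (M i) C \<noteq> {}"
      using skew_brace_nat_copy[of "M i"] M by auto
    obtain f where "f \<in> skew_brace_iso C (M i)"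
      using skew_brace_iso_sym[OF _ C(2)] M by auto
    then have "f \<in> iso (add_monoid C) (add_monoid (M i))" "f \<in> iso C (M i)"
      by (auto simp: skew_brace_iso_def iso_def hom_def bij_betw_apply)
    then have "add_monoid C \<cong> X" "C \<cong> Y"
      using M by (meson is_isoI iso_trans)+
    then show "\<exists>C. skew_brace C \<and> skew_brace_iso (M i) C \<noteq> {} \<and> C \<in> S"
      using C by (auto simp: S_def skew_braces_of_type_def)
  qed
  from bchoice[OF this] obtain C where C: "\<And>i. i \<in> I \<Longrightarrow> skew_brace (C i)"
      "\<And>i. i \<in> I \<Longrightarrow> skew_brace_iso (M i) (C i) \<noteq> {}" "\<And>i. i \<in> I \<Longrightarrow> C i \<in> S"
    by blast
  have backward: "skew_brace_iso (C i) (M i) \<noteq> {}" if "i \<in> I" for i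
    using skew_brace_iso_sym[OF _ C(2)[OF that]] model[OF that] by simp
  have "bij_betw (\<lambda>i. R `` {C i}) I (S // R)"
  proof (rule bij_betw_imageI)
    show "inj_on (\<lambda>i. R `` {C i}) I"
    proof (rule inj_onI)
      fix i j assume ij: "i \<in> I" "j \<in> I" "R `` {C i} = R `` {C j}"
      then have "(C i, C j) \<in> R"
        using eq_equiv_class_iff[OF eqv C(3)[OF ij(1)] C(3)[OF ij(2)]] by simp
      then have "skew_brace_iso (C i) (C j) \<noteq> {}"
        by (simp add: R_def)
      then have "skew_brace_iso (M i) (M j) \<noteq> {}"
        by (intro skew_brace_iso_trans[OF C(2)[OF ij(1)]] skew_brace_iso_trans[OF _ backward[OF ij(2)]])
      then show "i = j"
        by (rule distinct[OF ij(1,2)])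
    qed
    show "(\<lambda>i. R `` {C i}) ` I = S // R"
    proof (intro equalityI subsetI)
      fix K assume "K \<in> (\<lambda>i. R `` {C i}) ` I"
      then show "K \<in> S // R"
        using C(3) by (auto intro: quotientI)
    next
      fix K assume "K \<in> S // R"
      then obtain B where B: "B \<in> S" "K = R `` {B}"
        by (auto elim: quotientE)
      obtain i where i: "i \<in> I" "skew_brace_iso B (M i) \<noteq> {}"
        using complete[of B] B(1) unfolding S_def by blast
      then have "(B, C i) \<in> R"
        using skew_brace_iso_trans[OF i(2) C(2)[OF i(1)]] B(1) C(3)[OF i(1)] by (simp add: R_def)
      then have "K = R `` {C i}"
        by (simp add: B(2) equiv_class_eq[OF eqv])
      then show "K \<in> (\<lambda>i. R `` {C i}) ` I"
        using i(1) by blast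
    qed
  qed
  then show ?thesis
    by (simp add: bij_betw_same_card num_skew_braces_def skew_brace_classes_def S_def R_def)
qed

text \<open>The least period of \<open>t\<close> divides the prime q, and an orbit with q points
  does not fit into \<open>F\<close>, so the period is 1.\<close>

lemma prime_period_fixpoint:
  assumes q: "prime q" and F: "finite F" "card F < q"
    and orbit: "\<And>n. (f ^^ n) t \<in> F" and period: "(f ^^ q) t = t"
  shows "f t = t"
proof -
  have "\<not> inj_on (\<lambda>n. (f ^^ n) t) {..<q}"
    using card_inj_on_le[of "\<lambda>n. (f ^^ n) t" "{..<q}" F] F orbit by auto
  then obtain i j where ij: "i < j" "j < q" "(f ^^ i) t = (f ^^ j) t"
    unfolding inj_on_def by (metis lessThan_iff linorder_neqE_nat)
  have mult: "(f ^^ (m * n)) t = t" if "(f ^^ m) t = t" for m n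
    by (induction n) (use that in \<open>simp_all add: funpow_add\<close>)
  \<comment> \<open>The remaining q - i iterations undo the first i, so the collision at i and j
    becomes a return of \<open>t\<close> to itself after j - i steps, although \<open>f\<close> may
    fail to be injective.\<close>
  have "t = (f ^^ (q - i + i)) t"
    using ij period by simp
  also have "\<dots> = (f ^^ (q - i + j)) t"
    by (simp add: funpow_add ij)
  also have "q - i + j = (j - i) + q"
    using ij by simp
  also have "(f ^^ \<dots>) t = (f ^^ (j - i)) t"
    by (simp add: funpow_add period)
  finally have d: "(f ^^ (j - i)) t = t"
    by simp
  have "coprime q (j - i)"
    using ij q by (intro prime_imp_coprime) (auto dest: dvd_imp_le)
  then obtain x y where "(j - i) * x = q * y + 1"
    using bezout_nat[of "j - i" q] ij by (auto simp: coprime_iff_gcd_eq_1 gcd.commute)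
  then have "t = f ((f ^^ (q * y)) t)"
    using mult[OF d, of x] by simp
  then show ?thesis
    using mult[OF period, of y] by simp
qed

section \<open>The models\<close>

text \<open>Common frame for Z_{p^2} and Z_p x Z_p: S is an extension of Z_p by the subgroup
  generated by z, with quotient map \<open>h\<close>. The values of \<open>h\<close> are natural
  numbers because they serve as exponents of r; only their residues modulo p matter.\<close>

locale prime_square_data = comm_group S
  for S :: "'s monoid" (structure) +
  fixes z :: 's and h :: "'s \<Rightarrow> nat" and p q r :: nat
  assumes prime_p: "prime p" and p_gt_2: "p > 2" and prime_q: "prime q"
    and q_cong: "[q = 1] (mod p)" and q_not_cong: "\<not> [q = 1] (mod p\<^sup>2)"
    and ord_r: "Pocklington.ord q r = p"
    and order_S: "order S = p\<^sup>2"
    and z_closed [simp]: "z \<in> carrier S" and z_neq: "z \<noteq> \<one>" and z_pow_p: "z [^] p = \<one>"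
    and h_mult: "s \<in> carrier S \<Longrightarrow> t \<in> carrier S \<Longrightarrow> [h (s \<otimes> t) = h s + h t] (mod p)"
    and h_z: "[h z = 0] (mod p)"
    and h_kernel: "s \<in> carrier S \<Longrightarrow> [h s = 0] (mod p) \<Longrightarrow> \<exists>n. s = z [^] (n::nat)"
    and h_onto: "\<exists>e\<in>carrier S. h e = 1"
begin

lemma p_less_q: "p < q"
proof -
  have "p dvd q - 1"
    using q_cong prime_gt_1_nat[OF prime_q] by (simp add: cong_altdef_nat)
  then show ?thesis
    using prime_gt_1_nat[OF prime_q] by (auto dest!: dvd_imp_le)
qed

lemma finite_S: "finite (carrier S)"
  using order_S prime_gt_0_nat[OF prime_p] by (simp add: order_gt_0_iff_finite[symmetric])

lemma r_pow_cong_iff: "[int r ^ m = int r ^ n] (mod int q) \<longleftrightarrow> [m = n] (mod p)"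
proof -
  have "coprime q r"
    using ord_r prime_gt_0_nat[OF prime_p] Pocklington.ord_eq_0[of q r] by auto
  from order_divides_expdiff[OF this, of m n] show ?thesis
    by (simp add: ord_r flip: cong_int_iff)
qed

lemma r_pow_cong: "[m = n] (mod p) \<Longrightarrow> [int r ^ m = int r ^ n] (mod int q)"
  by (simp add: r_pow_cong_iff)

lemma prime_int_q: "prime (int q)"
  using prime_q by simp

lemma inverse_mod_q:
  assumes "\<not> int q dvd x"
  obtains y where "[x * y = 1] (mod int q)"
proof -
  have "coprime x (int q)"
    using assms prime_imp_coprime[OF prime_int_q] by (simp add: coprime_commute)
  then show thesis
    using cong_solve_coprime_int that by blast
qed

lemma z_pow_cong_iff: "z [^] (m::nat) = z [^] (n::nat) \<longleftrightarrow> [m = n] (mod p)"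
proof -
  have "ord z dvd p"
    using pow_eq_id[of z p] z_pow_p by simp
  moreover have "ord z \<noteq> 1"
    using pow_eq_id[of z 1] z_neq by simp
  ultimately have "ord z = p"
    using prime_p prime_nat_iff by blast
  then have "z [^] int m = z [^] int n \<longleftrightarrow> [int m = int n] (mod int p)"
    by (simp add: int_pow_eq cong_iff_dvd_diff dvd_diff_commute)
  then show ?thesis
    by (simp add: int_pow_int cong_int_iff)
qed

lemma z_pow_cong: "[m = n] (mod p) \<Longrightarrow> z [^] (m::nat) = z [^] (n::nat)"
  by (simp add: z_pow_cong_iff)

definition character :: "('s \<Rightarrow> nat) \<Rightarrow> bool" where
  "character g \<longleftrightarrow> (\<forall>s\<in>carrier S. \<forall>t\<in>carrier S. [g (s \<otimes> t) = g s + g t] (mod p))"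

lemma character_h: "character h"
  using h_mult by (simp add: character_def)

lemma character_one: "character g \<Longrightarrow> [g \<one> = 0] (mod p)"
  by (metis character_def cong_add_lcancel_0_nat cong_sym one_closed r_one)

lemma character_pow:
  assumes g: "character g" and s: "s \<in> carrier S"
  shows "[g (s [^] (n::nat)) = n * g s] (mod p)"
proof (induction n)
  case 0
  show ?case
    using character_one[OF g] by simp
next
  case (Suc n)
  have "[g (s [^] n \<otimes> s) = g (s [^] n) + g s] (mod p)"
    using g s by (simp add: character_def)
  then have "[g (s [^] n \<otimes> s) = n * g s + g s] (mod p)"
    using cong_add[OF Suc cong_refl] cong_trans by blast
  then show ?case
    by (simp add: add.commute)
qed

lemmas h_one = character_one[OF character_h]

lemmas h_pow = character_pow[OF character_h]

lemma h_z_pow: "[h (z [^] (n::nat)) = 0] (mod p)"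
  using h_pow[of z n] h_z by (metis cong_scalar_left cong_trans mult_0_right z_closed)

lemma h_mult_z_pow: "s \<in> carrier S \<Longrightarrow> [h (s \<otimes> z [^] (n::nat)) = h s] (mod p)"
  using h_mult[of s "z [^] n"] h_z_pow[of n]
  by (metis add.right_neutral cong_add cong_refl cong_trans nat_pow_closed z_closed)

lemma mult_z_pow:
  assumes "s \<in> carrier S" "t \<in> carrier S"
  shows "(s \<otimes> z [^] (m::nat)) \<otimes> (t \<otimes> z [^] (n::nat)) = s \<otimes> t \<otimes> z [^] (m + n)"
  using assms by (simp add: nat_pow_mult[symmetric] m_ac)

section \<open>Semidirect products with Z_q and the deformed multiplication on S\<close>

definition semidirect :: "('s \<Rightarrow> nat) \<Rightarrow> (int \<times> 's) monoid" where
  "semidirect g = \<lparr>carrier = {0..<int q} \<times> carrier S,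
     monoid.mult = (\<lambda>(a, s) (b, t). ((a + int r ^ g s * b) mod int q, s \<otimes> t)), one = (0, \<one>)\<rparr>"

lemma group_semidirect:
  assumes g: "character g"
  shows "group (semidirect g)"
proof (rule groupI)
  have q0: "int q > 0"
    using prime_gt_0_nat[OF prime_q] by simp
  fix x y w
  show "\<one>\<^bsub>semidirect g\<^esub> \<in> carrier (semidirect g)"
    using q0 by (simp add: semidirect_def)
  assume "x \<in> carrier (semidirect g)"
  then obtain a s where x: "x = (a, s)" "a \<in> {0..<int q}" "s \<in> carrier S"
    by (auto simp: semidirect_def)
  have "int r ^ g \<one> mod int q = 1"
    using r_pow_cong[OF character_one[OF g]] prime_gt_1_nat[OF prime_q] by (simp add: cong_def)
  then have "int r ^ g \<one> * a mod int q = a"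
    using x(2) by (metis atLeastLessThan_iff mod_mult_left_eq mod_pos_pos_trivial mult_1)
  then show "\<one>\<^bsub>semidirect g\<^esub> \<otimes>\<^bsub>semidirect g\<^esub> x = x"
    using x by (simp add: semidirect_def)
  define i where "i = (- (int r ^ g (inv s) * a)) mod int q"
  have "(i, inv s) \<otimes>\<^bsub>semidirect g\<^esub> x = \<one>\<^bsub>semidirect g\<^esub>"
    using x by (simp add: semidirect_def i_def mod_add_left_eq)
  then show "\<exists>y\<in>carrier (semidirect g). y \<otimes>\<^bsub>semidirect g\<^esub> x = \<one>\<^bsub>semidirect g\<^esub>"
    using x q0 by (intro bexI[of _ "(i, inv s)"]) (simp_all add: semidirect_def i_def)
  assume "y \<in> carrier (semidirect g)"
  then obtain b t where y: "y = (b, t)" "b \<in> {0..<int q}" "t \<in> carrier S"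
    by (auto simp: semidirect_def)
  show "x \<otimes>\<^bsub>semidirect g\<^esub> y \<in> carrier (semidirect g)"
    using x y q0 by (simp add: semidirect_def)
  assume "w \<in> carrier (semidirect g)"
  then obtain c u where w: "w = (c, u)" "c \<in> {0..<int q}" "u \<in> carrier S"
    by (auto simp: semidirect_def)
  have "[g (s \<otimes> t) = g s + g t] (mod p)"
    using g x y by (simp add: character_def)
  then have "[int r ^ g (s \<otimes> t) = int r ^ g s * int r ^ g t] (mod int q)"
    by (simp add: r_pow_cong flip: power_add)
  then have "[(a + int r ^ g s * b) mod int q + int r ^ g (s \<otimes> t) * c
      = (a + int r ^ g s * b) + (int r ^ g s * int r ^ g t) * c] (mod int q)"
    by (intro cong_add cong_mult) auto
  also have "(a + int r ^ g s * b) + (int r ^ g s * int r ^ g t) * c =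
      a + int r ^ g s * (b + int r ^ g t * c)"
    by (simp add: algebra_simps)
  also have "[\<dots> = a + int r ^ g s * ((b + int r ^ g t * c) mod int q)] (mod int q)"
    by (intro cong_add cong_mult) auto
  finally show "x \<otimes>\<^bsub>semidirect g\<^esub> y \<otimes>\<^bsub>semidirect g\<^esub> w =
      x \<otimes>\<^bsub>semidirect g\<^esub> (y \<otimes>\<^bsub>semidirect g\<^esub> w)"
    using x y w by (simp add: semidirect_def cong_def m_assoc)
qed

definition circ :: "nat \<Rightarrow> 's \<Rightarrow> 's \<Rightarrow> 's" where
  "circ c s t = s \<otimes> t \<otimes> z [^] (c * h s * h t)"

text \<open>
  As \<open>(p - 1) div 2\<close> represents \<open>-1/2\<close> modulo \<open>p\<close>, \<open>twist c\<close> completes the square: it carries \<open>circ c\<close>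
  to the multiplication of \<open>S\<close>.
\<close>

definition twist :: "nat \<Rightarrow> 's \<Rightarrow> 's" where
  "twist c s = s \<otimes> z [^] (c * ((p - 1) div 2) * (h s)\<^sup>2)"

definition untwist :: "nat \<Rightarrow> 's \<Rightarrow> 's" where
  "untwist c s = s \<otimes> z [^] (c * ((p + 1) div 2) * (h s)\<^sup>2)"

lemma circ_closed [simp]: "s \<in> carrier S \<Longrightarrow> t \<in> carrier S \<Longrightarrow> circ c s t \<in> carrier S"
  and twist_closed [simp]: "s \<in> carrier S \<Longrightarrow> twist c s \<in> carrier S"
  and untwist_closed [simp]: "s \<in> carrier S \<Longrightarrow> untwist c s \<in> carrier S"
  by (simp_all add: circ_def twist_def untwist_def)

lemma h_circ: "s \<in> carrier S \<Longrightarrow> t \<in> carrier S \<Longrightarrow> [h (circ c s t) = h s + h t] (mod p)"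
  unfolding circ_def by (meson cong_trans h_mult h_mult_z_pow m_closed)

lemma h_twist: "s \<in> carrier S \<Longrightarrow> [h (twist c s) = h s] (mod p)"
  and h_untwist: "s \<in> carrier S \<Longrightarrow> [h (untwist c s) = h s] (mod p)"
  by (simp_all add: twist_def untwist_def h_mult_z_pow)

lemma odd_p: "odd p"
  using prime_p p_gt_2 prime_odd_nat by blast

lemma untwist_twist: "s \<in> carrier S \<Longrightarrow> untwist c (twist c s) = s"
  and twist_untwist: "s \<in> carrier S \<Longrightarrow> twist c (untwist c s) = s"
proof -
  \<comment> \<open>The two coefficients represent -1/2 and 1/2 modulo p. As natural numbers they
    add up to p, which vanishes as an exponent of z.\<close>
  have half: "(p - 1) div 2 + (p + 1) div 2 = p"
    using odd_p by (auto elim!: oddE)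
  assume s: "s \<in> carrier S"
  \<comment> \<open>\<open>h\<close> is additive only modulo p, so \<open>h s\<close> and
    \<open>h (twist c s)\<close> may be different numbers; hence two independent exponents
    \<open>m\<close> and \<open>n\<close> in the same residue class.\<close>
  have *: "z [^] (c * ((p - 1) div 2) * m) \<otimes> z [^] (c * ((p + 1) div 2) * n) = \<one>"
    if "[m = (h s)\<^sup>2] (mod p)" "[n = (h s)\<^sup>2] (mod p)" for m n
  proof -
    have "[c * ((p - 1) div 2) * m + c * ((p + 1) div 2) * n
        = c * ((p - 1) div 2) * (h s)\<^sup>2 + c * ((p + 1) div 2) * (h s)\<^sup>2] (mod p)"
      using that by (intro cong_add cong_mult) auto
    also have "c * ((p - 1) div 2) * (h s)\<^sup>2 + c * ((p + 1) div 2) * (h s)\<^sup>2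
        = c * ((p - 1) div 2 + (p + 1) div 2) * (h s)\<^sup>2"
      by (simp only: distrib_left distrib_right)
    also have "[\<dots> = 0] (mod p)"
      by (simp only: half) (simp add: cong_def)
    finally show ?thesis
      using z_pow_cong by (simp add: nat_pow_mult)
  qed
  define T U where "T = twist c s" and "U = untwist c s"
  have "untwist c T = s \<otimes> (z [^] (c * ((p - 1) div 2) * (h s)\<^sup>2) \<otimes> z [^] (c * ((p + 1) div 2) * (h T)\<^sup>2))"
    using s by (simp add: untwist_def m_assoc) (simp add: T_def twist_def m_assoc)
  then show "untwist c (twist c s) = s"
    using s *[of "(h s)\<^sup>2" "(h T)\<^sup>2"] h_twist[OF s, of c] by (simp add: T_def cong_pow)
  have "twist c U = s \<otimes> (z [^] (c * ((p - 1) div 2) * (h U)\<^sup>2) \<otimes> z [^] (c * ((p + 1) div 2) * (h s)\<^sup>2))"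
    using s by (simp add: twist_def) (simp add: U_def untwist_def m_assoc m_comm)
  then show "twist c (untwist c s) = s"
    using s *[of "(h U)\<^sup>2" "(h s)\<^sup>2"] h_untwist[OF s, of c] by (simp add: U_def cong_pow)
qed

end

lemma mod_add_mult_mod_eq: "(a + b * (c mod m)) mod m = (a + b * c) mod m"
  for a b c m :: int
  by (metis mod_add_right_eq mod_mult_right_eq)

text \<open>In the additive groups considered here the elements killed by q are exactly those of Z_q
  (\<open>model_torsion\<close>, \<open>torsion_iff\<close>). This is therefore the case k = 0,
  expressed without coordinates so that isomorphisms preserve it.\<close>

definition left_trivial :: "nat \<Rightarrow> ('a, 'm) ring_scheme \<Rightarrow> bool" where
  "left_trivial q B \<longleftrightarrow> (\<forall>x\<in>carrier B. \<forall>y\<in>carrier B.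
     add_pow B q x = \<zero>\<^bsub>B\<^esub> \<longrightarrow> x \<otimes>\<^bsub>B\<^esub> y = x \<oplus>\<^bsub>B\<^esub> y)"

lemma skew_brace_iso_add_pow:
  assumes B: "skew_brace B" and C: "skew_brace C" and f: "f \<in> skew_brace_iso B C"
    and x: "x \<in> carrier B"
  shows "f (add_pow B (n::nat) x) = add_pow C n (f x)"
proof -
  interpret B: skew_brace B by (rule B)
  interpret C: skew_brace C by (rule C)
  interpret group_hom "add_monoid B" "add_monoid C" f
    using f B.add.is_group C.add.is_group
    by (auto simp: group_hom_def group_hom_axioms_def hom_def skew_brace_iso_def bij_betw_apply
        intro: B.add_group C.add_group)
  show ?thesis
    using hom_nat_pow[of x n] x by (simp add: add_pow_def)
qed

lemma left_trivial_iso: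
  assumes B: "skew_brace B" and C: "skew_brace C" and iso: "skew_brace_iso B C \<noteq> {}"
    and C_triv: "left_trivial q C"
  shows "left_trivial q B"
proof -
  interpret B: skew_brace B by (rule B)
  interpret C: skew_brace C by (rule C)
  obtain f where f: "f \<in> skew_brace_iso B C"
    using iso by blast
  then have bij: "bij_betw f (carrier B) (carrier C)"
    and add: "\<And>x y. x \<in> carrier B \<Longrightarrow> y \<in> carrier B \<Longrightarrow> f (x \<oplus>\<^bsub>B\<^esub> y) = f x \<oplus>\<^bsub>C\<^esub> f y"
    and mult: "\<And>x y. x \<in> carrier B \<Longrightarrow> y \<in> carrier B \<Longrightarrow> f (x \<otimes>\<^bsub>B\<^esub> y) = f x \<otimes>\<^bsub>C\<^esub> f y"
    by (auto simp: skew_brace_iso_def)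
  have closed: "f x \<in> carrier C" if "x \<in> carrier B" for x
    using bij that by (simp add: bij_betw_apply)
  have zero: "f \<zero>\<^bsub>B\<^esub> = \<zero>\<^bsub>C\<^esub>"
    using skew_brace_iso_add_pow[OF B C f, of "\<zero>\<^bsub>B\<^esub>" 0] by (simp add: add_pow_def)
  show ?thesis
    unfolding left_trivial_def
  proof (intro ballI impI)
    fix x y assume xy: "x \<in> carrier B" "y \<in> carrier B" "add_pow B q x = \<zero>\<^bsub>B\<^esub>"
    then have "add_pow C q (f x) = \<zero>\<^bsub>C\<^esub>"
      using skew_brace_iso_add_pow[OF B C f xy(1), of q] zero by simp
    then have "f x \<otimes>\<^bsub>C\<^esub> f y = f x \<oplus>\<^bsub>C\<^esub> f y"
      using C_triv closed xy by (simp add: left_trivial_def)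
    then have "f (x \<otimes>\<^bsub>B\<^esub> y) = f (x \<oplus>\<^bsub>B\<^esub> y)"
      using xy by (simp add: add mult)
    then show "x \<otimes>\<^bsub>B\<^esub> y = x \<oplus>\<^bsub>B\<^esub> y"
      using bij xy by (auto simp: bij_betw_def dest: inj_onD)
  qed
qed

section \<open>The model skew braces and the isomorphisms between them\<close>

context prime_square_data
begin

text \<open>Completing the square: twice the coefficient of \<open>twist c\<close> is
  \<open>c * (p - 1)\<close>, which represents -c, so the cross term of the squared sum cancels the
  exponent contributed by \<open>circ c\<close>.\<close>

lemma twist_circ:
  assumes s: "s \<in> carrier S" and t: "t \<in> carrier S"
  shows "twist c (circ c s t) = twist c s \<otimes> twist c t"
proof -
  let ?m = "c * ((p - 1) div 2)"
  have m: "2 * ?m = c * (p - 1)"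
    using odd_p by (auto elim!: oddE)
  have "[c * h s * h t + ?m * (h (circ c s t))\<^sup>2 = c * h s * h t + ?m * (h s + h t)\<^sup>2] (mod p)"
    using h_circ[OF s t, of c] by (intro cong_add cong_mult cong_pow) auto
  also have "c * h s * h t + ?m * (h s + h t)\<^sup>2 =
      c * h s * h t + (2 * ?m) * (h s * h t) + (?m * (h s)\<^sup>2 + ?m * (h t)\<^sup>2)"
    by (simp add: power2_eq_square algebra_simps)
  also have "c * h s * h t + (2 * ?m) * (h s * h t) = c * h s * h t * (1 + (p - 1))"
    by (simp only: m) (simp add: algebra_simps)
  also have "1 + (p - 1) = p"
    using p_gt_2 by simp
  also have "[c * h s * h t * p + (?m * (h s)\<^sup>2 + ?m * (h t)\<^sup>2) = ?m * (h s)\<^sup>2 + ?m * (h t)\<^sup>2] (mod p)"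
    by (simp add: cong_def)
  finally have *: "z [^] (c * h s * h t + ?m * (h (circ c s t))\<^sup>2) = z [^] (?m * (h s)\<^sup>2 + ?m * (h t)\<^sup>2)"
    by (rule z_pow_cong)
  have "twist c (circ c s t) = s \<otimes> t \<otimes> z [^] (c * h s * h t + ?m * (h (circ c s t))\<^sup>2)"
    unfolding twist_def[of c "circ c s t"]
    using s t by (subst circ_def) (simp add: m_assoc nat_pow_mult)
  then show ?thesis
    using s t unfolding * by (simp add: twist_def mult_z_pow)
qed

lemma untwist_mult:
  assumes "s \<in> carrier S" "t \<in> carrier S"
  shows "untwist c (s \<otimes> t) = circ c (untwist c s) (untwist c t)"
  using assms by (metis circ_closed twist_circ twist_untwist untwist_closed untwist_twist)

lemma untwist_one: "untwist c \<one> = \<one>"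
  using h_one z_pow_cong[of "c * ((p + 1) div 2) * (h \<one>)\<^sup>2" 0]
  by (simp add: untwist_def cong_0_iff power2_eq_square)

text \<open>Composing with \<open>twist c\<close> turns a character of S into a character of the
  group with multiplication \<open>circ c\<close>. Thus the parameter \<open>g\<close> ranges over
  characters of S itself, independently of c.\<close>

definition model :: "nat \<Rightarrow> ('s \<Rightarrow> nat) \<Rightarrow> (int \<times> 's) ring" where
  "model c g = \<lparr>carrier = {0..<int q} \<times> carrier S,
     monoid.mult = (\<lambda>(a, s) (b, t). ((a + int r ^ g (twist c s) * b) mod int q, circ c s t)),
     one = (0, \<one>), zero = (0, \<one>),
     add = (\<lambda>(a, s) (b, t). ((a + int r ^ h s * b) mod int q, s \<otimes> t))\<rparr>"

lemma model_simps:
  "carrier (model c g) = {0..<int q} \<times> carrier S"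
  "(a, s) \<otimes>\<^bsub>model c g\<^esub> (b, t) = ((a + int r ^ g (twist c s) * b) mod int q, circ c s t)"
  "\<one>\<^bsub>model c g\<^esub> = (0, \<one>)" "\<zero>\<^bsub>model c g\<^esub> = (0, \<one>)"
  "(a, s) \<oplus>\<^bsub>model c g\<^esub> (b, t) = ((a + int r ^ h s * b) mod int q, s \<otimes> t)"
  by (simp_all add: model_def)

lemma finite_model: "finite (carrier (model c g))"
  using finite_S by (simp add: model_simps)

lemma add_monoid_model: "add_monoid (model c g) = semidirect h"
  by (simp add: model_def semidirect_def)

lemma semidirect_iso_model:
  "(\<lambda>(a, s). (a, untwist c s)) \<in> iso (semidirect g) (model c g)"
proof -
  have "bij_betw (\<lambda>(a, s). (a, untwist c s)) (carrier (semidirect g)) (carrier (model c g))"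
    by (rule bij_betw_byWitness[where f' = "\<lambda>(a, s). (a, twist c s)"])
       (auto simp: semidirect_def model_def untwist_twist twist_untwist)
  then show ?thesis
    by (auto simp: iso_def hom_def semidirect_def model_def twist_untwist untwist_mult)
qed

lemma model_iso_semidirect: "character g \<Longrightarrow> model c g \<cong> semidirect g"
  using group.iso_sym[OF group_semidirect is_isoI[OF semidirect_iso_model]] .

lemma skew_brace_model:
  assumes g: "character g"
  shows "skew_brace (model c g)"
proof -
  \<comment> \<open>Solving \<open>x \<otimes> y = x \<oplus> L x y\<close> forces \<open>L\<close>
    to act on Z_q by the power of r with exponent \<open>g (twist c s) - h s\<close>; the natural
    number \<open>(p - 1) * h s\<close> stands for \<open>- h s\<close> modulo p.\<close>
  define L where "L = (\<lambda>(a :: int, s) (b, t).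
    ((int r ^ ((p - 1) * h s) * int r ^ g (twist c s) * b) mod int q, t \<otimes> z [^] (c * h s * h t)))"
  have q0: "int q > 0"
    using prime_gt_0_nat[OF prime_q] by simp
  show ?thesis
  proof (rule skew_braceI[where L = L])
    show "group (add_monoid (model c g))"
      unfolding add_monoid_model by (rule group_semidirect[OF character_h])
    have "(\<lambda>(a, s). (a, untwist c s)) \<one>\<^bsub>semidirect g\<^esub> = \<one>\<^bsub>model c g\<^esub>"
      by (simp add: semidirect_def model_def untwist_one)
    then have "model c g\<lparr>one := (\<lambda>(a, s). (a, untwist c s)) \<one>\<^bsub>semidirect g\<^esub>\<rparr> = model c g"
      by simp
    then show "group (model c g)"
      using group.iso_imp_img_group[OF group_semidirect[OF g] semidirect_iso_model] by metis
    fix x y w assume xy: "x \<in> carrier (model c g)" "y \<in> carrier (model c g)"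
    then obtain a s b t where x: "x = (a, s)" "s \<in> carrier S" and y: "y = (b, t)" "t \<in> carrier S"
      by (auto simp: model_simps)
    show "L x y \<in> carrier (model c g)"
      using x y q0 by (simp add: L_def model_simps)
    have "h s + (p - 1) * h s = p * h s"
      using p_gt_2 by (cases p) auto
    then have "[h s + (p - 1) * h s = 0] (mod p)"
      by (simp add: cong_def)
    then have "[int r ^ h s * int r ^ ((p - 1) * h s) = 1] (mod int q)"
      using r_pow_cong_iff[of "h s + (p - 1) * h s" 0] by (simp add: power_add)
    then have "[a + (int r ^ h s * int r ^ ((p - 1) * h s)) * (int r ^ g (twist c s) * b)
        = a + 1 * (int r ^ g (twist c s) * b)] (mod int q)"
      by (intro cong_add cong_mult) auto
    moreover have "[a + int r ^ h s * (int r ^ ((p - 1) * h s) * int r ^ g (twist c s) * b mod int q)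
        = a + int r ^ h s * (int r ^ ((p - 1) * h s) * int r ^ g (twist c s) * b)] (mod int q)"
      by (intro cong_add cong_mult) auto
    ultimately have "(a + int r ^ h s * (int r ^ ((p - 1) * h s) * int r ^ g (twist c s) * b mod int q)) mod int q
        = (a + int r ^ g (twist c s) * b) mod int q"
      by (simp add: cong_def mult.assoc)
    then show "x \<otimes>\<^bsub>model c g\<^esub> y = x \<oplus>\<^bsub>model c g\<^esub> L x y"
      using x y by (simp add: L_def model_simps circ_def m_assoc)
    assume "w \<in> carrier (model c g)"
    then obtain d u where w: "w = (d, u)" "u \<in> carrier S"
      by (auto simp: model_simps)
    let ?R = "int r ^ ((p - 1) * h s) * int r ^ g (twist c s)"
    have "?R * (b + int r ^ h t * d) = ?R * b + int r ^ h t * (?R * d)"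
      by (simp add: algebra_simps)
    also have "[\<dots> = ?R * b + int r ^ h (t \<otimes> z [^] (c * h s * h t)) * (?R * d)] (mod int q)"
      by (intro cong_add cong_mult r_pow_cong cong_sym[OF h_mult_z_pow]) (auto simp: y)
    finally have *: "[?R * (b + int r ^ h t * d) =
      ?R * b + int r ^ h (t \<otimes> z [^] (c * h s * h t)) * (?R * d)] (mod int q)" .
    have "[c * h s * h (t \<otimes> u) = c * h s * (h t + h u)] (mod p)"
      using h_mult[OF y(2) w(2)] by (intro cong_mult) auto
    then have "z [^] (c * h s * h (t \<otimes> u)) = z [^] (c * h s * h t + c * h s * h u)"
      by (intro z_pow_cong) (simp add: algebra_simps)
    then show "L x (y \<oplus>\<^bsub>model c g\<^esub> w) = L x y \<oplus>\<^bsub>model c g\<^esub> L x w"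
      using y w x * by (simp add: L_def model_simps mult_z_pow cong_def mod_simps mod_add_mult_mod_eq)
  qed
qed

lemma add_pow_model:
  assumes "s \<in> carrier S"
  shows "\<exists>b. add_pow (model c g) (n::nat) (a, s) = (b, s [^] n)"
  by (induction n) (auto simp: add_pow_def model_def)

lemma pow_q_eq_one:
  assumes "s \<in> carrier S" "s [^] q = \<one>"
  shows "s = \<one>"
proof -
  have "\<not> q dvd p"
    using p_less_q prime_p by (auto dest: dvd_imp_le simp: prime_gt_0_nat)
  then have "coprime q (p\<^sup>2)"
    using prime_imp_coprime[OF prime_q] by simp
  moreover have "ord s dvd q" "ord s dvd p\<^sup>2"
    using assms pow_eq_id[OF assms(1)] pow_order_eq_1[OF assms(1)] by (auto simp: order_S)
  ultimately have "ord s = 1"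
    by (meson coprime_common_divisor_nat)
  then show ?thesis
    using assms(1) ord_eq_1 by blast
qed

lemma model_torsion:
  assumes "x \<in> carrier (model c g)"
  shows "add_pow (model c g) q x = \<zero>\<^bsub>model c g\<^esub> \<longleftrightarrow> snd x = \<one>"
proof -
  obtain a s where x: "x = (a, s)" "s \<in> carrier S"
    using assms by (auto simp: model_simps)
  have "[int r ^ h \<one> = 1] (mod int q)"
    using r_pow_cong[OF h_one] by simp
  then have *: "[b + int r ^ h \<one> * a = b + 1 * a] (mod int q)" for b
    by (intro cong_add cong_mult) auto
  have "add_pow (model c g) n (a, \<one>) = ((int n * a) mod int q, \<one>)" for n :: nat
  proof (induction n)
    case (Suc n)
    then show ?case
      using *[of "int n * a"]
      by (simp add: add_pow_def model_def cong_def mod_simps algebra_simps)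
  qed (simp add: add_pow_def model_def)
  then show ?thesis
    using pow_q_eq_one[OF x(2)] add_pow_model[OF x(2), of c g q a] by (auto simp: x model_simps)
qed

text \<open>It suffices to extend \<open>f\<close> by the identity on Z_q: preserving
  \<open>h\<close> and \<open>g\<close> matches the actions on Z_q, and the condition on z carries
  the correction factor of \<open>circ c\<close> to that of \<open>circ c'\<close>.\<close>

lemma model_iso_model:
  assumes f: "f \<in> iso S S" and hf: "\<And>s. s \<in> carrier S \<Longrightarrow> [h (f s) = h s] (mod p)"
    and gf: "\<And>s. s \<in> carrier S \<Longrightarrow> [g' (f s) = g s] (mod p)"
    and fz: "f z [^] c = z [^] c'"
  shows "skew_brace_iso (model c g) (model c' g') \<noteq> {}"
proof -
  interpret f: group_hom S S f
    using f by (auto simp: group_hom_def group_hom_axioms_def iso_def is_group)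
  have f_pow: "f (z [^] (c * n)) = z [^] (c' * n)" for n :: nat
    by (metis f.hom_closed f.hom_nat_pow fz nat_pow_pow z_closed)
  have circ: "f (circ c s t) = circ c' (f s) (f t)" if "s \<in> carrier S" "t \<in> carrier S" for s t
  proof -
    have "[c' * (h (f s) * h (f t)) = c' * (h s * h t)] (mod p)"
      using hf that by (intro cong_mult) auto
    then show ?thesis
      using that f_pow[of "h s * h t"] z_pow_cong by (simp add: circ_def mult.assoc)
  qed
  have twist: "f (twist c s) = twist c' (f s)" if "s \<in> carrier S" for s
  proof -
    have "[c' * (((p - 1) div 2) * (h (f s))\<^sup>2) = c' * (((p - 1) div 2) * (h s)\<^sup>2)] (mod p)"
      using hf that by (intro cong_mult cong_pow) auto
    then show ?thesis
      using that f_pow[of "((p - 1) div 2) * (h s)\<^sup>2"] z_pow_cong by (simp add: twist_def mult.assoc)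
  qed
  have bij: "bij_betw f (carrier S) (carrier S)"
    using f by (simp add: iso_def)
  have h_cong: "[a + int r ^ h (f s) * b = a + int r ^ h s * b] (mod int q)" if "s \<in> carrier S" for a b s
    using hf that by (intro cong_add cong_mult r_pow_cong) auto
  have g_cong: "[a + int r ^ g' (twist c' (f s)) * b = a + int r ^ g (twist c s) * b] (mod int q)"
    if "s \<in> carrier S" for a b s
    using gf[of "twist c s"] that twist by (intro cong_add cong_mult r_pow_cong) auto
  have "(\<lambda>(a, s). (a, f s)) \<in> skew_brace_iso (model c g) (model c' g')"
    using circ bij h_cong g_cong bij_betw_map_prod[OF bij_betw_id bij, of "{0..<int q}"]
    by (auto simp: skew_brace_iso_def model_def map_prod_def cong_def)
  then show ?thesis
    by blast
qed

text \<open>An isomorphism F preserves the q-torsion, hence Z_q, and induces an automorphism f of S.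
  It may move the complement of Z_q by some \<open>w s\<close>, but evaluating F on the sum and on
  the product of \<open>(0, s)\<close> and \<open>(1, \<one>)\<close> in two ways puts the same
  \<open>w s\<close> on both sides; cancelling it, and then the invertible image \<open>u\<close> of
  1, leaves the exponents.\<close>

lemma model_iso_modelD:
  assumes g: "character g" and g': "character g'"
    and iso: "skew_brace_iso (model c g) (model c' g') \<noteq> {}"
  obtains f where "f \<in> iso S S" "\<And>s. s \<in> carrier S \<Longrightarrow> [h (f s) = h s] (mod p)"
    "\<And>s. s \<in> carrier S \<Longrightarrow> [g' (f s) = g s] (mod p)" "f z [^] c = z [^] c'"
proof -
  have q1: "int q > 1"
    using prime_gt_1_nat[OF prime_q] by simp
  obtain F where F: "F \<in> skew_brace_iso (model c g) (model c' g')"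
    using iso by blast
  then have bij: "bij_betw F (carrier (model c g)) (carrier (model c' g'))"
    and add: "\<And>x y. x \<in> carrier (model c g) \<Longrightarrow> y \<in> carrier (model c g) \<Longrightarrow>
      F (x \<oplus>\<^bsub>model c g\<^esub> y) = F x \<oplus>\<^bsub>model c' g'\<^esub> F y"
    and mult: "\<And>x y. x \<in> carrier (model c g) \<Longrightarrow> y \<in> carrier (model c g) \<Longrightarrow>
      F (x \<otimes>\<^bsub>model c g\<^esub> y) = F x \<otimes>\<^bsub>model c' g'\<^esub> F y"
    by (auto simp: skew_brace_iso_def)
  note pow = skew_brace_iso_add_pow[OF skew_brace_model[OF g] skew_brace_model[OF g'] F]
  have in_M: "(a, s) \<in> carrier (model c g) \<longleftrightarrow> 0 \<le> a \<and> a < int q \<and> s \<in> carrier S" for a s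
    by (auto simp: model_simps)
  have F_closed: "F x \<in> carrier (model c' g')" if "x \<in> carrier (model c g)" for x
    using bij that by (rule bij_betw_apply)
  have zero: "F (0, \<one>) = (0, \<one>)"
    using pow[of "(0, \<one>)" 0] q1 by (simp add: add_pow_def model_def)
  have tors: "snd (F (a, \<one>)) = \<one>" if "0 \<le> a" "a < int q" for a
  proof -
    have x: "(a, \<one>) \<in> carrier (model c g)"
      using that by (simp add: in_M)
    then have "add_pow (model c' g') q (F (a, \<one>)) = (0, \<one>)"
      using model_torsion[OF x] pow[OF x, of q] zero by (simp add: model_simps)
    then show ?thesis
      using model_torsion[OF F_closed[OF x]] by (simp add: model_simps)
  qed
  define u where "u = fst (F (1, \<one>))"
  define w where "w s = fst (F (0, s))" for s
  define f where "f s = snd (F (0, s))" for s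
  have f_closed [simp]: "f s \<in> carrier S" if "s \<in> carrier S" for s
    using F_closed[of "(0, s)"] q1 that by (auto simp: f_def model_def)
  have F0: "F (0, s) = (w s, f s)" for s
    by (simp add: w_def f_def)
  have F1: "F (1, \<one>) = (u, \<one>)"
    using tors[of 1] q1 by (simp add: u_def prod_eq_iff)
  have h1: "[int r ^ h \<one> = 1] (mod int q)"
    using r_pow_cong[OF h_one] by simp
  have h1': "[b + int r ^ h \<one> * a = b + a] (mod int q)" for a b
    using cong_add[OF cong_refl[of b] cong_mult[OF h1 cong_refl[of a]]] by simp
  have Fn: "F (int n mod int q, \<one>) = ((int n * u) mod int q, \<one>)" for n
  proof (induction n)
    case (Suc n)
    have "(int (Suc n) mod int q, \<one>) = (int n mod int q, \<one>) \<oplus>\<^bsub>model c g\<^esub> (1, \<one>)"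
      using h1'[of "int n" 1] by (simp add: model_def cong_def mod_simps algebra_simps)
    also have "F \<dots> = ((int n * u) mod int q, \<one>) \<oplus>\<^bsub>model c' g'\<^esub> (u, \<one>)"
      using q1 by (subst add) (simp_all add: in_M Suc F1)
    also have "\<dots> = ((int (Suc n) * u) mod int q, \<one>)"
      using h1'[of "int n * u" u] by (simp add: model_def cong_def mod_simps algebra_simps)
    finally show ?case .
  qed (simp add: zero)
  have F_eq: "F (int n mod int q, s) = ((int n * u + w s) mod int q, f s)"
    if "s \<in> carrier S" for s n
  proof -
    have "(int n mod int q, s) = (int n mod int q, \<one>) \<oplus>\<^bsub>model c g\<^esub> (0, s)"
      using that by (simp add: model_def)
    also have "F \<dots> = ((int n * u) mod int q, \<one>) \<oplus>\<^bsub>model c' g'\<^esub> (w s, f s)"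
      using q1 that by (subst add) (simp_all add: in_M Fn F0)
    also have "\<dots> = ((int n * u + w s) mod int q, f s)"
      using that h1'[of "int n * u" "w s"] by (simp add: model_def cong_def mod_simps)
    finally show ?thesis .
  qed
  have f_mult: "f (s \<otimes> t) = f s \<otimes> f t" if "s \<in> carrier S" "t \<in> carrier S" for s t
    using add[of "(0, s)" "(0, t)"] that q1 by (simp add: in_M F0) (simp add: model_def F0)
  have f_circ: "f (circ c s t) = circ c' (f s) (f t)" if "s \<in> carrier S" "t \<in> carrier S" for s t
    using mult[of "(0, s)" "(0, t)"] that q1 by (simp add: in_M F0) (simp add: model_def F0)
  have "carrier S \<subseteq> f ` carrier S"
  proof
    fix t assume t: "t \<in> carrier S"
    then have "(0, t) \<in> F ` carrier (model c g)"
      using bij q1 by (auto simp: bij_betw_def model_simps)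
    then obtain a s where as: "0 \<le> a" "a < int q" "s \<in> carrier S" "F (a, s) = (0, t)"
      by (auto simp: model_simps)
    then have "a = int (nat a) mod int q"
      by simp
    then have "t = f s"
      using F_eq[OF as(3), of "nat a"] as(4) by simp
    then show "t \<in> f ` carrier S"
      using as(3) by blast
  qed
  then have surj: "f ` carrier S = carrier S"
    by auto
  then have "bij_betw f (carrier S) (carrier S)"
    using finite_S by (simp add: bij_betw_def eq_card_imp_inj_on)
  then have f: "f \<in> iso S S"
    by (auto simp: iso_def hom_def f_mult)
  interpret f: group_hom S S f
    using f by (auto simp: group_hom_def group_hom_axioms_def iso_def is_group)
  have u: "\<not> int q dvd u"
  proof
    assume "int q dvd u"
    moreover have "0 \<le> u" "u < int q"
      using F_closed[of "(1, \<one>)"] F1 q1 by (simp_all add: model_simps)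
    ultimately have "u = 0"
      by (metis order_le_less zdvd_not_zless)
    then have "F (1, \<one>) = (0, \<one>)"
      using F1 by metis
    then have "(1 :: int, \<one>) = (0, \<one>)"
      using inj_onD[OF bij_betw_imp_inj_on[OF bij], of "(1, \<one>)" "(0, \<one>)"] zero q1
      by (simp add: in_M)
    then show False
      by simp
  qed
  have cancel: "[m = n] (mod p)" if "[w + int r ^ m * u = int r ^ n * u + w] (mod int q)" for m n w
  proof -
    have "[int r ^ m * u = int r ^ n * u] (mod int q)"
      using that by (simp add: add.commute[of _ w] cong_add_lcancel)
    moreover have "coprime u (int q)"
      using u prime_imp_coprime[OF prime_int_q] by (simp add: coprime_commute)
    ultimately show ?thesis
      by (simp add: cong_mult_rcancel r_pow_cong_iff)
  qed
  have hf: "[h (f s) = h s] (mod p)" if s: "s \<in> carrier S" for s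
  proof (rule cancel)
    have "F (int (r ^ h s) mod int q, s) = F ((0, s) \<oplus>\<^bsub>model c g\<^esub> (1, \<one>))"
      using s by (simp add: model_def)
    also have "\<dots> = (w s, f s) \<oplus>\<^bsub>model c' g'\<^esub> (u, \<one>)"
      using q1 s by (subst add) (simp_all add: in_M F0 F1)
    finally show "[w s + int r ^ h (f s) * u = int r ^ h s * u + w s] (mod int q)"
      using F_eq[OF s, of "r ^ h s"] s by (simp add: model_def cong_def)
  qed
  have circ_one: "circ d s \<one> = s" if "s \<in> carrier S" for d s
    using that z_pow_cong[of "d * h s * h \<one>" 0] h_one by (simp add: circ_def cong_0_iff)
  have gf: "[g' (twist c' (f s)) = g (twist c s)] (mod p)" if s: "s \<in> carrier S" for s
  proof (rule cancel)
    have "F (int (r ^ g (twist c s)) mod int q, s) = F ((0, s) \<otimes>\<^bsub>model c g\<^esub> (1, \<one>))"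
      using s by (simp add: model_def circ_one)
    also have "\<dots> = (w s, f s) \<otimes>\<^bsub>model c' g'\<^esub> (u, \<one>)"
      using q1 s by (subst mult) (simp_all add: in_M F0 F1)
    finally show "[w s + int r ^ g' (twist c' (f s)) * u = int r ^ g (twist c s) * u + w s] (mod int q)"
      using F_eq[OF s, of "r ^ g (twist c s)"] s by (simp add: model_def cong_def)
  qed
  obtain e where e: "e \<in> carrier S" "h e = 1"
    using h_onto by blast
  \<comment> \<open>Because \<open>h e = 1\<close>, the factor by which \<open>circ c e e\<close>
    differs from the square of e is exactly the c-th power of z.\<close>
  have "f e \<otimes> f e \<otimes> f z [^] c = f (circ c e e)"
    using e by (simp add: circ_def f_mult f.hom_nat_pow)
  also have "\<dots> = f e \<otimes> f e \<otimes> z [^] (c' * h (f e) * h (f e))"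
    by (simp only: f_circ[OF e(1) e(1)] circ_def[of c' "f e" "f e"])
  also have "z [^] (c' * h (f e) * h (f e)) = z [^] (c' * 1 * 1)"
    using hf[OF e(1)] e by (intro z_pow_cong cong_mult) auto
  finally have fz: "f z [^] c = z [^] c'"
    using e left_cancel[of "f e \<otimes> f e"] by simp
  have f_pow: "f (z [^] (c * n)) = z [^] (c' * n)" for n :: nat
    by (metis f.hom_closed f.hom_nat_pow fz nat_pow_pow z_closed)
  have "[g' (f s) = g s] (mod p)" if s: "s \<in> carrier S" for s
  proof -
    have "twist c' (f t) = f (twist c t)" if t: "t \<in> carrier S" for t
    proof -
      have "[c' * (((p - 1) div 2) * (h (f t))\<^sup>2) = c' * (((p - 1) div 2) * (h t)\<^sup>2)] (mod p)"
        using hf t by (intro cong_mult cong_pow) auto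
      from z_pow_cong[OF this] show ?thesis
        using t f_pow[of "((p - 1) div 2) * (h t)\<^sup>2"] by (simp add: twist_def mult.assoc f_mult)
    qed
    then show ?thesis
      using gf[of "untwist c s"] s by (simp add: twist_untwist)
  qed
  then show thesis
    using that f hf fz by blast
qed

lemma left_trivial_model:
  assumes g: "character g"
  shows "left_trivial q (model c g)"
  unfolding left_trivial_def
proof (intro ballI impI)
  fix x y assume xy: "x \<in> carrier (model c g)" "y \<in> carrier (model c g)"
    "add_pow (model c g) q x = \<zero>\<^bsub>model c g\<^esub>"
  then obtain a b t where x: "x = (a, \<one>)" and y: "y = (b, t)" "t \<in> carrier S"
    using model_torsion[OF xy(1)] by (cases x; cases y) (auto simp: model_simps)
  have "twist c \<one> = \<one>"
    by (metis one_closed twist_untwist untwist_one)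
  then have "[int r ^ g (twist c \<one>) = int r ^ h \<one>] (mod int q)"
    using character_one[OF g] h_one by (intro r_pow_cong) (metis cong_sym cong_trans)
  then have "[a + int r ^ g (twist c \<one>) * b = a + int r ^ h \<one> * b] (mod int q)"
    by (intro cong_add cong_mult) auto
  moreover have "circ c \<one> t = t"
    using y z_pow_cong[of "c * h \<one> * h t" 0] h_one by (simp add: circ_def cong_0_iff)
  ultimately show "x \<otimes>\<^bsub>model c g\<^esub> y = x \<oplus>\<^bsub>model c g\<^esub> y"
    using x y by (simp add: model_def cong_def)
qed

text \<open>If both a model and its opposite were left trivial, Z_q would commute additively with an
  element e with \<open>h e = 1\<close>, although e acts on Z_q as multiplication by r. This keeps
  the models and their opposites apart.\<close>

lemma not_left_trivial_opposite_model:
  assumes g: "character g"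
  shows "\<not> left_trivial q (opposite_brace (model c g))"
proof
  assume triv: "left_trivial q (opposite_brace (model c g))"
  obtain e where e: "e \<in> carrier S" "h e = 1"
    using h_onto by blast
  have q1: "int q > 1"
    using prime_gt_1_nat[OF prime_q] by simp
  have x: "(1, \<one>) \<in> carrier (model c g)" and y: "(0, e) \<in> carrier (model c g)"
    using q1 e by (auto simp: model_simps)
  have "add_pow (model c g) q (1, \<one>) = \<zero>\<^bsub>model c g\<^esub>"
    using model_torsion[OF x] by simp
  then have "(1, \<one>) \<oplus>\<^bsub>model c g\<^esub> (0, e) = (0, e) \<oplus>\<^bsub>model c g\<^esub> (1, \<one>)"
    using triv x y left_trivial_model[OF g]
    by (simp add: left_trivial_def skew_brace.add_pow_opposite_brace[OF skew_brace_model[OF g]])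
  then have "[int r ^ 0 = int r ^ 1] (mod int q)"
    using e by (simp add: model_def cong_def)
  then have "[0 = 1::nat] (mod p)"
    by (simp only: r_pow_cong_iff)
  then show False
    using p_gt_2 by (simp add: cong_def)
qed

end

section \<open>Coordinates on a skew brace\<close>

context prime_square_data
begin

lemma fibre_h:
  assumes s: "s \<in> carrier S" and t: "t \<in> carrier S" and eq: "[h t = h s] (mod p)"
  shows "\<exists>n<p. t = s \<otimes> z [^] n"
proof -
  have "[h s + h (inv s \<otimes> t) = h t] (mod p)"
    using h_mult[of s "inv s \<otimes> t"] s t by (simp add: cong_sym_eq flip: m_assoc)
  then have "[h s + h (inv s \<otimes> t) = h s + 0] (mod p)"
    using eq cong_trans by fastforce
  then have "[h (inv s \<otimes> t) = 0] (mod p)"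
    by (simp only: cong_add_lcancel_nat)
  then obtain n :: nat where n: "inv s \<otimes> t = z [^] n"
    using h_kernel s t by (metis inv_closed m_closed)
  have "t = s \<otimes> (inv s \<otimes> t)"
    using s t by (simp flip: m_assoc)
  also have "\<dots> = s \<otimes> z [^] (n mod p)"
    using n z_pow_cong[of "n mod p" n] by (simp add: cong_def)
  finally show ?thesis
    using prime_gt_0_nat[OF prime_p] mod_less_divisor by blast
qed

lemma card_fibre_h:
  assumes s: "s \<in> carrier S"
  shows "card {t \<in> carrier S. [h t = h s] (mod p)} < q"
proof -
  have "{t \<in> carrier S. [h t = h s] (mod p)} \<subseteq> (\<lambda>n. s \<otimes> z [^] n) ` {..<p}"
    using fibre_h[OF s] by auto
  then have "card {t \<in> carrier S. [h t = h s] (mod p)} \<le> card {..<p}"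
    by (meson card_image_le card_mono finite_imageI finite_lessThan le_trans)
  then show ?thesis
    using p_less_q by simp
qed

text \<open>S is abelian, so expanding \<open>\<theta>\<close> on the two products of s and e gives
  \<open>\<theta> s * (1 - r) = \<theta> e * (1 - r ^ h s)\<close> modulo q when
  \<open>h e = 1\<close>, and 1 - r is invertible because r has order p > 1.\<close>

lemma coboundary:
  fixes \<theta> :: "'s \<Rightarrow> int"
  assumes "\<And>s t. s \<in> carrier S \<Longrightarrow> t \<in> carrier S \<Longrightarrow>
    [\<theta> (s \<otimes> t) = \<theta> s + int r ^ h s * \<theta> t] (mod int q)"
  shows "\<exists>w. \<forall>s\<in>carrier S. [\<theta> s = w * (1 - int r ^ h s)] (mod int q)"
proof -
  obtain e where e: "e \<in> carrier S" "h e = 1"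
    using h_onto by blast
  have "\<not> [int r ^ h e = int r ^ 0] (mod int q)"
    using p_gt_2 by (subst r_pow_cong_iff) (simp add: e cong_def)
  then have "\<not> int q dvd 1 - int r ^ h e"
    by (metis cong_iff_dvd_diff cong_sym power_0)
  then obtain y where y: "[(1 - int r ^ h e) * y = 1] (mod int q)"
    by (rule inverse_mod_q)
  have "[\<theta> s = \<theta> e * y * (1 - int r ^ h s)] (mod int q)" if s: "s \<in> carrier S" for s
  proof -
    have "[\<theta> s + int r ^ h s * \<theta> e = \<theta> e + int r ^ h e * \<theta> s] (mod int q)"
      using assms[OF s e(1)] assms[OF e(1) s] m_comm[OF s e(1)] by (metis cong_sym cong_trans)
    then have "int q dvd (\<theta> s + int r ^ h s * \<theta> e) - (\<theta> e + int r ^ h e * \<theta> s)"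
      by (simp only: cong_iff_dvd_diff)
    moreover have "int q dvd (1 - int r ^ h e) * y - 1"
      using y by (simp only: cong_iff_dvd_diff)
    ultimately have "int q dvd y * ((\<theta> s + int r ^ h s * \<theta> e) - (\<theta> e + int r ^ h e * \<theta> s))
        - \<theta> s * ((1 - int r ^ h e) * y - 1)"
      by (meson dvd_diff dvd_mult)
    then show ?thesis
      by (simp add: cong_iff_dvd_diff algebra_simps)
  qed
  then show ?thesis
    by blast
qed

end

text \<open>The first coordinate is an arbitrary integer and equality is taken modulo q, so no
  reductions appear in the computations. Only the addition is prescribed; the multiplication is the
  unknown.\<close>

locale brace_coordinates = S: prime_square_data S z h p q r + skew_brace B
  for S :: "'s monoid" and z :: 's and h :: "'s \<Rightarrow> nat" and p q r :: nat
    and B :: "'b ring" (structure) +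
  fixes E :: "int \<Rightarrow> 's \<Rightarrow> 'b"
  assumes E_closed [simp]: "s \<in> carrier S \<Longrightarrow> E a s \<in> carrier B"
    and E_eq_iff: "s \<in> carrier S \<Longrightarrow> t \<in> carrier S \<Longrightarrow>
      E a s = E b t \<longleftrightarrow> [a = b] (mod int q) \<and> s = t"
    and E_surj: "x \<in> carrier B \<Longrightarrow> \<exists>a. \<exists>s\<in>carrier S. x = E a s"
    and E_add: "s \<in> carrier S \<Longrightarrow> t \<in> carrier S \<Longrightarrow>
      E a s \<oplus> E b t = E (a + int r ^ h s * b) (s \<otimes>\<^bsub>S\<^esub> t)"
begin

abbreviation R :: "'s \<Rightarrow> int" where "R s \<equiv> int r ^ h s"

abbreviation Q :: "int \<Rightarrow> 'b" where "Q a \<equiv> E a \<one>\<^bsub>S\<^esub>"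

lemma E_cong: "s \<in> carrier S \<Longrightarrow> [a = b] (mod int q) \<Longrightarrow> E a s = E b s"
  by (simp add: E_eq_iff)

lemma R_one: "[R \<one>\<^bsub>S\<^esub> = 1] (mod int q)"
  using S.r_pow_cong[OF S.h_one] by simp

lemma R_mult: "s \<in> carrier S \<Longrightarrow> t \<in> carrier S \<Longrightarrow> [R (s \<otimes>\<^bsub>S\<^esub> t) = R s * R t] (mod int q)"
  using S.r_pow_cong[OF S.h_mult] by (simp add: power_add)

lemma Q_add:
  assumes "s \<in> carrier S"
  shows "Q a \<oplus> E b s = E (a + b) s"
proof -
  have "[a + R \<one>\<^bsub>S\<^esub> * b = a + 1 * b] (mod int q)"
    by (intro cong_add cong_mult R_one) auto
  then show ?thesis
    using assms by (simp add: E_add E_eq_iff)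
qed

lemma add_Q: "s \<in> carrier S \<Longrightarrow> E b s \<oplus> Q a = E (b + R s * a) s"
  by (simp add: E_add)

lemma Q_zero: "Q 0 = \<zero>"
proof -
  have "Q 0 \<oplus> Q 0 = Q 0"
    by (simp add: Q_add)
  then show ?thesis
    by (metis E_closed S.one_closed add.l_cancel_one)
qed

lemma Q_eq_iff: "Q a = Q b \<longleftrightarrow> [a = b] (mod int q)"
  by (simp add: E_eq_iff)

lemma E_split: "s \<in> carrier S \<Longrightarrow> E a s = Q a \<oplus> E 0 s"
  by (simp add: Q_add)

lemma int_mod_q: obtains n :: nat where "[a = int n] (mod int q)"
proof
  show "[a = int (nat (a mod int q))] (mod int q)"
    using prime_gt_0_nat[OF S.prime_q] by (simp add: cong_def)
qed

lemma add_pow_Q: "add_pow B n (Q a) = Q (int n * a)" for n :: nat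
  by (induction n) (simp_all add: Q_zero Q_add algebra_simps)

lemma torsion_iff:
  assumes "x \<in> carrier B"
  shows "add_pow B q x = \<zero> \<longleftrightarrow> (\<exists>a. x = Q a)"
proof
  assume tors: "add_pow B q x = \<zero>"
  obtain a s where x: "x = E a s" "s \<in> carrier S"
    using E_surj assms by blast
  have "\<exists>b. add_pow B n (E a s) = E b (s [^]\<^bsub>S\<^esub> n)" for n :: nat
  proof (induction n)
    case 0
    show ?case
      using Q_zero by (auto intro: exI[of _ 0])
  next
    case (Suc n)
    then show ?case
      using x(2) by (auto simp: E_add)
  qed
  then obtain b where "E b (s [^]\<^bsub>S\<^esub> q) = Q 0"
    using tors x Q_zero by metis
  then have "s [^]\<^bsub>S\<^esub> q = \<one>\<^bsub>S\<^esub>"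
    using x(2) by (simp add: E_eq_iff)
  then show "\<exists>a. x = Q a"
    using S.pow_q_eq_one x by blast
next
  assume "\<exists>a. x = Q a"
  then show "add_pow B q x = \<zero>"
    by (auto simp: add_pow_Q Q_zero[symmetric] Q_eq_iff cong_def)
qed

text \<open>The image of \<open>Q\<close> is the q-torsion and so is preserved by the additive map
  \<open>lam x\<close>; an endomorphism of a cyclic group is multiplication by a constant.\<close>

lemma lam_Q_ex:
  assumes x: "x \<in> carrier B"
  shows "\<exists>c. \<forall>a. lam x (Q a) = Q (c * a)"
proof -
  have "add_pow B q (lam x (Q 1)) = \<zero>"
    using x torsion_iff[of "Q 1"] lam_pow[OF x, of "Q 1" q] lam_zero[OF x] by force
  then obtain c where c: "lam x (Q 1) = Q c"
    using torsion_iff[of "lam x (Q 1)"] x by auto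
  have "lam x (Q a) = Q (c * a)" for a
  proof -
    obtain n where n: "[a = int n] (mod int q)"
      by (rule int_mod_q)
    have "lam x (Q a) = lam x (add_pow B n (Q 1))"
      using n by (simp add: add_pow_Q E_cong)
    also have "\<dots> = Q (int n * c)"
      using lam_pow[OF x, of "Q 1" n] by (simp add: c add_pow_Q)
    also have "\<dots> = Q (c * a)"
      using n by (simp add: Q_eq_iff mult.commute[of _ c] cong_scalar_left cong_sym)
    finally show ?thesis .
  qed
  then show ?thesis
    by blast
qed

text \<open>Determined only modulo q, so it is used through congruences.\<close>

definition chi :: "'b \<Rightarrow> int" where
  "chi x = (SOME c. \<forall>a. lam x (Q a) = Q (c * a))"

lemma lam_Q: "x \<in> carrier B \<Longrightarrow> lam x (Q a) = Q (chi x * a)"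
  using someI_ex[OF lam_Q_ex[of x]] unfolding chi_def by blast

lemma chi_not_dvd:
  assumes x: "x \<in> carrier B"
  shows "\<not> int q dvd chi x"
proof
  assume "int q dvd chi x"
  then have "lam x (Q 1) = lam x (Q 0)"
    using x by (simp add: lam_Q Q_eq_iff cong_0_iff)
  then have "Q 1 = Q 0"
    using lam_inj[of x "Q 1" "Q 0"] x by simp
  then show False
    using prime_gt_1_nat[OF S.prime_q] by (simp add: Q_eq_iff cong_0_iff)
qed

definition pr :: "'b \<Rightarrow> 's" where
  "pr x = (THE s. s \<in> carrier S \<and> (\<exists>a. x = E a s))"

definition co :: "'b \<Rightarrow> int" where
  "co x = (SOME a. x = E a (pr x))"

lemma pr_E [simp]: "s \<in> carrier S \<Longrightarrow> pr (E a s) = s"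
  unfolding pr_def by (rule the_equality, blast, metis E_eq_iff)

lemma pr_closed [simp]: "x \<in> carrier B \<Longrightarrow> pr x \<in> carrier S"
  using E_surj by force

lemma E_co_pr: "x \<in> carrier B \<Longrightarrow> E (co x) (pr x) = x"
  using E_surj[of x] unfolding co_def by (metis (mono_tags, lifting) pr_E someI_ex)

lemma pr_add: "x \<in> carrier B \<Longrightarrow> y \<in> carrier B \<Longrightarrow> pr (x \<oplus> y) = pr x \<otimes>\<^bsub>S\<^esub> pr y"
  by (metis E_add E_co_pr S.m_closed pr_E pr_closed)

lemma lam_E:
  assumes x: "x \<in> carrier B" and s: "s \<in> carrier S"
  shows "lam x (E b s) = E (chi x * b + co (lam x (E 0 s))) (pr (lam x (E 0 s)))"
proof -
  have "lam x (E b s) = Q (chi x * b) \<oplus> lam x (E 0 s)"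
    using assms by (simp add: E_split[of s b] lam_add lam_Q)
  then show ?thesis
    using assms by (metis E_co_pr E_closed Q_add lam_closed pr_closed)
qed

lemma pr_lam: "x \<in> carrier B \<Longrightarrow> y \<in> carrier B \<Longrightarrow> pr (lam x y) = pr (lam x (E 0 (pr y)))"
  by (metis E_closed E_co_pr lam_E lam_closed pr_E pr_closed)

text \<open>The exponent \<open>h s\<close> is visible in the additive group: conjugation by
  \<open>E 0 s\<close> multiplies \<open>Q\<close> by \<open>r ^ h s\<close>. Applying the additive
  map \<open>lam x\<close> to this relation only introduces the invertible factor
  \<open>chi x\<close> on both sides.\<close>

lemma h_pr_lam:
  assumes x: "x \<in> carrier B" and s: "s \<in> carrier S"
  shows "[h (pr (lam x (E 0 s))) = h s] (mod p)"
proof -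
  define t w where "t = pr (lam x (E 0 s))" and "w = co (lam x (E 0 s))"
  have t: "t \<in> carrier S" and wt: "lam x (E 0 s) = E w t"
    using x s by (simp_all add: t_def w_def E_co_pr)
  have "lam x (E 0 s \<oplus> Q 1) = lam x (Q (R s) \<oplus> E 0 s)"
    using s by (simp add: add_Q Q_add)
  then have "E w t \<oplus> Q (chi x) = Q (chi x * R s) \<oplus> E w t"
    using x s by (simp add: lam_add lam_Q wt)
  then have "[w + R t * chi x = R s * chi x + w] (mod int q)"
    using t by (simp add: add_Q Q_add E_eq_iff mult.commute)
  then have "[R t * chi x = R s * chi x] (mod int q)"
    by (simp add: add.commute[of w] cong_add_rcancel)
  moreover have "coprime (chi x) (int q)"
    using chi_not_dvd[OF x] prime_imp_coprime[OF S.prime_int_q] by (metis coprime_commute)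
  ultimately show ?thesis
    by (simp add: cong_mult_rcancel S.r_pow_cong_iff t_def)
qed

lemma lam_one: "y \<in> carrier B \<Longrightarrow> lam \<one> y = y"
  using zero_eq_one by (metis add.l_one circ_eq l_one lam_closed one_closed)

text \<open>If \<open>chi (Q a)\<close> were not \<open>1\<close>, then \<open>b \<mapsto> a + chi (Q a) * b\<close> would have a fixed point.\<close>

lemma chi_Q: "[chi (Q a) = 1] (mod int q)"
proof (rule ccontr)
  assume neq: "\<not> [chi (Q a) = 1] (mod int q)"
  then have "\<not> int q dvd 1 - chi (Q a)"
    by (metis cong_iff_dvd_diff cong_sym)
  then obtain y where "[(1 - chi (Q a)) * y = 1] (mod int q)"
    by (rule S.inverse_mod_q)
  then have "int q dvd a * ((1 - chi (Q a)) * y - 1)"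
    by (simp add: cong_iff_dvd_diff)
  then have "[a * y = a + chi (Q a) * (a * y)] (mod int q)"
    by (simp add: cong_iff_dvd_diff algebra_simps)
  then have "Q a \<otimes> Q (a * y) = Q (a * y)"
    by (simp add: circ_eq lam_Q Q_add Q_eq_iff cong_sym)
  then have "Q a = \<one>"
    by (metis E_closed S.one_closed r_cancel_one)
  then have "Q (chi (Q a) * 1) = Q 1"
    using lam_Q[of "Q a" 1] lam_one[of "Q 1"] by simp
  then show False
    using neq by (simp add: Q_eq_iff)
qed

lemma Q_circ_Q: "Q a \<otimes> Q b = Q (a + b)"
proof -
  have "[a + chi (Q a) * b = a + 1 * b] (mod int q)"
    by (intro cong_add cong_mult chi_Q) auto
  then show ?thesis
    by (simp add: circ_eq lam_Q Q_add Q_eq_iff)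
qed

text \<open>A group of order \<open>q\<close> acts trivially on the fibres of \<open>h\<close>, which have only \<open>p < q\<close> elements.\<close>

lemma pr_lam_Q:
  assumes s: "s \<in> carrier S"
  shows "pr (lam (Q a) (E 0 s)) = s"
proof -
  define f where "f t = pr (lam (Q 1) (E 0 t))" for t
  have f: "pr (lam (Q 1) y) = f (pr y)" if "y \<in> carrier B" for y
    using pr_lam[of "Q 1" y] that by (simp add: f_def)
  have iter: "pr (lam (Q (int n)) (E 0 s)) = (f ^^ n) s" for n
  proof (induction n)
    case 0
    show ?case
      using s lam_one[of "E 0 s"] by (simp add: Q_zero zero_eq_one)
  next
    case (Suc n)
    have "Q (int (Suc n)) = Q 1 \<otimes> Q (int n)"
      by (simp add: Q_circ_Q)
    then have "pr (lam (Q (int (Suc n))) (E 0 s)) = pr (lam (Q 1) (lam (Q (int n)) (E 0 s)))"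
      using s by (simp add: lam_comp)
    also have "\<dots> = f ((f ^^ n) s)"
      using s by (simp add: f Suc)
    finally show ?case
      by simp
  qed
  have "f s = s"
  proof (rule prime_period_fixpoint[OF S.prime_q])
    show "finite {t \<in> carrier S. [h t = h s] (mod p)}"
      using S.finite_S by simp
    show "card {t \<in> carrier S. [h t = h s] (mod p)} < q"
      by (rule S.card_fibre_h[OF s])
    show "(f ^^ n) s \<in> {t \<in> carrier S. [h t = h s] (mod p)}" for n
      using s h_pr_lam[of "Q (int n)" s] by (simp flip: iter)
    have "Q (int q) = Q 0"
      by (simp add: Q_eq_iff cong_def)
    then show "(f ^^ q) s = s"
      using iter[of q] iter[of 0] by simp
  qed
  then have "(f ^^ n) s = s" for n
    by (induction n) simp_all
  moreover obtain n where "[a = int n] (mod int q)"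
    by (rule int_mod_q)
  then have "Q a = Q (int n)"
    by (simp add: Q_eq_iff)
  ultimately show ?thesis
    using iter by simp
qed

text \<open>\<open>lam (Q 1)\<close> is trivial on \<open>Q\<close> and on the quotient S, so it
  shifts the first coordinate by a twisted cocycle. By \<open>coboundary\<close> it is conjugation
  by some \<open>Q k\<close>, and iterating gives conjugation by \<open>Q (k * a)\<close> for
  \<open>Q a\<close>.\<close>

lemma lam_Q_E_ex:
  "\<exists>k. \<forall>a b. \<forall>s\<in>carrier S. lam (Q a) (E b s) = E (b + k * a * (1 - R s)) s"
proof -
  define \<theta> where "\<theta> s = co (lam (Q 1) (E 0 s))" for s
  have step: "lam (Q 1) (E b s) = E (b + \<theta> s) s" if s: "s \<in> carrier S" for b s
  proof -
    have "[chi (Q 1) * b + \<theta> s = 1 * b + \<theta> s] (mod int q)"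
      by (intro cong_add cong_mult chi_Q) auto
    then show ?thesis
      using s lam_E[of "Q 1" s b] by (simp add: pr_lam_Q E_eq_iff flip: \<theta>_def)
  qed
  have "[\<theta> (s \<otimes>\<^bsub>S\<^esub> t) = \<theta> s + R s * \<theta> t] (mod int q)"
    if "s \<in> carrier S" "t \<in> carrier S" for s t
    using that lam_add[of "Q 1" "E 0 s" "E 0 t"] by (simp add: step E_add E_eq_iff)
  then have "\<exists>k. \<forall>s\<in>carrier S. [\<theta> s = k * (1 - R s)] (mod int q)"
    by (rule S.coboundary)
  then obtain k where k: "\<And>s. s \<in> carrier S \<Longrightarrow> [\<theta> s = k * (1 - R s)] (mod int q)"
    by blast
  have step': "lam (Q 1) (E b s) = E (b + k * (1 - R s)) s" if "s \<in> carrier S" for b s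
    using step[OF that] k[OF that] that by (simp add: E_eq_iff cong_add_lcancel)
  have iter: "lam (Q (int n)) (E b s) = E (b + k * int n * (1 - R s)) s" if s: "s \<in> carrier S" for n b s
  proof (induction n)
    case 0
    show ?case
      using s lam_one[of "E b s"] by (simp add: Q_zero zero_eq_one)
  next
    case (Suc n)
    have "Q (int (Suc n)) = Q 1 \<otimes> Q (int n)"
      by (simp add: Q_circ_Q)
    then show ?case
      using s by (simp add: lam_comp Suc step' algebra_simps)
  qed
  have "lam (Q a) (E b s) = E (b + k * a * (1 - R s)) s" if s: "s \<in> carrier S" for a b s
  proof -
    obtain n where n: "[a = int n] (mod int q)"
      by (rule int_mod_q)
    then have "[b + k * a * (1 - R s) = b + k * int n * (1 - R s)] (mod int q)"
      by (intro cong_add cong_mult) auto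
    moreover have "Q a = Q (int n)"
      using n by (simp add: Q_eq_iff)
    ultimately show ?thesis
      using s iter[OF s, of n b] by (metis E_cong)
  qed
  then show ?thesis
    by blast
qed

text \<open>
  Comparing \<open>E 0 e \<otimes> Q 1\<close> with the element \<open>Q b \<otimes> E 0 e\<close> equal to it shows that the parameter
  \<open>k\<close> of the inner action of \<open>Q\<close> satisfies \<open>k (k + 1) = 0\<close>.
\<close>

lemma left_trivial_cases: "left_trivial q B \<or> left_trivial q (opposite_brace B)"
proof -
  obtain k where "\<forall>a b. \<forall>s\<in>carrier S. lam (Q a) (E b s) = E (b + k * a * (1 - R s)) s"
    using lam_Q_E_ex ..
  then have k: "\<And>a b s. s \<in> carrier S \<Longrightarrow> lam (Q a) (E b s) = E (b + k * a * (1 - R s)) s"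
    by blast
  obtain e where e: "e \<in> carrier S" "h e = 1"
    using S.h_onto by blast
  define m X where "m = 1 + k * (1 - R e)" and "X = chi (E 0 e)"
  have circ_e: "Q b \<otimes> E 0 e = E (b * m) e" for b
    using e(1) by (simp add: circ_eq k Q_add m_def algebra_simps)
  have "\<not> int q dvd m"
  proof
    assume "int q dvd m"
    then have "Q 1 \<otimes> E 0 e = E 0 e"
      using e(1) by (simp add: circ_e E_eq_iff cong_0_iff)
    then have "Q 1 = Q 0"
      by (metis E_closed Q_zero S.one_closed e(1) r_cancel_one zero_eq_one)
    then show False
      using prime_gt_1_nat[OF S.prime_q] by (simp add: Q_eq_iff cong_0_iff)
  qed
  then obtain y where y: "[m * y = 1] (mod int q)"
    by (rule S.inverse_mod_q)
  \<comment> \<open>Chosen to solve \<open>b * m = R e * X\<close> modulo q, the condition for the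
    products \<open>Q b \<otimes> E 0 e\<close> and \<open>E 0 e \<otimes> Q 1\<close> to have equal
    first coordinates.\<close>
  define b where "b = R e * X * y"
  have "int q dvd R e * X * (m * y - 1)"
    using y by (simp add: cong_iff_dvd_diff)
  then have bm: "[b * m = R e * X] (mod int q)"
    by (simp add: cong_iff_dvd_diff b_def algebra_simps)
  then have comm: "Q b \<otimes> E 0 e = E 0 e \<otimes> Q 1"
    using e(1) by (simp add: circ_e) (simp add: circ_eq lam_Q add_Q E_eq_iff X_def)
  define t w where "t = pr (lam (E 0 e) (E 0 e))" and "w = co (lam (E 0 e) (E 0 e))"
  have t: "t \<in> carrier S" and wt: "lam (E 0 e) (E 0 e) = E w t"
    using e by (simp_all add: t_def w_def E_co_pr)
  have "[R t = R e] (mod int q)"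
    using h_pr_lam[of "E 0 e" e] e(1) by (intro S.r_pow_cong) (simp add: t_def)
  then have Rt: "[w + k * b * (1 - R t) = w + k * b * (1 - R e)] (mod int q)"
    by (intro cong_add cong_mult cong_diff) auto
  have "lam (E 0 e) (lam (Q 1) (E 0 e)) = lam (Q b) (lam (E 0 e) (E 0 e))"
    using comm e(1) by (simp flip: lam_comp)
  then have "lam (E 0 e) (Q (k * (1 - R e)) \<oplus> E 0 e) = E (w + k * b * (1 - R t)) t"
    using e(1) t by (simp add: k wt Q_add)
  then have "Q (X * (k * (1 - R e))) \<oplus> E w t = E (w + k * b * (1 - R t)) t"
    using e(1) by (simp add: lam_add lam_Q wt X_def)
  then have "[X * (k * (1 - R e)) + w = w + k * b * (1 - R t)] (mod int q)"
    using t by (simp add: Q_add E_eq_iff)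
  then have "[X * (k * (1 - R e)) + w = w + k * b * (1 - R e)] (mod int q)"
    using Rt cong_trans by blast
  \<comment> \<open>Multiplying by \<open>m\<close> allows \<open>b * m\<close> to be eliminated,
    and \<open>m - R e = (1 - R e) * (1 + k)\<close> then makes the whole expression factor.\<close>
  then have "int q dvd m * (X * (k * (1 - R e)) + w - (w + k * b * (1 - R e)))
      + k * (1 - R e) * (b * m - R e * X)"
    using bm by (intro dvd_add dvd_mult) (simp_all only: cong_iff_dvd_diff)
  also have "m * (X * (k * (1 - R e)) + w - (w + k * b * (1 - R e)))
      + k * (1 - R e) * (b * m - R e * X) = X * ((1 - R e) * (1 - R e)) * (k * (1 + k))"
    by (simp add: m_def algebra_simps)
  finally have "int q dvd X \<or> int q dvd 1 - R e \<or> int q dvd k \<or> int q dvd 1 + k"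
    using S.prime_int_q by (auto simp: prime_dvd_mult_iff)
  moreover have "\<not> int q dvd X"
    using chi_not_dvd[of "E 0 e"] e(1) by (simp add: X_def)
  moreover have "\<not> [int r ^ h e = int r ^ 0] (mod int q)"
    using S.p_gt_2 by (subst S.r_pow_cong_iff) (simp add: e cong_def)
  then have "\<not> int q dvd 1 - R e"
    by (metis cong_iff_dvd_diff cong_sym power_0)
  ultimately consider "int q dvd k" | "int q dvd 1 + k"
    by blast
  then show ?thesis
  proof cases
    case 1
    have "x \<otimes> y = x \<oplus> y" if xy: "x \<in> carrier B" "y \<in> carrier B" "add_pow B q x = \<zero>" for x y
    proof -
      obtain a where a: "x = Q a"
        using torsion_iff[OF xy(1)] xy(3) by blast
      obtain b s where "y = E b s" "s \<in> carrier S"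
        using E_surj[OF xy(2)] by blast
      note * = a this
      then have "[a + (b + k * a * (1 - R s)) = a + b] (mod int q)"
        using 1 by (simp add: cong_iff_dvd_diff)
      then show ?thesis
        using * by (simp add: circ_eq k Q_add E_eq_iff)
    qed
    then show ?thesis
      by (simp add: left_trivial_def)
  next
    case 2
    have "x \<otimes> y = y \<oplus> x" if xy: "x \<in> carrier B" "y \<in> carrier B" "add_pow B q x = \<zero>" for x y
    proof -
      obtain a where a: "x = Q a"
        using torsion_iff[OF xy(1)] xy(3) by blast
      obtain b s where "y = E b s" "s \<in> carrier S"
        using E_surj[OF xy(2)] by blast
      note * = a this
      have "int q dvd (1 + k) * (a * (1 - R s))"
        using 2 by simp
      then have "[a + (b + k * a * (1 - R s)) = b + R s * a] (mod int q)"
        by (simp add: cong_iff_dvd_diff algebra_simps)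
      then show ?thesis
        using * by (simp add: circ_eq k Q_add add_Q E_eq_iff)
    qed
    then show ?thesis
      by (simp add: left_trivial_def add_pow_opposite_brace)
  qed
qed

end

section \<open>Left trivial braces and an invariant complement of Z_q\<close>

locale left_trivial_coordinates = brace_coordinates S z h p q r B E
  for S :: "'s monoid" and z :: 's and h :: "'s \<Rightarrow> nat" and p q r :: nat
    and B :: "'b ring" (structure) and E :: "int \<Rightarrow> 's \<Rightarrow> 'b" +
  assumes left_trivial: "left_trivial q B"
begin

lemma lam_Q_id:
  assumes "x \<in> carrier B"
  shows "lam (Q a) x = x"
proof -
  have "add_pow B q (Q a) = \<zero>"
    using torsion_iff[of "Q a"] by auto
  then have "Q a \<otimes> x = Q a \<oplus> x"
    using left_trivial assms by (simp add: left_trivial_def)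
  then have "Q a \<oplus> lam (Q a) x = Q a \<oplus> x"
    using assms by (simp add: circ_eq)
  then show ?thesis
    using assms by (simp add: add.left_cancel)
qed

lemma lam_E_left:
  assumes "s \<in> carrier S" "x \<in> carrier B"
  shows "lam (E a s) x = lam (E 0 s) x"
proof -
  have "E a s = Q a \<otimes> E 0 s"
    using assms by (simp add: circ_eq lam_Q_id Q_add)
  then show ?thesis
    using assms by (simp add: lam_comp lam_Q_id)
qed

text \<open>\<open>act\<close> and \<open>sc\<close> are the lambda map and the multiplication of
  the skew brace induced on the quotient by \<open>Q\<close>, whose additive group is S.\<close>

definition act :: "'s \<Rightarrow> 's \<Rightarrow> 's" where
  "act s t = pr (lam (E 0 s) (E 0 t))"

definition sc :: "'s \<Rightarrow> 's \<Rightarrow> 's" where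
  "sc s t = s \<otimes>\<^bsub>S\<^esub> act s t"

lemma act_closed [simp]: "s \<in> carrier S \<Longrightarrow> t \<in> carrier S \<Longrightarrow> act s t \<in> carrier S"
  by (simp add: act_def)

lemma sc_closed [simp]: "s \<in> carrier S \<Longrightarrow> t \<in> carrier S \<Longrightarrow> sc s t \<in> carrier S"
  by (simp add: sc_def)

lemma h_act: "s \<in> carrier S \<Longrightarrow> t \<in> carrier S \<Longrightarrow> [h (act s t) = h t] (mod p)"
  by (simp add: act_def h_pr_lam)

lemma R_act: "s \<in> carrier S \<Longrightarrow> t \<in> carrier S \<Longrightarrow> [R (act s t) = R t] (mod int q)"
  by (simp add: S.r_pow_cong h_act)

lemma lam_E_act:
  assumes "s \<in> carrier S" "t \<in> carrier S"
  shows "lam (E a s) (E b t) = E (chi (E 0 s) * b + co (lam (E 0 s) (E 0 t))) (act s t)"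
  using assms lam_E[of "E 0 s" t b] lam_E_left[of s "E b t" a] by (simp add: act_def)

lemma pr_circ: "s \<in> carrier S \<Longrightarrow> t \<in> carrier S \<Longrightarrow> pr (E a s \<otimes> E b t) = sc s t"
  using lam_E_act[of s t a b] by (simp add: circ_eq E_add sc_def)

lemma circ_sc:
  assumes "s \<in> carrier S" "t \<in> carrier S"
  obtains m where "E a s \<otimes> E b t = E m (sc s t)"
  using assms E_co_pr[of "E a s \<otimes> E b t"] by (metis E_closed m_closed pr_circ)

lemma act_mult:
  assumes "s \<in> carrier S" "t \<in> carrier S" "u \<in> carrier S"
  shows "act s (t \<otimes>\<^bsub>S\<^esub> u) = act s t \<otimes>\<^bsub>S\<^esub> act s u"
  using assms lam_add[of "E 0 s" "E 0 t" "E 0 u"] pr_add[of "lam (E 0 s) (E 0 t)" "lam (E 0 s) (E 0 u)"]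
  by (simp add: E_add act_def)

lemma act_sc:
  assumes "s \<in> carrier S" "t \<in> carrier S" "u \<in> carrier S"
  shows "act (sc s t) u = act s (act t u)"
proof -
  obtain m where m: "E 0 s \<otimes> E 0 t = E m (sc s t)"
    using circ_sc[OF assms(1,2)] .
  have "act (sc s t) u = pr (lam (E 0 s \<otimes> E 0 t) (E 0 u))"
    using assms lam_E_left[of "sc s t" "E 0 u" m] by (simp add: m act_def)
  also have "\<dots> = act s (act t u)"
    using assms pr_lam[of "E 0 s" "lam (E 0 t) (E 0 u)"] by (simp add: lam_comp act_def)
  finally show ?thesis .
qed

lemma act_one: "s \<in> carrier S \<Longrightarrow> act \<one>\<^bsub>S\<^esub> s = s"
  by (simp add: act_def lam_Q_id)

text \<open>For fixed s the first coordinate of \<open>lam (E 0 s) (E 0 t)\<close> is a twisted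
  cocycle in t, since \<open>act s\<close> preserves \<open>h\<close>; by \<open>coboundary\<close>
  a single number \<open>\<omega> s\<close> describes how \<open>lam (E 0 s)\<close> displaces the
  complement.\<close>

lemma ex_omega:
  "\<exists>\<omega>. \<forall>s\<in>carrier S. \<forall>t\<in>carrier S. \<forall>b.
    lam (E 0 s) (E b t) = E (chi (E 0 s) * b + \<omega> s * (1 - R t)) (act s t)"
proof -
  have "\<exists>w. \<forall>t\<in>carrier S. \<forall>b. lam (E 0 s) (E b t) = E (chi (E 0 s) * b + w * (1 - R t)) (act s t)"
    if s: "s \<in> carrier S" for s
  proof -
    define \<theta> where "\<theta> t = co (lam (E 0 s) (E 0 t))" for t
    have \<theta>: "lam (E 0 s) (E b t) = E (chi (E 0 s) * b + \<theta> t) (act s t)" if "t \<in> carrier S" for b t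
      using s that lam_E_act[of s t 0 b] by (simp add: \<theta>_def)
    have "[\<theta> (t \<otimes>\<^bsub>S\<^esub> u) = \<theta> t + R t * \<theta> u] (mod int q)"
      if t: "t \<in> carrier S" and u: "u \<in> carrier S" for t u
    proof -
      have "E (\<theta> (t \<otimes>\<^bsub>S\<^esub> u)) (act s (t \<otimes>\<^bsub>S\<^esub> u)) =
          E (\<theta> t + R (act s t) * \<theta> u) (act s t \<otimes>\<^bsub>S\<^esub> act s u)"
        using lam_add[of "E 0 s" "E 0 t" "E 0 u"] s t u by (simp add: \<theta> E_add)
      then have "[\<theta> (t \<otimes>\<^bsub>S\<^esub> u) = \<theta> t + R (act s t) * \<theta> u] (mod int q)"
        using s t u by (simp add: E_eq_iff)
      moreover have "[\<theta> t + R (act s t) * \<theta> u = \<theta> t + R t * \<theta> u] (mod int q)"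
        using s t by (intro cong_add cong_mult R_act) auto
      ultimately show ?thesis
        by (rule cong_trans)
    qed
    then have "\<exists>w. \<forall>t\<in>carrier S. [\<theta> t = w * (1 - R t)] (mod int q)"
      by (rule S.coboundary)
    then obtain w where w: "\<And>t. t \<in> carrier S \<Longrightarrow> [\<theta> t = w * (1 - R t)] (mod int q)"
      by blast
    have "lam (E 0 s) (E b t) = E (chi (E 0 s) * b + w * (1 - R t)) (act s t)"
      if "t \<in> carrier S" for b t
      using \<theta>[OF that] w[OF that] s that by (simp add: E_eq_iff cong_add_lcancel)
    then show ?thesis
      by blast
  qed
  then show ?thesis
    by (intro bchoice) blast
qed

text \<open>
  Modulo the kernel \<open>Q\<close>, the group \<open>(B, \<otimes>)\<close> acts on the complements of \<open>Q\<close> by the affine maps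
  \<open>w \<mapsto> chi s * w + \<omega> s\<close> of \<open>\<int>\<^sub>q\<close>; since its order \<open>p\<^sup>2\<close> is invertible modulo \<open>q\<close>, the average of \<open>\<omega>\<close>
  yields a fixed point.
\<close>

lemma ex_invariant_complement:
  obtains W where "left_trivial_coordinates S z h p q r B (\<lambda>a s. E (a + W * (1 - R s)) s)"
    "\<And>s t. s \<in> carrier S \<Longrightarrow> t \<in> carrier S \<Longrightarrow> \<exists>u\<in>carrier S.
      lam (E (0 + W * (1 - R s)) s) (E (0 + W * (1 - R t)) t) = E (0 + W * (1 - R u)) u"
proof -
  obtain \<omega> where "\<forall>s\<in>carrier S. \<forall>t\<in>carrier S. \<forall>b.
    lam (E 0 s) (E b t) = E (chi (E 0 s) * b + \<omega> s * (1 - R t)) (act s t)"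
    using ex_omega ..
  then have \<omega>: "lam (E 0 s) (E b t) = E (chi (E 0 s) * b + \<omega> s * (1 - R t)) (act s t)"
    if "s \<in> carrier S" "t \<in> carrier S" for s t b
    using that by blast
  obtain e where e: "e \<in> carrier S" "h e = 1"
    using S.h_onto by blast
  have "\<not> [int r ^ h e = int r ^ 0] (mod int q)"
    using S.p_gt_2 by (subst S.r_pow_cong_iff) (simp add: e cong_def)
  then have "\<not> int q dvd 1 - R e"
    by (metis cong_iff_dvd_diff cong_sym power_0)
  then have coprime_e: "coprime (1 - R e) (int q)"
    using prime_imp_coprime[OF S.prime_int_q] by (metis coprime_commute)
  \<comment> \<open>Composition of the affine maps, read off from \<open>lam_comp\<close> at the
    element e, where the factor \<open>1 - R e\<close> can be cancelled modulo q.\<close>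
  have \<omega>_sc: "[\<omega> (sc s t) = chi (E 0 s) * \<omega> t + \<omega> s] (mod int q)"
    if s: "s \<in> carrier S" and t: "t \<in> carrier S" for s t
  proof -
    obtain m where m: "E 0 s \<otimes> E 0 t = E m (sc s t)"
      using circ_sc[OF s t] .
    have "lam (E 0 s \<otimes> E 0 t) (E 0 e) = lam (E 0 s) (lam (E 0 t) (E 0 e))"
      using s t e by (simp add: lam_comp)
    then have "E (\<omega> (sc s t) * (1 - R e)) (act (sc s t) e) =
        E (chi (E 0 s) * (\<omega> t * (1 - R e)) + \<omega> s * (1 - R (act t e))) (act s (act t e))"
      using s t e(1) lam_E_left[of "sc s t" "E 0 e" m] by (simp add: m \<omega>)
    then have "[\<omega> (sc s t) * (1 - R e) =
        chi (E 0 s) * (\<omega> t * (1 - R e)) + \<omega> s * (1 - R (act t e))] (mod int q)"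
      using s t e(1) by (simp add: E_eq_iff)
    moreover have "[chi (E 0 s) * (\<omega> t * (1 - R e)) + \<omega> s * (1 - R (act t e)) =
        chi (E 0 s) * (\<omega> t * (1 - R e)) + \<omega> s * (1 - R e)] (mod int q)"
      using t e(1) by (intro cong_add cong_mult cong_diff R_act) auto
    ultimately have "[\<omega> (sc s t) * (1 - R e) =
        chi (E 0 s) * (\<omega> t * (1 - R e)) + \<omega> s * (1 - R e)] (mod int q)"
      by (rule cong_trans)
    also have "chi (E 0 s) * (\<omega> t * (1 - R e)) + \<omega> s * (1 - R e) =
        (chi (E 0 s) * \<omega> t + \<omega> s) * (1 - R e)"
      by (simp add: algebra_simps)
    finally show ?thesis
      using coprime_e by (simp only: cong_mult_rcancel)
  qed
  \<comment> \<open>Left translations permute S, which permits reindexing the sum of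
    \<open>\<omega>\<close> below. Here injectivity is drawn from that of
    \<open>lam\<close>.\<close>
  have sc_bij: "bij_betw (sc s) (carrier S) (carrier S)" if s: "s \<in> carrier S" for s
  proof -
    have "inj_on (sc s) (carrier S)"
    proof (rule inj_onI)
      fix t t' assume t: "t \<in> carrier S" "t' \<in> carrier S" "sc s t = sc s t'"
      then have act: "act s t = act s t'"
        using s by (simp add: sc_def S.left_cancel)
      obtain y where "[chi (E 0 s) * y = 1] (mod int q)"
        using S.inverse_mod_q[OF chi_not_dvd] s E_closed by metis
      \<comment> \<open>When \<open>act s\<close> agrees on t and t', shifting the first coordinate
        of t by \<open>y * \<omega> s * (R t - R t')\<close> compensates the different
        displacements, so the two images under \<open>lam (E 0 s)\<close> coincide.\<close>
      then have "int q dvd \<omega> s * (R t - R t') * (chi (E 0 s) * y - 1)"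
        by (simp add: cong_iff_dvd_diff)
      then have "lam (E 0 s) (E (y * \<omega> s * (R t - R t')) t) = lam (E 0 s) (E 0 t')"
        using s t act by (simp add: \<omega> E_eq_iff cong_iff_dvd_diff algebra_simps)
      then have "E (y * \<omega> s * (R t - R t')) t = E 0 t'"
        using s t lam_inj E_closed by metis
      then show "t = t'"
        using t by (simp add: E_eq_iff)
    qed
    moreover have "sc s ` carrier S \<subseteq> carrier S"
      using s by auto
    ultimately show ?thesis
      using S.finite_S by (simp add: bij_betw_def endo_inj_surj)
  qed
  define V where "V = (\<Sum>t\<in>carrier S. \<omega> t)"
  have V: "[V = chi (E 0 s) * V + int (p\<^sup>2) * \<omega> s] (mod int q)" if s: "s \<in> carrier S" for s
  proof -
    have "V = (\<Sum>t\<in>carrier S. \<omega> (sc s t))"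
      unfolding V_def using sum.reindex_bij_betw[OF sc_bij[OF s], of \<omega>] by simp
    also have "[\<dots> = (\<Sum>t\<in>carrier S. chi (E 0 s) * \<omega> t + \<omega> s)] (mod int q)"
      using \<omega>_sc s by (intro cong_sum) auto
    also have "(\<Sum>t\<in>carrier S. chi (E 0 s) * \<omega> t + \<omega> s) = chi (E 0 s) * V + int (p\<^sup>2) * \<omega> s"
      using S.order_S by (simp add: sum.distrib V_def order_def flip: sum_distrib_left)
    finally show ?thesis .
  qed
  have "\<not> q dvd p"
    using S.p_less_q S.p_gt_2 by (auto dest: dvd_imp_le)
  then have "\<not> int q dvd int (p\<^sup>2)"
    using S.prime_q prime_dvd_power by (metis int_dvd_int_iff)
  then obtain y where y: "[int (p\<^sup>2) * y = 1] (mod int q)"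
    by (rule S.inverse_mod_q)
  define W where "W = y * V"
  have W: "[chi (E 0 s) * W + \<omega> s = W] (mod int q)" if s: "s \<in> carrier S" for s
  proof -
    have "int q dvd y * (V - (chi (E 0 s) * V + int (p\<^sup>2) * \<omega> s))"
      "int q dvd \<omega> s * (int (p\<^sup>2) * y - 1)"
      using V[OF s] y by (simp_all only: cong_iff_dvd_diff dvd_mult)
    then have "int q dvd - (y * (V - (chi (E 0 s) * V + int (p\<^sup>2) * \<omega> s))
        + \<omega> s * (int (p\<^sup>2) * y - 1))"
      by (simp only: dvd_minus_iff dvd_add)
    also have "\<dots> = chi (E 0 s) * W + \<omega> s - W"
      by (simp add: W_def algebra_simps)
    finally show ?thesis
      by (simp only: cong_iff_dvd_diff)
  qed
  show thesis
  proof (rule that)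
    show "left_trivial_coordinates S z h p q r B (\<lambda>a s. E (a + W * (1 - R s)) s)"
    proof (unfold_locales, goal_cases)
      case (1 s a)
      then show ?case by simp
    next
      case (2 s t a b)
      then show ?case
        by (auto simp: E_eq_iff cong_add_rcancel)
    next
      case (3 x)
      then obtain a s where "x = E a s" "s \<in> carrier S"
        using E_surj by blast
      then show ?case
        by (intro exI[of _ "a - W * (1 - R s)"] bexI[of _ s]) simp_all
    next
      case (4 s t a b)
      have "[W * (1 - R s * R t) = W * (1 - R (s \<otimes>\<^bsub>S\<^esub> t))] (mod int q)"
        using R_mult[OF 4] by (intro cong_mult cong_diff) (auto simp: cong_sym_eq)
      then have "[a + R s * b + W * (1 - R s * R t) = a + R s * b + W * (1 - R (s \<otimes>\<^bsub>S\<^esub> t))] (mod int q)"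
        by (simp only: cong_add_lcancel)
      then show ?case
        using 4 by (simp add: E_add E_eq_iff algebra_simps)
    next
      case 5
      show ?case by (rule left_trivial)
    qed
    fix s t assume s: "s \<in> carrier S" and t: "t \<in> carrier S"
    have "[chi (E 0 s) * (W * (1 - R t)) + \<omega> s * (1 - R t) = W * (1 - R t)] (mod int q)"
      using cong_scalar_right[OF W[OF s], of "1 - R t"] by (simp add: algebra_simps)
    moreover have "[W * (1 - R (act s t)) = W * (1 - R t)] (mod int q)"
      using s t by (intro cong_mult cong_diff R_act) auto
    ultimately have "[chi (E 0 s) * (W * (1 - R t)) + \<omega> s * (1 - R t) = W * (1 - R (act s t))] (mod int q)"
      by (metis cong_sym cong_trans)
    then have "lam (E (0 + W * (1 - R s)) s) (E (0 + W * (1 - R t)) t) = E (0 + W * (1 - R (act s t))) (act s t)"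
      using s t lam_E_left[of s "E (W * (1 - R t)) t" "W * (1 - R s)"] by (simp add: \<omega> E_eq_iff)
    then show "\<exists>u\<in>carrier S. lam (E (0 + W * (1 - R s)) s) (E (0 + W * (1 - R t)) t) = E (0 + W * (1 - R u)) u"
      using s t by (intro bexI[of _ "act s t"]) auto
  qed
qed

end

section \<open>Roots of unity modulo q\<close>

context prime_square_data
begin

text \<open>The order of x divides both p^2 and q - 1, and p^2 does not divide q - 1, so x is a p-th
  root of unity. There are at most p of these modulo q, and the powers of r already provide
  p.\<close>

lemma root_of_unity_is_power:
  fixes x :: int
  assumes x: "[x ^ p\<^sup>2 = 1] (mod int q)"
  shows "\<exists>i. [x = int r ^ i] (mod int q)"
proof -
  have q0: "q > 0" and p0: "p > 0"
    using prime_gt_0_nat prime_p prime_q by auto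
  define y where "y = nat (x mod int q)"
  have xy: "[x = int y] (mod int q)"
    using q0 by (simp add: y_def cong_def)
  have "[int y ^ p\<^sup>2 = 1] (mod int q)"
    using x cong_pow[OF xy, of "p\<^sup>2"] by (metis cong_sym cong_trans)
  then have y: "[y ^ p\<^sup>2 = 1] (mod q)"
    by (simp flip: cong_int_iff)
  then have ord_p2: "Pocklington.ord q y dvd p\<^sup>2"
    by (simp only: ord_divides)
  then have "coprime q y"
    using p0 by (metis dvd_0_left_iff Pocklington.ord_eq_0 power_eq_0_iff less_irrefl)
  then have "Pocklington.ord q y dvd q - 1"
    using order_divides_totient[of q y] totient_prime[OF prime_q] by simp
  then have "\<not> Pocklington.ord q y = p\<^sup>2"
    using q_not_cong prime_gt_1_nat[OF prime_q] by (auto simp: cong_altdef_nat)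
  moreover obtain k where "k \<le> 2" "Pocklington.ord q y = p ^ k"
    using ord_p2 prime_p by (auto simp: divides_primepow_nat)
  ultimately have "Pocklington.ord q y dvd p"
    by (cases k; cases "k - 1") (auto simp: numeral_2_eq_2)
  then have y_root: "[y ^ p = 1] (mod q)"
    by (simp only: ord_divides)
  define A where "A = {x \<in> {..<q}. [x ^ p = 1] (mod q)}"
  define P where "P = (\<lambda>i. r ^ i mod q) ` {..<p}"
  have "[r ^ p = 1] (mod q)"
    using ord_r by (simp only: ord_divides dvd_refl)
  then have "[(r ^ i) ^ p = 1] (mod q)" for i
    using cong_pow[of "r ^ p" 1 q i] by (simp add: mult.commute flip: power_mult)
  then have "P \<subseteq> A"
    using q0 by (auto simp: A_def P_def cong_def power_mod)
  moreover have "inj_on (\<lambda>i. r ^ i mod q) {..<p}"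
  proof (rule inj_onI)
    fix i j assume ij: "i \<in> {..<p}" "j \<in> {..<p}" "r ^ i mod q = r ^ j mod q"
    then have "[r ^ i = r ^ j] (mod q)"
      by (simp only: cong_def)
    then have "[int (r ^ i) = int (r ^ j)] (mod int q)"
      by (simp only: cong_int_iff)
    then have "[i = j] (mod p)"
      by (simp add: r_pow_cong_iff)
    then show "i = j"
      using ij by (simp add: cong_def)
  qed
  then have "card P = p"
    by (simp add: P_def card_image)
  moreover have "card A \<le> p" "finite A"
    using roots_mod_prime_bound[OF prime_q p0, of 1] by (simp_all add: A_def)
  ultimately have "P = A"
    by (metis card_seteq)
  moreover have "y \<in> A"
    using y_root q0 by (simp add: A_def y_def nat_less_iff)
  ultimately obtain i where "y = r ^ i mod q"
    by (auto simp: P_def)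
  then have "[y = r ^ i] (mod q)"
    by (simp add: cong_def)
  then have "[int y = int (r ^ i)] (mod int q)"
    by (simp only: cong_int_iff)
  then show ?thesis
    using xy by (metis cong_trans of_nat_power)
qed

end

section \<open>Braces with an invariant complement, and their identification with models\<close>

locale split_coordinates = left_trivial_coordinates S z h p q r B E
  for S :: "'s monoid" and z :: 's and h :: "'s \<Rightarrow> nat" and p q r :: nat
    and B :: "'b ring" (structure) and E :: "int \<Rightarrow> 's \<Rightarrow> 'b" +
  assumes lam_E0_ex: "s \<in> carrier S \<Longrightarrow> t \<in> carrier S \<Longrightarrow>
    \<exists>u\<in>carrier S. lam (E 0 s) (E 0 t) = E 0 u"
begin

lemma lam_E0: "s \<in> carrier S \<Longrightarrow> t \<in> carrier S \<Longrightarrow> lam (E 0 s) (E 0 t) = E 0 (act s t)"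
  using lam_E0_ex[of s t] by (auto simp: act_def)

lemma lam_split:
  assumes "s \<in> carrier S" "t \<in> carrier S"
  shows "lam (E 0 s) (E b t) = E (chi (E 0 s) * b) (act s t)"
proof -
  have "lam (E 0 s) (Q b \<oplus> E 0 t) = Q (chi (E 0 s) * b) \<oplus> E 0 (act s t)"
    using assms by (subst lam_add) (simp_all add: lam_Q lam_E0)
  then show ?thesis
    using assms by (simp add: Q_add)
qed

lemma circ_E:
  assumes "s \<in> carrier S" "t \<in> carrier S"
  shows "E a s \<otimes> E b t = E (a + R s * (chi (E 0 s) * b)) (sc s t)"
  using assms lam_E_left[of s "E b t" a] by (simp add: circ_eq lam_split E_add sc_def)

lemma circ_E0: "s \<in> carrier S \<Longrightarrow> t \<in> carrier S \<Longrightarrow> E 0 s \<otimes> E 0 t = E 0 (sc s t)"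
  by (simp add: circ_E)

definition circ_group_S :: "'s monoid" where
  "circ_group_S = \<lparr>carrier = carrier S, monoid.mult = sc, one = \<one>\<^bsub>S\<^esub>\<rparr>"

lemma sc_one: "s \<in> carrier S \<Longrightarrow> sc \<one>\<^bsub>S\<^esub> s = s"
  by (simp add: sc_def act_one)

lemma group_circ_group_S: "group circ_group_S"
proof (rule groupI)
  fix s t u
  assume s: "s \<in> carrier circ_group_S"
  then have s': "s \<in> carrier S"
    by (simp add: circ_group_S_def)
  have "inj_on (\<lambda>u. sc u s) (carrier S)"
  proof (rule inj_onI)
    fix u v assume uv: "u \<in> carrier S" "v \<in> carrier S" "sc u s = sc v s"
    then have "E 0 u \<otimes> E 0 s = E 0 v \<otimes> E 0 s"
      using s' by (simp add: circ_E0)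
    then have "E 0 u = E 0 v"
      using uv s' by (simp add: right_cancel)
    then show "u = v"
      using uv by (simp add: E_eq_iff)
  qed
  moreover have "(\<lambda>u. sc u s) ` carrier S \<subseteq> carrier S"
    using s' by auto
  ultimately have "(\<lambda>u. sc u s) ` carrier S = carrier S"
    using S.finite_S by (simp add: endo_inj_surj)
  then have "\<one>\<^bsub>S\<^esub> \<in> (\<lambda>u. sc u s) ` carrier S"
    by simp
  then show "\<exists>u\<in>carrier circ_group_S. u \<otimes>\<^bsub>circ_group_S\<^esub> s = \<one>\<^bsub>circ_group_S\<^esub>"
    by (auto simp: circ_group_S_def)
  show "\<one>\<^bsub>circ_group_S\<^esub> \<otimes>\<^bsub>circ_group_S\<^esub> s = s"
    using s' by (simp add: circ_group_S_def sc_one)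
  assume t: "t \<in> carrier circ_group_S"
  then show "s \<otimes>\<^bsub>circ_group_S\<^esub> t \<in> carrier circ_group_S"
    using s' by (simp add: circ_group_S_def)
  assume u: "u \<in> carrier circ_group_S"
  have "E 0 (sc (sc s t) u) = E 0 (sc s (sc t u))"
    using s' t u m_assoc[of "E 0 s" "E 0 t" "E 0 u"] by (simp add: circ_group_S_def circ_E0)
  then show "s \<otimes>\<^bsub>circ_group_S\<^esub> t \<otimes>\<^bsub>circ_group_S\<^esub> u = s \<otimes>\<^bsub>circ_group_S\<^esub> (t \<otimes>\<^bsub>circ_group_S\<^esub> u)"
    using s' t u by (simp add: circ_group_S_def E_eq_iff)
qed (simp add: circ_group_S_def)

text \<open>S under \<open>sc\<close> is a group of order p^2. The modulus is left open because this
  is applied modulo p to the action on z and modulo q to the action on Z_q.\<close>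

lemma sc_character_root_of_unity:
  fixes f :: "'s \<Rightarrow> int"
  assumes one: "[f \<one>\<^bsub>S\<^esub> = 1] (mod m)"
    and mult: "\<And>s t. s \<in> carrier S \<Longrightarrow> t \<in> carrier S \<Longrightarrow> [f (sc s t) = f s * f t] (mod m)"
    and s: "s \<in> carrier S"
  shows "[f s ^ p\<^sup>2 = 1] (mod m)"
proof -
  have s': "s \<in> carrier circ_group_S"
    using s by (simp add: circ_group_S_def)
  have pow: "s [^]\<^bsub>circ_group_S\<^esub> n \<in> carrier S \<and> [f (s [^]\<^bsub>circ_group_S\<^esub> n) = f s ^ n] (mod m)" for n :: nat
  proof (induction n)
    case 0
    show ?case
      using one by (simp add: circ_group_S_def)
  next
    case (Suc n)
    then have "[f (sc (s [^]\<^bsub>circ_group_S\<^esub> n) s) = f s ^ n * f s] (mod m)"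
      using mult[of "s [^]\<^bsub>circ_group_S\<^esub> n" s] s by (meson cong_mult cong_refl cong_trans)
    moreover have "s [^]\<^bsub>circ_group_S\<^esub> Suc n = sc (s [^]\<^bsub>circ_group_S\<^esub> n) s"
      by (simp add: nat_pow_Suc) (simp add: circ_group_S_def)
    ultimately show ?case
      using Suc s by (simp add: mult.commute)
  qed
  have "s [^]\<^bsub>circ_group_S\<^esub> p\<^sup>2 = \<one>\<^bsub>S\<^esub>"
    using group.pow_order_eq_1[OF group_circ_group_S s'] S.order_S
    by (simp add: order_def circ_group_S_def)
  then show ?thesis
    using pow[of "p\<^sup>2"] one by (metis cong_sym cong_trans)
qed

text \<open>\<open>act s\<close> preserves the kernel of \<open>h\<close>, so it sends z to a power
  with exponent \<open>u s\<close>, multiplicative in s. A group of order p^2 has no nontrivial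
  homomorphism to the units modulo p: the p^2-th power of \<open>u s\<close> is 1, but by Fermat it
  is also \<open>u s\<close>.\<close>

lemma act_z:
  assumes s: "s \<in> carrier S"
  shows "act s z = z"
proof -
  have "\<exists>n. act s z = z [^]\<^bsub>S\<^esub> (n::nat)" if s: "s \<in> carrier S" for s
    using S.h_kernel[of "act s z"] h_act[OF s S.z_closed] S.h_z s by (auto intro: cong_trans)
  then obtain u where u: "\<And>s. s \<in> carrier S \<Longrightarrow> act s z = z [^]\<^bsub>S\<^esub> (u s :: nat)"
    by metis
  have act_pow: "act s (z [^]\<^bsub>S\<^esub> n) = z [^]\<^bsub>S\<^esub> (u s * n)" if s: "s \<in> carrier S" for s and n :: nat
  proof (induction n)
    case 0
    have "act s \<one>\<^bsub>S\<^esub> \<otimes>\<^bsub>S\<^esub> act s \<one>\<^bsub>S\<^esub> = act s \<one>\<^bsub>S\<^esub>"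
      using s act_mult[of s "\<one>\<^bsub>S\<^esub>" "\<one>\<^bsub>S\<^esub>"] by simp
    then show ?case
      using s by simp
  next
    case (Suc n)
    then show ?case
      using s by (simp add: act_mult u S.nat_pow_mult add.commute)
  qed
  have "[int (u \<one>\<^bsub>S\<^esub>) = 1] (mod int p)"
    using u[of "\<one>\<^bsub>S\<^esub>"] act_one[of z] S.z_pow_cong_iff[of "u \<one>\<^bsub>S\<^esub>" 1]
    by (simp flip: cong_int_iff)
  moreover have "[int (u (sc s t)) = int (u s) * int (u t)] (mod int p)"
    if "s \<in> carrier S" "t \<in> carrier S" for s t
  proof -
    have "z [^]\<^bsub>S\<^esub> u (sc s t) = z [^]\<^bsub>S\<^esub> (u s * u t)"
      using that act_sc[of s t z] act_pow[of s "u t"] by (simp add: u)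
    then show ?thesis
      by (simp add: S.z_pow_cong_iff flip: cong_int_iff)
  qed
  ultimately have "[int (u s) ^ p\<^sup>2 = 1] (mod int p)"
    using s by (rule sc_character_root_of_unity)
  then have root: "[u s ^ p\<^sup>2 = 1] (mod p)"
    by (simp flip: cong_int_iff)
  have fermat: "[x ^ p = x] (mod p)" for x
  proof (cases "p dvd x")
    case True
    then have "p dvd x ^ p"
      using S.p_gt_2 by (simp add: dvd_power_iff dvd_trans[OF True dvd_power])
    then show ?thesis
      using True by (simp add: cong_def mod_eq_0_iff_dvd)
  next
    case False
    then have "[x ^ (p - 1) * x = 1 * x] (mod p)"
      using fermat_theorem[OF S.prime_p] by (intro cong_mult) auto
    then show ?thesis
      using S.p_gt_2 by (simp flip: power_Suc2)
  qed
  have "[(u s ^ p) ^ p = u s] (mod p)"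
    using fermat[of "u s ^ p"] fermat[of "u s"] by (rule cong_trans)
  then have "[u s = 1] (mod p)"
    using root by (metis cong_sym cong_trans power2_eq_square power_mult)
  then have "z [^]\<^bsub>S\<^esub> u s = z [^]\<^bsub>S\<^esub> (1::nat)"
    by (rule S.z_pow_cong)
  then show ?thesis
    using s u by simp
qed

lemma act_pow:
  assumes s: "s \<in> carrier S" and t: "t \<in> carrier S"
  shows "act s (t [^]\<^bsub>S\<^esub> (n::nat)) = act s t [^]\<^bsub>S\<^esub> n"
proof (induction n)
  case 0
  have "act s \<one>\<^bsub>S\<^esub> \<otimes>\<^bsub>S\<^esub> act s \<one>\<^bsub>S\<^esub> = act s \<one>\<^bsub>S\<^esub>"
    using s act_mult[of s "\<one>\<^bsub>S\<^esub>" "\<one>\<^bsub>S\<^esub>"] by simp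
  then show ?case
    using s by simp
qed (use s t in \<open>simp add: act_mult\<close>)

text \<open>S is generated by z, which \<open>act s\<close> fixes, and by an e with
  \<open>h e = 1\<close>, which it multiplies by a power of z with exponent \<open>v s\<close>. The
  map \<open>v\<close> is a homomorphism from S under \<open>sc\<close> to Z_p; once it vanishes at
  z it is the multiple \<open>v e\<close> of \<open>h\<close>, and \<open>v e\<close> is the
  structure constant.\<close>

lemma ex_circ: "\<exists>c. \<forall>s\<in>carrier S. \<forall>t\<in>carrier S. sc s t = S.circ c s t"
proof -
  obtain e where e: "e \<in> carrier S" "h e = 1"
    using S.h_onto by blast
  have generate: "\<exists>n. s = e [^]\<^bsub>S\<^esub> h s \<otimes>\<^bsub>S\<^esub> z [^]\<^bsub>S\<^esub> (n::nat)" if "s \<in> carrier S" for s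
    using S.fibre_h[of "e [^]\<^bsub>S\<^esub> h s" s] S.h_pow[OF e(1), of "h s"] e that by (auto simp: cong_sym_eq)
  have "\<exists>n. act s e = e \<otimes>\<^bsub>S\<^esub> z [^]\<^bsub>S\<^esub> (n::nat)" if "s \<in> carrier S" for s
    using S.fibre_h[of e "act s e"] h_act[of s e] e that by auto
  then obtain v where v: "\<And>s. s \<in> carrier S \<Longrightarrow> act s e = e \<otimes>\<^bsub>S\<^esub> z [^]\<^bsub>S\<^esub> (v s :: nat)"
    by metis
  have act: "act s t = t \<otimes>\<^bsub>S\<^esub> z [^]\<^bsub>S\<^esub> (v s * h t)" if s: "s \<in> carrier S" and t: "t \<in> carrier S" for s t
  proof -
    obtain n where n: "t = e [^]\<^bsub>S\<^esub> h t \<otimes>\<^bsub>S\<^esub> z [^]\<^bsub>S\<^esub> (n::nat)"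
      using generate[OF t] ..
    have "act s (e [^]\<^bsub>S\<^esub> h t \<otimes>\<^bsub>S\<^esub> z [^]\<^bsub>S\<^esub> n) =
        (e \<otimes>\<^bsub>S\<^esub> z [^]\<^bsub>S\<^esub> v s) [^]\<^bsub>S\<^esub> h t \<otimes>\<^bsub>S\<^esub> z [^]\<^bsub>S\<^esub> n"
      using s e by (simp add: act_mult act_pow act_z v)
    also have "\<dots> = e [^]\<^bsub>S\<^esub> h t \<otimes>\<^bsub>S\<^esub> z [^]\<^bsub>S\<^esub> (v s * h t) \<otimes>\<^bsub>S\<^esub> z [^]\<^bsub>S\<^esub> n"
      using e by (simp add: S.nat_pow_distrib S.nat_pow_pow)
    also have "\<dots> = (e [^]\<^bsub>S\<^esub> h t \<otimes>\<^bsub>S\<^esub> z [^]\<^bsub>S\<^esub> n) \<otimes>\<^bsub>S\<^esub> z [^]\<^bsub>S\<^esub> (v s * h t)"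
      using e by (simp add: S.m_ac)
    finally show ?thesis
      using n by simp
  qed
  have sc: "sc s t = s \<otimes>\<^bsub>S\<^esub> t \<otimes>\<^bsub>S\<^esub> z [^]\<^bsub>S\<^esub> (v s * h t)" if "s \<in> carrier S" "t \<in> carrier S" for s t
    using that by (simp add: sc_def act S.m_assoc)
  have v_sc: "[v (sc s t) = v s + v t] (mod p)" if s: "s \<in> carrier S" and t: "t \<in> carrier S" for s t
  proof -
    have "e \<otimes>\<^bsub>S\<^esub> z [^]\<^bsub>S\<^esub> v (sc s t) = act s (act t e)"
      using s t e act_sc[of s t e] by (simp add: v)
    also have "\<dots> = e \<otimes>\<^bsub>S\<^esub> z [^]\<^bsub>S\<^esub> (v s + v t)"
      using s t e by (simp add: v act_mult act_pow act_z S.nat_pow_mult S.m_assoc)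
    finally show ?thesis
      using e by (simp add: S.left_cancel S.z_pow_cong_iff)
  qed
  have v_one: "[v \<one>\<^bsub>S\<^esub> = 0] (mod p)"
    using v_sc[of "\<one>\<^bsub>S\<^esub>" "\<one>\<^bsub>S\<^esub>"] sc_one[of "\<one>\<^bsub>S\<^esub>"] by (metis S.one_closed cong_add_lcancel_0_nat cong_sym)
  \<comment> \<open>If \<open>v z\<close> were invertible modulo p, some t would satisfy
    \<open>sc z t = t\<close>, and cancellation in the multiplicative group would make z
    trivial.\<close>
  have v_z: "[v z = 0] (mod p)"
  proof (rule ccontr)
    assume "\<not> [v z = 0] (mod p)"
    then have "coprime (v z) p"
      using prime_imp_coprime[OF S.prime_p] by (metis cong_0_iff coprime_commute)
    then obtain x where x: "[v z * x = 1] (mod p)"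
      using cong_solve_coprime_nat unfolding One_nat_def by blast
    \<comment> \<open>With x inverse to \<open>v z\<close> and p - 1 standing for -1,
      \<open>h t\<close> represents the negative inverse of \<open>v z\<close>, so the power of z
      produced by \<open>act z t\<close> cancels z.\<close>
    define t where "t = e [^]\<^bsub>S\<^esub> (x * (p - 1))"
    have t: "t \<in> carrier S"
      using e by (simp add: t_def)
    have "[1 + v z * h t = 1 + v z * (x * (p - 1) * 1)] (mod p)"
      using S.h_pow[OF e(1), of "x * (p - 1)"] e by (intro cong_add cong_mult) (auto simp: t_def)
    also have "1 + v z * (x * (p - 1) * 1) = 1 + (v z * x) * (p - 1)"
      by simp
    also have "[\<dots> = 1 + 1 * (p - 1)] (mod p)"
      using x by (intro cong_add cong_mult) auto
    also have "1 + 1 * (p - 1) = p"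
      using S.p_gt_2 by simp
    also have "[p = 0] (mod p)"
      by (simp add: cong_def)
    finally have "z [^]\<^bsub>S\<^esub> (1 + v z * h t) = z [^]\<^bsub>S\<^esub> (0::nat)"
      by (rule S.z_pow_cong)
    then have "z \<otimes>\<^bsub>S\<^esub> z [^]\<^bsub>S\<^esub> (v z * h t) = \<one>\<^bsub>S\<^esub>"
      by (simp add: S.m_comm)
    then have "sc z t = t"
      using t by (simp add: sc S.m_comm[of z t] S.m_assoc)
    then have "E 0 z \<otimes> E 0 t = E 0 t"
      using t by (simp add: circ_E0)
    then have "E 0 z = E 0 \<one>\<^bsub>S\<^esub>"
      using t Q_zero zero_eq_one by simp
    then show False
      using S.z_neq by (simp add: E_eq_iff)
  qed
  have v_z_pow: "[v (s \<otimes>\<^bsub>S\<^esub> z [^]\<^bsub>S\<^esub> n) = v s] (mod p)" if s: "s \<in> carrier S" for s and n :: nat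
  proof (induction n)
    case 0
    show ?case
      using s by simp
  next
    case (Suc n)
    let ?t = "s \<otimes>\<^bsub>S\<^esub> z [^]\<^bsub>S\<^esub> n"
    have "z [^]\<^bsub>S\<^esub> (v ?t * h z) = z [^]\<^bsub>S\<^esub> (v ?t * 0)"
      using S.h_z by (intro S.z_pow_cong cong_mult) auto
    then have "sc ?t z = s \<otimes>\<^bsub>S\<^esub> z [^]\<^bsub>S\<^esub> Suc n"
      using s by (simp add: sc S.m_assoc)
    moreover have "[v ?t + v z = v s + 0] (mod p)"
      using Suc v_z by (rule cong_add)
    ultimately show ?case
      using v_sc[of ?t z] s by (simp add: cong_trans)
  qed
  have v_e_pow: "[v (e [^]\<^bsub>S\<^esub> n) = n * v e] (mod p)" for n :: nat
  proof (induction n)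
    case 0
    show ?case
      using v_one by simp
  next
    case (Suc n)
    let ?t = "e [^]\<^bsub>S\<^esub> n"
    have "[v (sc ?t e) = v (e [^]\<^bsub>S\<^esub> Suc n)] (mod p)"
      using v_z_pow[of "e [^]\<^bsub>S\<^esub> Suc n"] e by (simp add: sc)
    moreover have "[v (sc ?t e) = n * v e + v e] (mod p)"
      using v_sc[of ?t e] cong_add[OF Suc cong_refl[of "v e"]] e by (metis S.nat_pow_closed cong_trans)
    ultimately show ?case
      by (metis add.commute cong_sym cong_trans mult_Suc)
  qed
  have v_eq: "[v s = v e * h s] (mod p)" if s: "s \<in> carrier S" for s
  proof -
    obtain n where "s = e [^]\<^bsub>S\<^esub> h s \<otimes>\<^bsub>S\<^esub> z [^]\<^bsub>S\<^esub> (n::nat)"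
      using generate[OF s] ..
    then have "[v s = v (e [^]\<^bsub>S\<^esub> h s)] (mod p)"
      using v_z_pow[of "e [^]\<^bsub>S\<^esub> h s" n] e by simp
    then show ?thesis
      using v_e_pow[of "h s"] by (metis cong_trans mult.commute)
  qed
  have "sc s t = S.circ (v e) s t" if "s \<in> carrier S" "t \<in> carrier S" for s t
  proof -
    have "z [^]\<^bsub>S\<^esub> (v s * h t) = z [^]\<^bsub>S\<^esub> (v e * h s * h t)"
      using v_eq that by (intro S.z_pow_cong cong_mult) auto
    then show ?thesis
      using that by (simp add: sc S.circ_def)
  qed
  then show ?thesis
    by blast
qed

lemma iso_model: "\<exists>c g. S.character g \<and> skew_brace_iso B (S.model c g) \<noteq> {}"
proof -
  obtain c where "\<forall>s\<in>carrier S. \<forall>t\<in>carrier S. sc s t = S.circ c s t"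
    using ex_circ ..
  then have circ: "\<And>s t. s \<in> carrier S \<Longrightarrow> t \<in> carrier S \<Longrightarrow> sc s t = S.circ c s t"
    by blast
  \<comment> \<open>The factor by which left multiplication by \<open>E a s\<close> acts on first
    coordinates. Associativity makes it multiplicative for \<open>sc\<close>, so its values are
    roots of unity and hence powers of r.\<close>
  define \<psi> where "\<psi> s = R s * chi (E 0 s)" for s
  have circ_\<psi>: "E a s \<otimes> E b t = E (a + \<psi> s * b) (sc s t)"
    if "s \<in> carrier S" "t \<in> carrier S" for a b s t
    using that by (simp add: circ_E \<psi>_def mult.assoc)
  have \<psi>_sc: "[\<psi> (sc s t) = \<psi> s * \<psi> t] (mod int q)" if s: "s \<in> carrier S" and t: "t \<in> carrier S" for s t
  proof -
    have "E 0 s \<otimes> (E 0 t \<otimes> Q 1) = (E 0 s \<otimes> E 0 t) \<otimes> Q 1"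
      using s t by (simp add: m_assoc)
    then have "E (\<psi> s * \<psi> t) (sc s (sc t \<one>\<^bsub>S\<^esub>)) = E (\<psi> (sc s t)) (sc (sc s t) \<one>\<^bsub>S\<^esub>)"
      using s t by (simp add: circ_\<psi>)
    then show ?thesis
      using s t by (simp add: E_eq_iff cong_sym_eq)
  qed
  have \<psi>_one: "[\<psi> \<one>\<^bsub>S\<^esub> = 1] (mod int q)"
    using cong_mult[OF R_one chi_Q[of 0]] by (simp add: \<psi>_def)
  have "\<exists>i. [\<psi> s = int r ^ i] (mod int q)" if s: "s \<in> carrier S" for s
    using S.root_of_unity_is_power sc_character_root_of_unity[OF \<psi>_one \<psi>_sc s] by blast
  then obtain g where g: "\<And>s. s \<in> carrier S \<Longrightarrow> [\<psi> s = int r ^ g s] (mod int q)"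
    by metis
  have g_circ: "[g (S.circ c s t) = g s + g t] (mod p)" if s: "s \<in> carrier S" and t: "t \<in> carrier S" for s t
  proof -
    have "[int r ^ g (sc s t) = int r ^ g s * int r ^ g t] (mod int q)"
      using g[of "sc s t"] \<psi>_sc[OF s t] cong_mult[OF g[OF s] g[OF t]] s t
      by (metis cong_sym cong_trans sc_closed)
    then show ?thesis
      using s t by (simp add: circ S.r_pow_cong_iff flip: power_add)
  qed
  \<comment> \<open>The exponent \<open>g\<close> is additive for \<open>circ c\<close>;
    \<open>untwist c\<close> turns it into a character of S, as the models require.\<close>
  define g' where "g' s = g (S.untwist c s)" for s
  have g': "S.character g'"
    using g_circ by (simp add: S.character_def g'_def S.untwist_mult)
  define f where "f x = (co x mod int q, pr x)" for x
  have f_E: "f (E a s) = (a mod int q, s)" if s: "s \<in> carrier S" for a s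
  proof -
    have "E (co (E a s)) s = E a s"
      using E_co_pr[of "E a s"] s by simp
    then show ?thesis
      using s by (simp add: f_def E_eq_iff cong_def)
  qed
  have q0: "int q > 0"
    using prime_gt_0_nat[OF S.prime_q] by simp
  have "bij_betw f (carrier B) (carrier (S.model c g'))"
  proof (rule bij_betw_byWitness[where f' = "\<lambda>(a, s). E a s"])
    show "\<forall>x\<in>carrier B. (\<lambda>(a, s). E a s) (f x) = x"
    proof
      fix x assume "x \<in> carrier B"
      then obtain a s where "x = E a s" "s \<in> carrier S"
        using E_surj by blast
      then show "(\<lambda>(a, s). E a s) (f x) = x"
        by (simp add: f_E E_eq_iff cong_def)
    qed
    show "\<forall>x\<in>carrier (S.model c g'). f ((\<lambda>(a, s). E a s) x) = x"
      by (auto simp: S.model_simps f_E)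
    show "f ` carrier B \<subseteq> carrier (S.model c g')"
      using q0 by (auto simp: S.model_simps f_def)
    show "(\<lambda>(a, s). E a s) ` carrier (S.model c g') \<subseteq> carrier B"
      by (auto simp: S.model_simps)
  qed
  moreover have "f (x \<oplus> y) = f x \<oplus>\<^bsub>S.model c g'\<^esub> f y \<and> f (x \<otimes> y) = f x \<otimes>\<^bsub>S.model c g'\<^esub> f y"
    if xy: "x \<in> carrier B" "y \<in> carrier B" for x y
  proof -
    obtain a s where x: "x = E a s" "s \<in> carrier S"
      using E_surj[OF xy(1)] by blast
    obtain b t where y: "y = E b t" "t \<in> carrier S"
      using E_surj[OF xy(2)] by blast
    have "g' (S.twist c s) = g s"
      using x by (simp add: g'_def S.untwist_twist)
    moreover have "[a + \<psi> s * b = a + int r ^ g s * b] (mod int q)"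
      using g x by (intro cong_add cong_mult) auto
    ultimately show ?thesis
      using x y by (simp add: E_add circ_\<psi> f_E S.model_simps circ mod_simps mod_add_mult_mod_eq cong_def)
  qed
  ultimately have "f \<in> skew_brace_iso B (S.model c g')"
    by (simp add: skew_brace_iso_def)
  then show ?thesis
    using g' by blast
qed

end

lemma (in left_trivial_coordinates) iso_model:
  "\<exists>c g. S.character g \<and> skew_brace_iso B (S.model c g) \<noteq> {}"
proof (rule ex_invariant_complement)
  fix W assume W: "left_trivial_coordinates S z h p q r B (\<lambda>a s. E (a + W * (1 - R s)) s)"
    "\<And>s t. s \<in> carrier S \<Longrightarrow> t \<in> carrier S \<Longrightarrow> \<exists>u\<in>carrier S.
      lam (E (0 + W * (1 - R s)) s) (E (0 + W * (1 - R t)) t) = E (0 + W * (1 - R u)) u"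
  have "split_coordinates S z h p q r B (\<lambda>a s. E (a + W * (1 - R s)) s)"
    using W by (intro split_coordinates.intro split_coordinates_axioms.intro)
  then show ?thesis
    by (rule split_coordinates.iso_model)
qed

lemma (in prime_square_data) ex_coordinates:
  fixes B :: "'b ring"
  assumes B: "skew_brace B" and iso: "add_monoid B \<cong> semidirect h"
  shows "\<exists>E. brace_coordinates S z h p q r B E"
proof -
  have "group (add_monoid B)"
    using B by (rule skew_brace.add_group)
  then have "semidirect h \<cong> add_monoid B"
    using iso by (rule group.iso_sym)
  then obtain f where "f \<in> iso (semidirect h) (add_monoid B)"
    by (auto simp: is_iso_def)
  then have f: "f \<in> hom (semidirect h) (add_monoid B)"
    and bij: "bij_betw f ({0..<int q} \<times> carrier S) (carrier B)"
    by (simp_all add: iso_def semidirect_def)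
  have q0: "int q > 0"
    using prime_gt_0_nat[OF prime_q] by simp
  have "brace_coordinates S z h p q r B (\<lambda>a s. f (a mod int q, s))"
  proof (intro brace_coordinates.intro brace_coordinates_axioms.intro)
    show "prime_square_data S z h p q r"
      by (rule prime_square_data_axioms)
    show "skew_brace B"
      by (rule B)
    show "f (a mod int q, s) \<in> carrier B" if "s \<in> carrier S" for a s
      using bij_betw_apply[OF bij] that q0 by simp
    show "f (a mod int q, s) = f (b mod int q, t) \<longleftrightarrow> [a = b] (mod int q) \<and> s = t"
      if "s \<in> carrier S" "t \<in> carrier S" for a b s t
      using inj_on_eq_iff[OF bij_betw_imp_inj_on[OF bij], of "(a mod int q, s)" "(b mod int q, t)"] that q0
      by (simp add: cong_def)
    show "\<exists>a. \<exists>s\<in>carrier S. x = f (a mod int q, s)" if "x \<in> carrier B" for x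
    proof -
      have "x \<in> f ` ({0..<int q} \<times> carrier S)"
        using bij that by (simp add: bij_betw_def)
      then obtain a s where "0 \<le> a" "a < int q" "s \<in> carrier S" "x = f (a, s)"
        by auto
      then show ?thesis
        by (intro exI[of _ a] bexI[of _ s]) simp_all
    qed
    show "f (a mod int q, s) \<oplus>\<^bsub>B\<^esub> f (b mod int q, t) = f ((a + int r ^ h s * b) mod int q, s \<otimes> t)"
      if "s \<in> carrier S" "t \<in> carrier S" for a b s t
      using hom_mult[OF f, of "(a mod int q, s)" "(b mod int q, t)"] that q0
      by (simp add: semidirect_def mod_simps mod_add_mult_mod_eq)
  qed
  then show ?thesis
    by blast
qed

lemma (in prime_square_data) left_trivial_iso_model:
  fixes B :: "'b ring"
  assumes "skew_brace B" "add_monoid B \<cong> semidirect h" "left_trivial q B"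
  shows "\<exists>c g. character g \<and> skew_brace_iso B (model c g) \<noteq> {}"
proof -
  obtain E where "brace_coordinates S z h p q r B E"
    using ex_coordinates assms by blast
  then have "left_trivial_coordinates S z h p q r B E"
    using assms(3) by (intro left_trivial_coordinates.intro left_trivial_coordinates_axioms.intro)
  then show ?thesis
    by (rule left_trivial_coordinates.iso_model)
qed

lemma (in prime_square_data) left_trivial_or_opposite:
  fixes B :: "'b ring"
  assumes "skew_brace B" "add_monoid B \<cong> semidirect h"
  shows "left_trivial q B \<or> left_trivial q (opposite_brace B)"
proof -
  obtain E where "brace_coordinates S z h p q r B E"
    using ex_coordinates assms by blast
  then show ?thesis
    by (rule brace_coordinates.left_trivial_cases)
qed

section \<open>Counting\<close>

lemma skew_brace_iso_imp_iso:
  assumes "skew_brace_iso B C \<noteq> {}"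
  shows "B \<cong> C"
proof -
  obtain f where "f \<in> skew_brace_iso B C"
    using assms by blast
  then have "f \<in> iso B C"
    by (auto simp: skew_brace_iso_def iso_def hom_def bij_betw_apply)
  then show ?thesis
    by (rule is_isoI)
qed

lemma iso_pow_eq_one:
  assumes G: "group G" and H: "group H" and iso: "G \<cong> H"
    and H_pow: "\<And>y. y \<in> carrier H \<Longrightarrow> y [^]\<^bsub>H\<^esub> (n::nat) = \<one>\<^bsub>H\<^esub>" and x: "x \<in> carrier G"
  shows "x [^]\<^bsub>G\<^esub> n = \<one>\<^bsub>G\<^esub>"
proof -
  obtain f where f: "f \<in> hom G H" and bij: "bij_betw f (carrier G) (carrier H)"
    using iso by (auto simp: is_iso_def iso_def)
  interpret G: group G by (rule G)
  interpret H: group H by (rule H)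
  interpret f: group_hom G H f
    using f by unfold_locales
  have "f (x [^]\<^bsub>G\<^esub> n) = f \<one>\<^bsub>G\<^esub>"
    using x H_pow by (simp add: f.hom_nat_pow)
  then show ?thesis
    using inj_onD[OF bij_betw_imp_inj_on[OF bij]] x by simp
qed

section \<open>Isomorphism types of the semidirect products, and the doubling\<close>

context prime_square_data
begin

lemma semidirect_iso_semidirect:
  assumes f: "f \<in> iso S S" and gf: "\<And>s. s \<in> carrier S \<Longrightarrow> [g' (f s) = g s] (mod p)"
  shows "semidirect g \<cong> semidirect g'"
proof -
  have bij: "bij_betw f (carrier S) (carrier S)" and f_mult: "\<And>s t. s \<in> carrier S \<Longrightarrow> t \<in> carrier S \<Longrightarrow> f (s \<otimes> t) = f s \<otimes> f t"
    using f by (auto simp: iso_def hom_def)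
  have g_cong: "[a + int r ^ g' (f s) * b = a + int r ^ g s * b] (mod int q)" if "s \<in> carrier S" for a b s
    using gf that by (intro cong_add cong_mult r_pow_cong) auto
  have "(\<lambda>(a, s). (a, f s)) \<in> iso (semidirect g) (semidirect g')"
    using f_mult g_cong bij bij_betw_apply[OF bij] prime_gt_0_nat[OF prime_q]
      bij_betw_map_prod[OF bij_betw_id bij, of "{0..<int q}"]
    by (auto simp: iso_def hom_def semidirect_def map_prod_def cong_def)
  then show ?thesis
    by (rule is_isoI)
qed

lemma semidirect_cong:
  assumes "\<And>s. s \<in> carrier S \<Longrightarrow> [g' s = g s] (mod p)"
  shows "semidirect g \<cong> semidirect g'"
  using semidirect_iso_semidirect[of id g' g] assms by (simp add: iso_set_refl id_def)

text \<open>The elements \<open>(1, \<one>)\<close> and \<open>(0, s)\<close> commute only if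
  \<open>r ^ g s\<close> is 1 modulo q.\<close>

lemma semidirect_comm_imp_trivial:
  assumes g: "character g" and iso: "semidirect g \<cong> Y" and comm: "comm_group Y"
    and s: "s \<in> carrier S"
  shows "[g s = 0] (mod p)"
proof -
  interpret Y: comm_group Y
    by (rule comm)
  obtain f where hom: "f \<in> hom (semidirect g) Y" and inj: "inj_on f (carrier (semidirect g))"
    using iso by (auto simp: is_iso_def iso_def bij_betw_def)
  have q1: "int q > 1"
    using prime_gt_1_nat[OF prime_q] by simp
  define x y where "x = (1 :: int, \<one>)" and "y = (0 :: int, s)"
  have xy: "x \<in> carrier (semidirect g)" "y \<in> carrier (semidirect g)"
    using s q1 by (simp_all add: semidirect_def x_def y_def)
  have "f (x \<otimes>\<^bsub>semidirect g\<^esub> y) = f (y \<otimes>\<^bsub>semidirect g\<^esub> x)"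
    using xy by (simp add: hom_mult[OF hom] Y.m_comm hom_in_carrier[OF hom])
  then have "x \<otimes>\<^bsub>semidirect g\<^esub> y = y \<otimes>\<^bsub>semidirect g\<^esub> x"
    using xy by (intro inj_onD[OF inj]) (simp_all add: monoid.m_closed[OF group.is_monoid[OF group_semidirect[OF g]]])
  then have "[int r ^ g s = int r ^ 0] (mod int q)"
    using s q1 by (simp add: semidirect_def x_def y_def cong_def)
  then show ?thesis
    by (simp only: r_pow_cong_iff)
qed

lemma semidirect_pow: "\<exists>b. (a, s) [^]\<^bsub>semidirect g\<^esub> (n::nat) = (b, s [^] n)"
  by (induction n) (auto simp: semidirect_def nat_pow_def)

text \<open>The p-th power of an element falls into Z_q, and its q-th power is then trivial.\<close>

lemma semidirect_exponent:
  assumes g: "character g" and S_pow: "\<And>s. s \<in> carrier S \<Longrightarrow> s [^] p = \<one>"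
    and x: "x \<in> carrier (semidirect g)"
  shows "x [^]\<^bsub>semidirect g\<^esub> (p * q) = \<one>\<^bsub>semidirect g\<^esub>"
proof -
  obtain a s where as: "x = (a, s)" "s \<in> carrier S"
    using x by (auto simp: semidirect_def)
  obtain b where b: "x [^]\<^bsub>semidirect g\<^esub> p = (b, \<one>)"
    using semidirect_pow[of g a s p] S_pow as by auto
  have "[int r ^ g \<one> = 1] (mod int q)"
    using r_pow_cong[OF character_one[OF g]] by simp
  then have one: "[c + int r ^ g \<one> * b = c + 1 * b] (mod int q)" for c
    by (intro cong_add cong_mult) auto
  have "(b, \<one>) [^]\<^bsub>semidirect g\<^esub> n = ((int n * b) mod int q, \<one>)" for n :: nat
  proof (induction n)
    case (Suc n)
    then show ?case
      using one[of "int n * b"] by (simp add: semidirect_def cong_def mod_simps algebra_simps)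
  qed (simp add: semidirect_def)
  then have "(b, \<one>) [^]\<^bsub>semidirect g\<^esub> q = \<one>\<^bsub>semidirect g\<^esub>"
    by (simp add: semidirect_def)
  then show ?thesis
    using monoid.nat_pow_pow[OF group.is_monoid[OF group_semidirect[OF g]] x, of p q] b by simp
qed

text \<open>The factor 2 is the Boolean in the index set, which chooses between a model and its
  opposite. \<open>left_trivial\<close> holds exactly for the first kind, so no class is counted
  twice, and \<open>left_trivial_or_opposite\<close> shows that no brace is missed.\<close>

lemma num_skew_braces_models:
  fixes c :: "'i \<Rightarrow> nat" and g :: "'i \<Rightarrow> 's \<Rightarrow> nat"
  assumes X: "semidirect h \<cong> X"
    and models: "\<And>i. i \<in> I \<Longrightarrow> character (g i)" "\<And>i. i \<in> I \<Longrightarrow> semidirect (g i) \<cong> Y"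
    and distinct: "\<And>i j. i \<in> I \<Longrightarrow> j \<in> I \<Longrightarrow>
      skew_brace_iso (model (c i) (g i)) (model (c j) (g j)) \<noteq> {} \<Longrightarrow> i = j"
    and complete: "\<And>d k. character k \<Longrightarrow> semidirect k \<cong> Y \<Longrightarrow>
      \<exists>i\<in>I. skew_brace_iso (model d k) (model (c i) (g i)) \<noteq> {}"
  shows "num_skew_braces X Y = 2 * card I"
proof -
  define M where "M = (\<lambda>(b, i). if b then model (c i) (g i) else opposite_brace (model (c i) (g i)))"
  have model_i: "skew_brace (model (c i) (g i))" if "i \<in> I" for i
    using models(1)[OF that] by (rule skew_brace_model)
  have M_brace: "skew_brace (M (b, i))" if "i \<in> I" for b i
    using model_i[OF that] skew_brace.opposite_brace[OF model_i[OF that]] by (simp add: M_def)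
  have "num_skew_braces X Y = card ((UNIV :: bool set) \<times> I)"
  proof (rule num_skew_braces_eq_card[where M = M])
    fix j assume "j \<in> (UNIV :: bool set) \<times> I"
    then obtain b i where j: "j = (b, i)" "i \<in> I"
      by auto
    have "model (c i) (g i) \<cong> Y"
      using model_iso_semidirect[OF models(1)] models(2) j(2) by (blast intro: iso_trans)
    then have "M j \<cong> Y"
      by (simp add: M_def j opposite_brace_iso_mult)
    moreover have model_X: "add_monoid (model (c i) (g i)) \<cong> X"
      unfolding add_monoid_model by (rule X)
    then have "add_monoid (M j) \<cong> X"
      using iso_trans[OF skew_brace.opposite_brace_iso_add[OF model_i[OF j(2)]] model_X]
      by (cases b) (simp_all only: M_def j case_prod_conv if_True if_False)
    moreover have "finite (carrier (M j))"
      using finite_model by (simp add: M_def j)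
    ultimately show "skew_brace (M j) \<and> finite (carrier (M j)) \<and> add_monoid (M j) \<cong> X \<and> M j \<cong> Y"
      using M_brace j by simp
  next
    fix j j' assume "j \<in> (UNIV :: bool set) \<times> I" "j' \<in> (UNIV :: bool set) \<times> I"
      and iso: "skew_brace_iso (M j) (M j') \<noteq> {}"
    then obtain b i b' i' where j: "j = (b, i)" "i \<in> I" "j' = (b', i')" "i' \<in> I"
      by auto
    have triv: "left_trivial q (M (b, i)) \<longleftrightarrow> b" if "i \<in> I" for b i
      using left_trivial_model not_left_trivial_opposite_model models(1)[OF that] by (simp add: M_def)
    have "skew_brace_iso (M j') (M j) \<noteq> {}"
      using skew_brace_iso_sym[OF _ iso] M_brace j by simp
    then have "b = b'"
      using left_trivial_iso[OF _ _ iso, of q] left_trivial_iso[of "M j'" "M j" q] M_brace triv j by auto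
    then have "skew_brace_iso (model (c i) (g i)) (model (c i') (g i')) \<noteq> {}"
      using iso by (simp add: M_def j skew_brace_iso_opposite split: if_splits)
    then show "j = j'"
      using distinct j \<open>b = b'\<close> by blast
  next
    fix B :: "nat ring" assume "B \<in> skew_braces_of_type X Y"
    then have B: "skew_brace B" "add_monoid B \<cong> X" "B \<cong> Y"
      by (auto simp: skew_braces_of_type_def)
    have "X \<cong> semidirect h"
      using group.iso_sym[OF group_semidirect[OF character_h] X] .
    then have add: "add_monoid B \<cong> semidirect h"
      using B(2) iso_trans by blast
    have *: "\<exists>i\<in>I. skew_brace_iso C (model (c i) (g i)) \<noteq> {}"
      if C: "skew_brace C" "add_monoid C \<cong> semidirect h" "C \<cong> Y" "left_trivial q C" for C :: "nat ring"
    proof -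
      obtain d k where k: "character k" "skew_brace_iso C (model d k) \<noteq> {}"
        using left_trivial_iso_model[OF C(1,2,4)] by blast
      have "semidirect k \<cong> model d k"
        by (rule is_isoI[OF semidirect_iso_model])
      moreover have "model d k \<cong> C"
        using skew_brace_iso_imp_iso[OF skew_brace_iso_sym[OF C(1) k(2)]] .
      ultimately have "semidirect k \<cong> Y"
        using C(3) by (rule iso_trans[OF iso_trans])
      then obtain i where "i \<in> I" "skew_brace_iso (model d k) (model (c i) (g i)) \<noteq> {}"
        using complete k(1) by blast
      then show ?thesis
        using skew_brace_iso_trans[OF k(2)] by blast
    qed
    show "\<exists>j\<in>UNIV \<times> I. skew_brace_iso B (M j) \<noteq> {}"
    proof (cases "left_trivial q B")
      case True
      then obtain i where "i \<in> I" "skew_brace_iso B (model (c i) (g i)) \<noteq> {}"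
        using *[OF B(1) add B(3)] by blast
      then show ?thesis
        by (intro bexI[of _ "(True, i)"]) (simp_all add: M_def)
    next
      case False
      then have "left_trivial q (opposite_brace B)"
        using left_trivial_or_opposite[OF B(1) add] by blast
      moreover have "opposite_brace B \<cong> Y"
        using B(3) by (simp only: opposite_brace_iso_mult)
      ultimately obtain i where i: "i \<in> I" "skew_brace_iso (opposite_brace B) (model (c i) (g i)) \<noteq> {}"
        using *[OF skew_brace.opposite_brace[OF B(1)]
          iso_trans[OF skew_brace.opposite_brace_iso_add[OF B(1)] add]] by blast
      then have "skew_brace_iso B (opposite_brace (model (c i) (g i))) \<noteq> {}"
        using skew_brace_iso_opposite[of "opposite_brace B" "model (c i) (g i)"] by simp
      then show ?thesis
        using i(1) by (intro bexI[of _ "(False, i)"]) (simp_all add: M_def)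
    qed
  qed
  then show ?thesis
    by (simp add: card_cartesian_product)
qed

end

section \<open>The two additive groups\<close>

locale p2q_setup =
  fixes p q r :: nat
  assumes prime_p: "prime p" and prime_q: "prime q" and p_gt_2: "p > 2"
    and q_cong: "[q = 1] (mod p)" and q_not_cong: "\<not> [q = 1] (mod p\<^sup>2)"
    and ord_r: "Pocklington.ord q r = p"
begin

abbreviation C :: "int monoid" where "C \<equiv> integer_mod_group (p\<^sup>2)"

abbreviation V :: "(int \<times> int) monoid" where "V \<equiv> integer_mod_group p \<times>\<times> integer_mod_group p"

lemma p0: "p > 0"
  using p_gt_2 by simp

lemma carrier_C: "carrier C = {0..<int (p\<^sup>2)}"
  using p0 by (simp add: carrier_integer_mod_group)

lemma carrier_V: "carrier V = {0..<int p} \<times> {0..<int p}"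
  using p0 by (simp add: carrier_integer_mod_group)

lemma mult_V: "(w, x) \<otimes>\<^bsub>V\<^esub> (w', x') = ((w + w') mod int p, (x + x') mod int p)"
  by simp

lemma pow_V: "(w, x) [^]\<^bsub>V\<^esub> (n::nat) = ((int n * w) mod int p, (int n * x) mod int p)"
  by (induction n) (simp_all add: mod_simps algebra_simps)

lemma cong_nat_mod:
  assumes "0 \<le> x" "0 < m" "p dvd m"
  shows "[nat (x mod int m) = nat x] (mod p)"
proof -
  have "[x mod int m = x] (mod int m)"
    by simp
  then have "[x mod int m = x] (mod int p)"
    using assms(3) by (metis cong_dvd_modulus int_dvd_int_iff)
  then have "[int (nat (x mod int m)) = int (nat x)] (mod int p)"
    using assms by simp
  then show ?thesis
    by (simp only: cong_int_iff)
qed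

text \<open>The element p generates the subgroup of order p of Z_{p^2}. Since \<open>h\<close> is
  read modulo p, \<open>nat\<close> already acts as reduction to Z_p.\<close>

sublocale cyclic: prime_square_data C "int p" nat p q r
proof (intro prime_square_data.intro prime_square_data_axioms.intro)
  have p2: "p < p\<^sup>2"
    using p_gt_2 by (simp add: power2_eq_square)
  show "comm_group C" by simp
  show "order C = p\<^sup>2"
    by (simp add: order_def carrier_C nat_power_eq)
  show "int p \<in> carrier C"
    using p2 by (simp add: carrier_C)
  show "int p \<noteq> \<one>\<^bsub>C\<^esub>"
    using p0 by simp
  show "int p [^]\<^bsub>C\<^esub> p = \<one>\<^bsub>C\<^esub>"
    by (simp add: power2_eq_square)
  show "[nat (s \<otimes>\<^bsub>C\<^esub> t) = nat s + nat t] (mod p)" if "s \<in> carrier C" "t \<in> carrier C" for s t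
    using cong_nat_mod[of "s + t" "p\<^sup>2"] that p0 by (simp add: carrier_C nat_add_distrib)
  show "[nat (int p) = 0] (mod p)"
    by (simp add: cong_def)
  show "\<exists>n. s = int p [^]\<^bsub>C\<^esub> (n::nat)" if sC: "s \<in> carrier C" and hs: "[nat s = 0] (mod p)" for s
  proof -
    obtain n where n: "nat s = p * n"
      using hs by (auto simp: cong_0_iff elim: dvdE)
    then have "s = int p * int n"
      using sC by (simp add: carrier_C nat_eq_iff flip: of_nat_mult)
    then show ?thesis
      using sC by (intro exI[of _ n]) (simp add: carrier_C mult.commute)
  qed
  show "\<exists>e\<in>carrier C. nat e = 1"
    using p2 p_gt_2 by (intro bexI[of _ 1]) (simp_all add: carrier_C)
qed (rule prime_p p_gt_2 prime_q q_cong q_not_cong ord_r)+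

abbreviation h_V :: "int \<times> int \<Rightarrow> nat" where "h_V \<equiv> \<lambda>(w, x). nat x"

text \<open>The first factor is the kernel of \<open>h\<close>, that is, the direct factor Z_p of
  the additive group; the second acts on Z_q through r.\<close>

sublocale elementary: prime_square_data V "(1, 0)" h_V p q r
proof (intro prime_square_data.intro prime_square_data_axioms.intro)
  show "comm_group V"
  proof (rule group.group_comm_groupI)
    show "group V" by (simp add: DirProd_group)
  qed (auto simp: add.commute)
  show "order V = p\<^sup>2"
    by (simp add: order_def carrier_V power2_eq_square del: carrier_DirProd)
  show "(1, 0) \<in> carrier V"
    using p_gt_2 by (simp add: carrier_V del: carrier_DirProd)
  show "(1, 0) \<noteq> \<one>\<^bsub>V\<^esub>"
    by simp
  show "(1, 0) [^]\<^bsub>V\<^esub> p = \<one>\<^bsub>V\<^esub>"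
    by (simp add: pow_V)
  show "[h_V (s \<otimes>\<^bsub>V\<^esub> t) = h_V s + h_V t] (mod p)" if "s \<in> carrier V" "t \<in> carrier V" for s t
    using that p0 cong_nat_mod[of "snd s + snd t" p]
    by (cases s; cases t) (simp add: carrier_integer_mod_group nat_add_distrib)
  show "[h_V (1, 0) = 0] (mod p)"
    by (simp add: cong_def)
  show "\<exists>n. s = (1, 0) [^]\<^bsub>V\<^esub> (n::nat)" if sV: "s \<in> carrier V" and hs: "[h_V s = 0] (mod p)" for s
  proof -
    obtain w x where s: "s = (w, x)" "0 \<le> w" "w < int p" "0 \<le> x" "x < int p"
      using sV p0 by (cases s) (auto simp: carrier_integer_mod_group)
    then have "x = 0"
      using hs s by (auto simp: cong_def nat_mod_eq_iff)
    then show ?thesis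
      using s by (intro exI[of _ "nat w"]) (simp add: pow_V)
  qed
  show "\<exists>e\<in>carrier V. h_V e = 1"
    using p_gt_2 by (intro bexI[of _ "(0, 1)"]) (simp_all add: carrier_integer_mod_group)
qed (rule prime_p p_gt_2 prime_q q_cong q_not_cong ord_r)+

text \<open>The general character of Z_p x Z_p up to congruence (\<open>character_V_eq\<close>),
  given by its values e at \<open>(1, 0)\<close> and d at \<open>(0, 1)\<close>; \<open>h_V\<close>
  is the case e = 0, d = 1.\<close>

definition ch :: "nat \<Rightarrow> nat \<Rightarrow> int \<times> int \<Rightarrow> nat" where
  "ch e d = (\<lambda>(w, x). e * nat w + d * nat x)"

lemma cyclic_semidirect_eq: "cyclic.semidirect nat = cyclic_semidirect q (p\<^sup>2) r"
  using prime_gt_0_nat[OF prime_q]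
  by (simp add: cyclic.semidirect_def cyclic_semidirect_def carrier_integer_mod_group)

lemma elementary_semidirect_iso:
  "elementary.semidirect h_V \<cong> integer_mod_group p \<times>\<times> cyclic_semidirect q p r"
proof -
  have q0: "q > 0"
    using prime_gt_0_nat[OF prime_q] .
  have "bij_betw (\<lambda>(a, w, x). (w, a, x)) ({0..<int q} \<times> {0..<int p} \<times> {0..<int p})
      ({0..<int p} \<times> {0..<int q} \<times> {0..<int p})"
    by (rule bij_betw_byWitness[where f' = "\<lambda>(w, a, x). (a, w, x)"]) auto
  then have "(\<lambda>(a, w, x). (w, a, x)) \<in>
      iso (elementary.semidirect h_V) (integer_mod_group p \<times>\<times> cyclic_semidirect q p r)"
    using q0 p0
    by (auto simp: iso_def hom_def elementary.semidirect_def cyclic_semidirect_def carrier_integer_mod_group)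
  then show ?thesis
    by (rule is_isoI)
qed

lemma elementary_trivial_iso:
  "elementary.semidirect (ch 0 0) \<cong> (integer_mod_group p \<times>\<times> integer_mod_group p) \<times>\<times> integer_mod_group q"
proof -
  have q0: "q > 0"
    using prime_gt_0_nat[OF prime_q] .
  have "bij_betw (\<lambda>(a, w, x). ((w, x), a)) ({0..<int q} \<times> {0..<int p} \<times> {0..<int p})
      (({0..<int p} \<times> {0..<int p}) \<times> {0..<int q})"
    by (rule bij_betw_byWitness[where f' = "\<lambda>((w, x), a). (a, w, x)"]) auto
  then have "(\<lambda>(a, w, x). ((w, x), a)) \<in>
      iso (elementary.semidirect (ch 0 0)) ((integer_mod_group p \<times>\<times> integer_mod_group p) \<times>\<times> integer_mod_group q)"
    using q0 p0
    by (auto simp: iso_def hom_def elementary.semidirect_def ch_def carrier_integer_mod_group)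
  then show ?thesis
    by (rule is_isoI)
qed

lemma cyclic_trivial_iso: "cyclic.semidirect (\<lambda>_. 0) \<cong> integer_mod_group (p\<^sup>2 * q)"
proof -
  have q0: "q > 0"
    using prime_gt_0_nat[OF prime_q] .
  have "\<not> q dvd p"
    using cyclic.p_less_q p_gt_2 by (auto dest: dvd_imp_le)
  then have coprime: "coprime (int (p\<^sup>2)) (int q)"
    using prime_imp_coprime[OF prime_q, of p] by (simp add: coprime_commute)
  define f where "f n = (n mod int q, n mod int (p\<^sup>2))" for n
  have "inj_on f {0..<int (p\<^sup>2 * q)}"
  proof (rule inj_onI)
    fix m n assume mn: "m \<in> {0..<int (p\<^sup>2 * q)}" "n \<in> {0..<int (p\<^sup>2 * q)}" "f m = f n"
    then have "[m = n] (mod int (p\<^sup>2))" "[m = n] (mod int q)"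
      by (simp_all add: f_def cong_def)
    then have "[m = n] (mod int (p\<^sup>2) * int q)"
      using coprime by (rule coprime_cong_mult)
    then show "m = n"
      using mn by (simp add: cong_def)
  qed
  moreover have "f ` {0..<int (p\<^sup>2 * q)} \<subseteq> {0..<int q} \<times> {0..<int (p\<^sup>2)}"
    using p0 q0 by (auto simp: f_def)
  moreover have "card ({0..<int q} \<times> {0..<int (p\<^sup>2)}) \<le> card {0..<int (p\<^sup>2 * q)}"
    by (simp add: nat_mult_distrib nat_power_eq mult.commute)
  ultimately have "bij_betw f {0..<int (p\<^sup>2 * q)} ({0..<int q} \<times> {0..<int (p\<^sup>2)})"
    by (metis bij_betw_def card_image card_seteq finite_atLeastLessThan_int finite_cartesian_product)
  moreover have "f ((m + n) mod int (p\<^sup>2 * q)) = ((m mod int q + n mod int q) mod int q,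
      (m mod int (p\<^sup>2) + n mod int (p\<^sup>2)) mod int (p\<^sup>2))" for m n
    by (simp add: f_def mod_simps mod_mod_cancel)
  ultimately have "f \<in> iso (integer_mod_group (p\<^sup>2 * q)) (cyclic.semidirect (\<lambda>_. 0))"
    using p0 q0
    by (auto simp: iso_def hom_def cyclic.semidirect_def carrier_integer_mod_group)
       (simp_all add: f_def)
  then show ?thesis
    using group.iso_sym[OF group_integer_mod_group is_isoI] by blast
qed

section \<open>Automorphisms and characters of Z_{p^2} and Z_p x Z_p\<close>

lemma iso_C:
  assumes d: "\<not> p dvd d"
  shows "(\<lambda>x. (int d * x) mod int (p\<^sup>2)) \<in> iso C C"
proof -
  have coprime: "coprime (int d) (int (p\<^sup>2))"
    using prime_imp_coprime[OF prime_p d] by (simp add: coprime_commute)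
  have "inj_on (\<lambda>x. (int d * x) mod int (p\<^sup>2)) {0..<int (p\<^sup>2)}"
  proof (rule inj_onI)
    fix x y assume xy: "x \<in> {0..<int (p\<^sup>2)}" "y \<in> {0..<int (p\<^sup>2)}"
      "(int d * x) mod int (p\<^sup>2) = (int d * y) mod int (p\<^sup>2)"
    then have "[int d * x = int d * y] (mod int (p\<^sup>2))"
      by (simp only: cong_def)
    then have "[x = y] (mod int (p\<^sup>2))"
      using coprime by (simp only: cong_mult_lcancel)
    then show "x = y"
      using xy by (simp add: cong_def)
  qed
  moreover have "(\<lambda>x. (int d * x) mod int (p\<^sup>2)) ` {0..<int (p\<^sup>2)} \<subseteq> {0..<int (p\<^sup>2)}"
    using p0 by auto
  ultimately have "bij_betw (\<lambda>x. (int d * x) mod int (p\<^sup>2)) {0..<int (p\<^sup>2)} {0..<int (p\<^sup>2)}"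
    by (simp add: bij_betw_def endo_inj_surj)
  then show ?thesis
    using p0 by (simp add: iso_def hom_def carrier_C Pi_def mod_simps distrib_left)
qed

lemma iso_V:
  assumes det: "\<not> int p dvd a * d - b * c"
  shows "(\<lambda>(w, x). ((a * w + b * x) mod int p, (c * w + d * x) mod int p)) \<in> iso V V"
proof -
  define f where "f = (\<lambda>(w, x). ((a * w + b * x) mod int p, (c * w + d * x) mod int p))"
  have prime: "prime (int p)"
    using prime_p by simp
  have "inj_on f ({0..<int p} \<times> {0..<int p})"
  proof (rule inj_onI)
    fix s t assume st: "s \<in> {0..<int p} \<times> {0..<int p}" "t \<in> {0..<int p} \<times> {0..<int p}" "f s = f t"
    obtain w x w' x' where s: "s = (w, x)" and t: "t = (w', x')"
      by (cases s; cases t)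
    have 1: "int p dvd (a * w + b * x) - (a * w' + b * x')"
      and 2: "int p dvd (c * w + d * x) - (c * w' + d * x')"
      using st by (simp_all add: f_def s t mod_eq_dvd_iff)
    have "int p dvd d * ((a * w + b * x) - (a * w' + b * x')) - b * ((c * w + d * x) - (c * w' + d * x'))"
      "int p dvd a * ((c * w + d * x) - (c * w' + d * x')) - c * ((a * w + b * x) - (a * w' + b * x'))"
      by (meson 1 2 dvd_diff dvd_mult)+
    moreover have "d * ((a * w + b * x) - (a * w' + b * x')) - b * ((c * w + d * x) - (c * w' + d * x'))
        = (a * d - b * c) * (w - w')"
      "a * ((c * w + d * x) - (c * w' + d * x')) - c * ((a * w + b * x) - (a * w' + b * x'))
        = (a * d - b * c) * (x - x')"
      by (simp_all add: algebra_simps)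
    ultimately have "int p dvd w - w'" "int p dvd x - x'"
      using det prime by (simp_all add: prime_dvd_mult_iff)
    then have "w mod int p = w' mod int p" "x mod int p = x' mod int p"
      by (simp_all add: mod_eq_dvd_iff)
    then show "s = t"
      using st by (simp add: s t)
  qed
  moreover have "f ` ({0..<int p} \<times> {0..<int p}) \<subseteq> {0..<int p} \<times> {0..<int p}"
    using p0 by (auto simp: f_def)
  ultimately have "bij_betw f ({0..<int p} \<times> {0..<int p}) ({0..<int p} \<times> {0..<int p})"
    by (simp add: bij_betw_def endo_inj_surj)
  moreover have "f ((w + w') mod int p, (x + x') mod int p) = f (w, x) \<otimes>\<^bsub>V\<^esub> f (w', x')" for w x w' x'
  proof -
    have "(a * ((w + w') mod int p) + b * ((x + x') mod int p)) mod int p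
        = ((a * w + b * x) mod int p + (a * w' + b * x') mod int p) mod int p" for a b
    proof -
      have "(a * ((w + w') mod int p) + b * ((x + x') mod int p)) mod int p
          = (a * (w + w') + b * (x + x')) mod int p"
        by (metis mod_add_cong mod_mult_right_eq)
      also have "a * (w + w') + b * (x + x') = (a * w + b * x) + (a * w' + b * x')"
        by (simp add: algebra_simps)
      finally show ?thesis
        by (simp only: mod_add_eq)
    qed
    then show ?thesis
      by (simp add: f_def)
  qed
  ultimately have "f \<in> iso V V"
    using p0 unfolding iso_def hom_def
    by (auto simp: carrier_integer_mod_group f_def)
  then show ?thesis
    by (simp add: f_def)
qed

lemma character_C: "cyclic.character (\<lambda>x. d * nat x)"
  using cyclic.h_mult unfolding cyclic.character_def
  by (metis cong_scalar_left distrib_left)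

lemma character_C_eq:
  assumes g: "cyclic.character g" and x: "x \<in> carrier C"
  shows "[g x = g 1 mod p * nat x] (mod p)"
proof -
  have "1 \<in> carrier C"
    using p_gt_2 by (simp add: carrier_C)
  then have "[g (1 [^]\<^bsub>C\<^esub> nat x) = nat x * g 1] (mod p)"
    by (rule cyclic.character_pow[OF g])
  then have "[g x = g 1 * nat x] (mod p)"
    using x by (simp add: carrier_C mult.commute)
  then show ?thesis
    by (simp add: cong_def mod_simps)
qed

lemma ch_mod:
  assumes "0 \<le> w" "0 \<le> x"
  shows "[ch e d (w mod int p, x mod int p) = e * nat w + d * nat x] (mod p)"
  using cong_nat_mod[OF assms(1) p0] cong_nat_mod[OF assms(2) p0] unfolding ch_def
  by (auto intro!: cong_add cong_mult)

lemma character_V: "elementary.character (ch e d)"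
  unfolding elementary.character_def
proof (intro ballI)
  fix s t assume "s \<in> carrier V" "t \<in> carrier V"
  then obtain w x w' x' where st: "s = (w, x)" "t = (w', x')" "0 \<le> w" "0 \<le> x" "0 \<le> w'" "0 \<le> x'"
    using p0 by (cases s; cases t) (auto simp: carrier_integer_mod_group)
  then show "[ch e d (s \<otimes>\<^bsub>V\<^esub> t) = ch e d s + ch e d t] (mod p)"
    using ch_mod[of "w + w'" "x + x'" e d] by (simp add: ch_def nat_add_distrib algebra_simps)
qed

lemma character_V_eq:
  assumes g: "elementary.character g" and s: "s \<in> carrier V"
  shows "[g s = ch (g (1, 0)) (g (0, 1)) s] (mod p)"
proof -
  obtain w x where s_eq: "s = (w, x)" "0 \<le> w" "w < int p" "0 \<le> x" "x < int p"
    using s p0 by (cases s) (auto simp: carrier_integer_mod_group)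
  have V: "(1, 0) \<in> carrier V" "(0, 1) \<in> carrier V"
    using p_gt_2 by (simp_all add: carrier_integer_mod_group)
  have "s = (1, 0) [^]\<^bsub>V\<^esub> nat w \<otimes>\<^bsub>V\<^esub> (0, 1) [^]\<^bsub>V\<^esub> nat x"
    using s_eq by (simp only: pow_V mult_V) simp
  then have "[g s = g ((1, 0) [^]\<^bsub>V\<^esub> nat w) + g ((0, 1) [^]\<^bsub>V\<^esub> nat x)] (mod p)"
    using g V unfolding elementary.character_def by (metis elementary.nat_pow_closed)
  also have "[g ((1, 0) [^]\<^bsub>V\<^esub> nat w) + g ((0, 1) [^]\<^bsub>V\<^esub> nat x) = nat w * g (1, 0) + nat x * g (0, 1)] (mod p)"
    by (intro cong_add elementary.character_pow[OF g] V)
  finally show ?thesis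
    by (simp add: ch_def s_eq mult.commute)
qed

text \<open>The exponent separates the two families: p q kills every element on the elementary side,
  whereas for a generator of Z_{p^2} this would need p^2 to divide p q.\<close>

lemma cyclic_not_iso_elementary:
  assumes g: "cyclic.character g" and g': "elementary.character g'"
  shows "\<not> cyclic.semidirect g \<cong> elementary.semidirect g'"
proof
  assume iso: "cyclic.semidirect g \<cong> elementary.semidirect g'"
  have pow: "s [^]\<^bsub>V\<^esub> p = \<one>\<^bsub>V\<^esub>" if "s \<in> carrier V" for s
    by (cases s) (simp only: pow_V, simp)
  have "(0, 1) \<in> carrier (cyclic.semidirect g)"
    using prime_gt_0_nat[OF prime_q] p_gt_2 by (simp add: cyclic.semidirect_def carrier_C)
  moreover have "y [^]\<^bsub>elementary.semidirect g'\<^esub> (p * q) = \<one>\<^bsub>elementary.semidirect g'\<^esub>"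
    if "y \<in> carrier (elementary.semidirect g')" for y
    using elementary.semidirect_exponent[OF g' pow that] by simp
  ultimately have "(0, 1) [^]\<^bsub>cyclic.semidirect g\<^esub> (p * q) = \<one>\<^bsub>cyclic.semidirect g\<^esub>"
    using iso_pow_eq_one[OF cyclic.group_semidirect[OF g] elementary.group_semidirect[OF g'] iso] by blast
  moreover obtain b where "(0, 1) [^]\<^bsub>cyclic.semidirect g\<^esub> (p * q) = (b, 1 [^]\<^bsub>C\<^esub> (p * q))"
    using cyclic.semidirect_pow by blast
  ultimately have "int (p * q) mod int (p\<^sup>2) = 0"
    by (simp add: cyclic.semidirect_def)
  then have "p\<^sup>2 dvd p * q"
    by (simp only: mod_eq_0_iff_dvd int_dvd_int_iff)
  then have "p dvd q"
    using p0 by (simp add: power2_eq_square)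
  then show False
    using primes_dvd_imp_eq[OF prime_p prime_q] cyclic.p_less_q by blast
qed

lemma cyclic_nontrivial_iso:
  assumes d: "d \<in> {1..<p}"
  shows "cyclic.semidirect (\<lambda>x. d * nat x) \<cong> cyclic.semidirect nat"
proof (rule cyclic.semidirect_iso_semidirect[OF iso_C])
  show "\<not> p dvd d"
    using d by (auto dest: dvd_imp_le)
  fix s assume "s \<in> carrier C"
  then show "[nat (int d * s mod int (p\<^sup>2)) = d * nat s] (mod p)"
    using cong_nat_mod[of "int d * s" "p\<^sup>2"] p0 by (simp add: carrier_C nat_mult_distrib)
qed

text \<open>A nonzero linear form is the second row of an invertible matrix, which carries it to the
  second coordinate. The first row is chosen according to whether e vanishes.\<close>

lemma elementary_nontrivial_iso:
  assumes ed: "e < p" "d < p" "(e, d) \<noteq> (0, 0)"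
  shows "elementary.semidirect (ch e d) \<cong> elementary.semidirect h_V"
proof (cases "e = 0")
  case True
  then have d: "\<not> int p dvd 1 * int d - 0 * 0"
    using ed by (auto dest: dvd_imp_le)
  show ?thesis
  proof (rule elementary.semidirect_iso_semidirect[OF iso_V[OF d]])
    fix s assume "s \<in> carrier V"
    then obtain w x where s: "s = (w, x)" "0 \<le> w" "0 \<le> x"
      using p0 by (cases s) (auto simp: carrier_integer_mod_group)
    then show "[h_V (case s of (w, x) \<Rightarrow> ((1 * w + 0 * x) mod int p, (0 * w + int d * x) mod int p)) = ch e d s] (mod p)"
      using True cong_nat_mod[of "int d * x" p] p0 by (simp add: ch_def nat_mult_distrib)
  qed
next
  case False
  then have e: "\<not> int p dvd 0 * int d - 1 * int e"
    using ed by (auto dest: dvd_imp_le)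
  show ?thesis
  proof (rule elementary.semidirect_iso_semidirect[OF iso_V[OF e]])
    fix s assume "s \<in> carrier V"
    then obtain w x where s: "s = (w, x)" "0 \<le> w" "0 \<le> x"
      using p0 by (cases s) (auto simp: carrier_integer_mod_group)
    then show "[h_V (case s of (w, x) \<Rightarrow> ((0 * w + 1 * x) mod int p, (int e * w + int d * x) mod int p)) = ch e d s] (mod p)"
      using cong_nat_mod[of "int e * w + int d * x" p] p0
      by (simp add: ch_def nat_mult_distrib nat_add_distrib)
  qed
qed

text \<open>One statement serves all multiplicative types: \<open>Y\<close> enters only through the
  set \<open>D\<close> of characters that produce it, while c runs freely over p values.\<close>

lemma num_skew_braces_cyclic:
  assumes D: "\<And>d. d < p \<Longrightarrow> cyclic.semidirect (\<lambda>x. d * nat x) \<cong> Y \<longleftrightarrow> d \<in> D" and "D \<subseteq> {..<p}"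
  shows "num_skew_braces (cyclic_semidirect q (p\<^sup>2) r) Y = 2 * (p * card D)"
proof -
  have one: "1 \<in> carrier C"
    using p_gt_2 by (simp add: carrier_C)
  have "num_skew_braces (cyclic_semidirect q (p\<^sup>2) r) Y = 2 * card ({..<p} \<times> D)"
  proof (rule cyclic.num_skew_braces_models[where c = fst and g = "\<lambda>(c, d) x. d * nat x"])
    show "cyclic.semidirect nat \<cong> cyclic_semidirect q (p\<^sup>2) r"
      by (simp only: cyclic_semidirect_eq iso_refl)
    show "cyclic.character (case i of (c, d) \<Rightarrow> \<lambda>x. d * nat x)" for i :: "nat \<times> nat"
      by (cases i) (simp add: character_C)
    show "cyclic.semidirect (case i of (c, d) \<Rightarrow> \<lambda>x. d * nat x) \<cong> Y" if "i \<in> {..<p} \<times> D" for i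
      using that D assms(2) by auto
    fix i j assume ij: "i \<in> {..<p} \<times> D" "j \<in> {..<p} \<times> D"
      and iso: "skew_brace_iso (cyclic.model (fst i) (case i of (c, d) \<Rightarrow> \<lambda>x. d * nat x))
        (cyclic.model (fst j) (case j of (c, d) \<Rightarrow> \<lambda>x. d * nat x)) \<noteq> {}"
    obtain c d c' d' where cd: "i = (c, d)" "j = (c', d')"
      by (cases i; cases j)
    have "skew_brace_iso (cyclic.model c (\<lambda>x. d * nat x)) (cyclic.model c' (\<lambda>x. d' * nat x)) \<noteq> {}"
      using iso by (simp add: cd)
    then obtain f where f: "f \<in> iso C C" "\<And>s. s \<in> carrier C \<Longrightarrow> [nat (f s) = nat s] (mod p)"
      "\<And>s. s \<in> carrier C \<Longrightarrow> [d' * nat (f s) = d * nat s] (mod p)"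
      "f (int p) [^]\<^bsub>C\<^esub> c = int p [^]\<^bsub>C\<^esub> c'"
      by (rule cyclic.model_iso_modelD[OF character_C character_C]) blast
    have f1: "f 1 \<in> carrier C" "[nat (f 1) = 1] (mod p)"
      using f(1) f(2)[OF one] one by (auto simp: iso_def hom_def)
    have "[d' * 1 = d' * nat (f 1)] (mod p)"
      using f1(2) by (intro cong_mult) (auto simp: cong_sym_eq)
    then have "[d' = d] (mod p)"
      using f(3)[OF one] by (simp add: cong_def)
    moreover have "d < p" "d' < p"
      using ij assms(2) by (auto simp: cd)
    ultimately have "d' = d"
      by (simp add: cong_def)
    \<comment> \<open>\<open>f\<close> is determined by \<open>f 1\<close>, which is 1 modulo p.
      Multiplying by p lifts this to a congruence modulo p^2, so \<open>f\<close> fixes z and the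
      value of c can be read off.\<close>
    have "int p = 1 [^]\<^bsub>C\<^esub> p"
      using p_gt_2 by (simp add: power2_eq_square)
    then have "f (int p) = f 1 [^]\<^bsub>C\<^esub> p"
      using hom_nat_pow[of f C C 1 p] f(1) one by (simp add: iso_def)
    also have "\<dots> = int p"
    proof -
      have "[int (nat (f 1)) = int 1] (mod int p)"
        using f1(2) by (simp only: cong_int_iff)
      then have "[f 1 = 1] (mod int p)"
        using f1(1) by (simp add: carrier_C)
      then have "int p * int p dvd int p * (f 1 - 1)"
        by (simp add: cong_iff_dvd_diff)
      then have "[int p * f 1 = int p * 1] (mod int (p\<^sup>2))"
        by (simp add: cong_iff_dvd_diff power2_eq_square right_diff_distrib)
      also have "int p * 1 < int (p\<^sup>2)"
        using p_gt_2 by (simp add: power2_eq_square)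
      ultimately show ?thesis
        by (simp add: cong_def)
    qed
    finally have "[c = c'] (mod p)"
      using f(4) by (simp only: cyclic.z_pow_cong_iff)
    then have "c = c'"
      using ij by (simp add: cd cong_def)
    then show "i = j"
      using \<open>d' = d\<close> by (simp add: cd)
  next
    fix c k assume k: "cyclic.character k" "cyclic.semidirect k \<cong> Y"
    define d where "d = k 1 mod p"
    have eq: "[k s = d * nat s] (mod p)" if "s \<in> carrier C" for s
      using character_C_eq[OF k(1) that] by (simp add: d_def)
    have "cyclic.semidirect (\<lambda>x. d * nat x) \<cong> Y"
      using cyclic.semidirect_cong[of k "\<lambda>x. d * nat x"] eq k(2) iso_trans by blast
    then have "d \<in> D"
      using D p0 by (simp add: d_def)
    moreover have "skew_brace_iso (cyclic.model c k) (cyclic.model (c mod p) (\<lambda>x. d * nat x)) \<noteq> {}"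
    proof (rule cyclic.model_iso_model[where f = id])
      show "id \<in> iso C C"
        by (simp add: iso_set_refl id_def)
      show "id (int p) [^]\<^bsub>C\<^esub> c = int p [^]\<^bsub>C\<^esub> (c mod p)"
        unfolding id_apply by (rule cyclic.z_pow_cong) (simp add: cong_def)
    qed (use eq in \<open>auto intro: cong_sym\<close>)
    ultimately show "\<exists>i\<in>{..<p} \<times> D. skew_brace_iso (cyclic.model c k)
        (cyclic.model (fst i) (case i of (c, d) \<Rightarrow> \<lambda>x. d * nat x)) \<noteq> {}"
      using p0 by (intro bexI[of _ "(c mod p, d)"]) simp_all
  qed
  then show ?thesis
    by (simp add: card_cartesian_product)
qed

text \<open>
  Representatives \<open>(c, e, d)\<close> of the orbits of the automorphisms \<open>(w, x) \<mapsto> (\<alpha> w + \<beta> x, x)\<close> of \<open>\<int>\<^sub>p\<^sup>2\<close> on the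
  parameters of the models: \<open>c\<close> is the structure constant of the multiplicative group on \<open>\<int>\<^sub>p\<^sup>2\<close> and
  \<open>ch e d\<close> its character.
\<close>

definition reps :: "(nat \<times> nat \<times> nat) set" where
  "reps = (\<lambda>d. (0, 0, d)) ` {..<p} \<union> {(0, 1, 0)} \<union> (\<lambda>d. (1, 0, d)) ` {..<p} \<union> (\<lambda>e. (1, e, 0)) ` {1..<p}"

abbreviation elementary_model :: "nat \<times> nat \<times> nat \<Rightarrow> (int \<times> int \<times> int) ring" where
  "elementary_model \<equiv> \<lambda>(c, e, d). elementary.model c (ch e d)"

text \<open>Under \<open>(w, x) \<mapsto> (\<alpha> w + \<beta> x, x)\<close> the form
  \<open>ch e d\<close> pulls back to \<open>ch (e * \<alpha>) (e * \<beta> + d)\<close>, and z is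
  replaced by its power with exponent \<alpha>; the three congruences express exactly this.\<close>

lemma elementary_model_iso:
  assumes g: "elementary.character g" and \<alpha>: "\<not> p dvd \<alpha>" "[c * \<alpha> = c'] (mod p)"
    and ed: "[e * \<alpha> = g (1, 0)] (mod p)" "[e * \<beta> + d = g (0, 1)] (mod p)"
  shows "skew_brace_iso (elementary.model c g) (elementary.model c' (ch e d)) \<noteq> {}"
proof -
  have det: "\<not> int p dvd int \<alpha> * 1 - int \<beta> * 0"
    using \<alpha>(1) by simp
  show ?thesis
  proof (rule elementary.model_iso_model[OF iso_V[OF det]])
    fix s assume sV: "s \<in> carrier V"
    then obtain w x where s: "s = (w, x)" "0 \<le> w" "0 \<le> x" "x < int p"
      using p0 by (cases s) (auto simp: carrier_integer_mod_group)
    show "[h_V (case s of (w, x) \<Rightarrow> ((int \<alpha> * w + int \<beta> * x) mod int p, (0 * w + 1 * x) mod int p)) = h_V s] (mod p)"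
      using s by simp
    have "[ch e d ((int \<alpha> * w + int \<beta> * x) mod int p, x mod int p) =
        e * nat (int \<alpha> * w + int \<beta> * x) + d * nat x] (mod p)"
      using s by (intro ch_mod) auto
    also have "e * nat (int \<alpha> * w + int \<beta> * x) + d * nat x = (e * \<alpha>) * nat w + (e * \<beta> + d) * nat x"
      using s by (simp add: nat_mult_distrib nat_add_distrib algebra_simps)
    also have "[(e * \<alpha>) * nat w + (e * \<beta> + d) * nat x = g (1, 0) * nat w + g (0, 1) * nat x] (mod p)"
      by (intro cong_add cong_mult ed) auto
    also have "g (1, 0) * nat w + g (0, 1) * nat x = ch (g (1, 0)) (g (0, 1)) s"
      by (simp add: ch_def s)
    also have "[ch (g (1, 0)) (g (0, 1)) s = g s] (mod p)"
      using character_V_eq[OF g sV] by (rule cong_sym)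
    finally show "[ch e d (case s of (w, x) \<Rightarrow> ((int \<alpha> * w + int \<beta> * x) mod int p, (0 * w + 1 * x) mod int p)) = g s] (mod p)"
      by (simp add: s)
  next
    have "[int c * int \<alpha> = int c'] (mod int p)"
      using \<alpha>(2) by (simp flip: cong_int_iff)
    then have "(int c * (int \<alpha> mod int p)) mod int p = int c' mod int p"
      by (simp add: cong_def mod_simps)
    then show "(case (1, 0) of (w, x) \<Rightarrow> ((int \<alpha> * w + int \<beta> * x) mod int p, (0 * w + 1 * x) mod int p))
        [^]\<^bsub>V\<^esub> c = (1, 0) [^]\<^bsub>V\<^esub> c'"
      by (simp add: pow_V)
  qed
qed

lemma inverse_mod_p:
  assumes "\<not> p dvd a"
  obtains b where "[a * b = 1] (mod p)" "\<not> p dvd b"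
proof -
  have "coprime a p"
    using prime_imp_coprime[OF prime_p assms] by (simp add: coprime_commute)
  then obtain b where b: "[a * b = 1] (mod p)"
    using cong_solve_coprime_nat unfolding One_nat_def by blast
  moreover have "\<not> p dvd b"
  proof
    assume "p dvd b"
    then have "[a * b = 0] (mod p)"
      by (simp add: cong_0_iff)
    then have "[1 = 0::nat] (mod p)"
      using b by (metis cong_sym cong_trans)
    then show False
      using p_gt_2 by (simp add: cong_def)
  qed
  ultimately show thesis
    by (rule that)
qed

text \<open>Scaling by \<alpha> normalizes c to 0 or 1, and if e is nonzero the shear \<beta> clears
  d. For c = 0 the scaling is still free to turn e into 1; for c nonzero it is used up and e
  survives as a parameter.\<close>

lemma elementary_reps_complete:
  assumes g: "elementary.character g"
  shows "\<exists>i\<in>reps. skew_brace_iso (elementary.model c g) (elementary_model i) \<noteq> {}"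
proof -
  define e d where "e = g (1, 0)" and "d = g (0, 1)"
  note iso = elementary_model_iso[OF g, folded e_def d_def]
  have one: "\<not> p dvd 1"
    using p_gt_2 by auto
  have mod: "[m mod p = m] (mod p)" "m mod p < p" for m
    using p0 by (simp_all add: cong_def)
  show ?thesis
  proof (cases "p dvd c")
    case c: True
    show ?thesis
    proof (cases "p dvd e")
      case True
      have "skew_brace_iso (elementary.model c g) (elementary.model 0 (ch 0 (d mod p))) \<noteq> {}"
        using c True mod by (intro iso[where \<alpha> = 1 and \<beta> = 0] one) (auto simp: cong_def)
      moreover have "(0, 0, d mod p) \<in> reps"
        using mod by (auto simp: reps_def)
      ultimately show ?thesis
        by (intro bexI[of _ "(0, 0, d mod p)"]) simp_all
    next
      case False
      have "skew_brace_iso (elementary.model c g) (elementary.model 0 (ch 1 0)) \<noteq> {}"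
        using c False by (intro iso[where \<alpha> = e and \<beta> = d]) (auto simp: cong_0_iff)
      then show ?thesis
        by (intro bexI[of _ "(0, 1, 0)"]) (simp_all add: reps_def)
    qed
  next
    case c: False
    obtain \<alpha> where \<alpha>: "[c * \<alpha> = 1] (mod p)" "\<not> p dvd \<alpha>"
      using inverse_mod_p[OF c] by blast
    show ?thesis
    proof (cases "p dvd e")
      case True
      have "skew_brace_iso (elementary.model c g) (elementary.model 1 (ch 0 (d mod p))) \<noteq> {}"
        using \<alpha> True mod by (intro iso[where \<alpha> = \<alpha> and \<beta> = 0]) (auto simp: cong_def)
      moreover have "(1, 0, d mod p) \<in> reps"
        using mod by (auto simp: reps_def)
      ultimately show ?thesis
        by (intro bexI[of _ "(1, 0, d mod p)"]) simp_all
    next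
      case False
      \<comment> \<open>With \<open>c * \<alpha> = 1\<close> fixed, the required
        \<open>e' * \<alpha> = e\<close> forces e' to be e c modulo p.\<close>
      define e' where "e' = e * c mod p"
      have e'_cong: "[e' = e * c] (mod p)"
        by (simp add: e'_def mod)
      have e'_ndvd: "\<not> p dvd e'"
        using False c prime_p by (simp add: e'_def dvd_mod_iff prime_dvd_mult_iff)
      obtain y where y: "[e' * y = 1] (mod p)"
        using inverse_mod_p[OF e'_ndvd] by blast
      have "[e' * \<alpha> = e * c * \<alpha>] (mod p)"
        by (intro cong_mult e'_cong) auto
      also have "e * c * \<alpha> = e * (c * \<alpha>)"
        by simp
      also have "[\<dots> = e * 1] (mod p)"
        by (intro cong_mult \<alpha>) auto
      finally have 1: "[e' * \<alpha> = e] (mod p)"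
        by simp
      have "[e' * y * d = 1 * d] (mod p)"
        by (intro cong_mult y) auto
      then have 2: "[e' * (y * d) + 0 = d] (mod p)"
        by (simp add: mult.assoc)
      have "skew_brace_iso (elementary.model c g) (elementary.model 1 (ch e' 0)) \<noteq> {}"
        by (rule iso[OF \<alpha>(2,1) 1 2])
      moreover have "e' \<in> {1..<p}"
        using e'_ndvd p0 by (cases "e' = 0") (auto simp: e'_def)
      then have "(1, e', 0) \<in> reps"
        by (auto simp: reps_def)
      ultimately show ?thesis
        by (intro bexI[of _ "(1, e', 0)"]) simp_all
    qed
  qed
qed

text \<open>Preserving \<open>h\<close> forces f to be
  \<open>(w, x) \<mapsto> (\<alpha> w + \<beta> x, x)\<close> with \<alpha> invertible. So the
  vanishing of c and of e is invariant; if e = 0 then d is invariant, and if c = 1 then \<alpha> = 1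
  modulo p and e is invariant.\<close>

lemma elementary_reps_distinct:
  assumes i: "i \<in> reps" and j: "j \<in> reps"
    and iso: "skew_brace_iso (elementary_model i) (elementary_model j) \<noteq> {}"
  shows "i = j"
proof -
  obtain c e d c' e' d' where ij: "i = (c, e, d)" "j = (c', e', d')"
    by (cases i; cases j)
  have V: "(1, 0) \<in> carrier V" "(0, 1) \<in> carrier V"
    using p_gt_2 by (simp_all add: carrier_integer_mod_group)
  have "skew_brace_iso (elementary.model c (ch e d)) (elementary.model c' (ch e' d')) \<noteq> {}"
    using iso by (simp add: ij)
  then obtain f where f: "f \<in> iso V V" "\<And>s. s \<in> carrier V \<Longrightarrow> [h_V (f s) = h_V s] (mod p)"
    "\<And>s. s \<in> carrier V \<Longrightarrow> [ch e' d' (f s) = ch e d s] (mod p)"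
    "f (1, 0) [^]\<^bsub>V\<^esub> c = (1, 0) [^]\<^bsub>V\<^esub> c'"
    by (rule elementary.model_iso_modelD[OF character_V character_V]) blast
  have closed: "f s \<in> carrier V" if "s \<in> carrier V" for s
    using f(1) that by (auto simp: iso_def hom_def)
  have small: "m = n" if "[m = n] (mod p)" "m < p" "n < p" for m n
    using that by (simp add: cong_def)
  obtain w x where wx: "f (1, 0) = (w, x)" "0 \<le> w" "w < int p" "0 \<le> x" "x < int p"
    using closed[OF V(1)] p0 by (cases "f (1, 0)") (auto simp: carrier_integer_mod_group)
  have x: "x = 0"
    using f(2)[OF V(1)] wx small[of "nat x" 0] by (simp add: nat_less_iff)
  define \<alpha> where "\<alpha> = nat w"
  have f_z: "f (1, 0) = (int \<alpha>, 0)"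
    using wx x by (simp add: \<alpha>_def)
  obtain w' x' where wx': "f (0, 1) = (w', x')" "0 \<le> w'" "w' < int p" "0 \<le> x'" "x' < int p"
    using closed[OF V(2)] p0 by (cases "f (0, 1)") (auto simp: carrier_integer_mod_group)
  have x': "x' = 1"
    using f(2)[OF V(2)] wx' small[of "nat x'" 1] p_gt_2 by (simp add: nat_less_iff)
  define \<beta> where "\<beta> = nat w'"
  have f_e: "f (0, 1) = (int \<beta>, 1)"
    using wx' x' by (simp add: \<beta>_def)
  have c_eq: "[c * \<alpha> = c'] (mod p)"
    using f(4) by (simp add: f_z pow_V cong_def flip: of_nat_mult of_nat_mod)
  have e_eq: "[e' * \<alpha> = e] (mod p)"
    using f(3)[OF V(1)] by (simp add: f_z ch_def)
  have d_eq: "[e' * \<beta> + d' = d] (mod p)"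
    using f(3)[OF V(2)] by (simp add: f_e ch_def)
  have \<alpha>: "\<not> p dvd \<alpha>"
  proof
    assume "p dvd \<alpha>"
    then have "\<alpha> = 0"
      using wx by (auto simp: \<alpha>_def dest!: dvd_imp_le)
    have "f (0, 0) = f ((0, 0) \<otimes>\<^bsub>V\<^esub> (0, 0))"
      by simp
    also have "\<dots> = f (0, 0) \<otimes>\<^bsub>V\<^esub> f (0, 0)"
      using f(1) p0 by (intro hom_mult[of f V V]) (auto simp: iso_def)
    finally have "f (0, 0) = \<one>\<^bsub>V\<^esub>"
      using closed[of "(0, 0)"] p0 by (metis elementary.l_cancel_one' elementary.one_closed one_DirProd one_integer_mod_group)
    then have "f (1, 0) = f (0, 0)"
      using f_z \<open>\<alpha> = 0\<close> by simp
    moreover have "inj_on f (carrier V)" "(0, 0) \<in> carrier V"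
      using f(1) p0 by (simp_all add: iso_def bij_betw_def carrier_integer_mod_group)
    ultimately have "(1 :: int, 0 :: int) = (0, 0)"
      using inj_onD[of f "carrier V" "(1, 0)" "(0, 0)"] V(1) by blast
    then show False
      by simp
  qed
  have lt: "c < p" "e < p" "d < p" "c' < p" "e' < p" "d' < p"
    using i j p_gt_2 by (auto simp: ij reps_def)
  have zero: "m = 0" if "[m = 0] (mod p)" "m < p" for m
    using small[OF that(1,2)] p0 by simp
  have "c' = 0" if "c = 0"
    using c_eq that lt zero by (simp add: cong_sym_eq)
  moreover have "c = 0" if "c' = 0"
    using c_eq that lt zero[of c] \<alpha> prime_p by (simp add: cong_0_iff prime_dvd_mult_iff)
  ultimately have c: "c = c'"
    using i j by (auto simp: ij reps_def)
  have e0: "e' = 0" if "e = 0"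
    using e_eq that lt zero[of e'] \<alpha> prime_p by (simp add: cong_0_iff prime_dvd_mult_iff)
  have e0': "e = 0" if "e' = 0"
    using e_eq that lt zero[of e] by (simp add: cong_sym_eq)
  show ?thesis
  proof (cases "e = 0")
    case True
    then have "d' = d"
      using e0 d_eq lt small by simp
    then show ?thesis
      using c True e0 by (simp add: ij)
  next
    case False
    then have "e' \<noteq> 0"
      using e0' by blast
    then have d: "d = 0" "d' = 0" and c0: "c = 0 \<Longrightarrow> e = 1 \<and> e' = 1" and c1: "c \<noteq> 0 \<Longrightarrow> c' = 1"
      using False i j c by (auto simp: ij reps_def)
    have "e = e'"
    proof (cases "c = 0")
      case False
      then have "[e' * \<alpha> = e' * 1] (mod p)"
        using c_eq c1 c by (intro cong_mult) simp_all
      then have "[e' = e] (mod p)"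
        using e_eq by (metis cong_sym cong_trans mult_1_right)
      then show ?thesis
        using small[of e' e] lt by simp
    qed (simp add: c0)
    then show ?thesis
      by (simp add: ij c d)
  qed
qed

text \<open>As in the cyclic case, \<open>Y\<close> enters only through a condition \<open>P\<close>
  on the character, so each count becomes a count of representatives.\<close>

lemma num_skew_braces_elementary:
  assumes D: "\<And>e d. e < p \<Longrightarrow> d < p \<Longrightarrow> elementary.semidirect (ch e d) \<cong> Y \<longleftrightarrow> P e d"
  shows "num_skew_braces (integer_mod_group p \<times>\<times> cyclic_semidirect q p r) Y =
    2 * card {(c, e, d) \<in> reps. P e d}"
proof (rule elementary.num_skew_braces_models[where c = fst and g = "\<lambda>(c, e, d). ch e d"])
  show "elementary.semidirect h_V \<cong> integer_mod_group p \<times>\<times> cyclic_semidirect q p r"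
    by (rule elementary_semidirect_iso)
  show "elementary.character (case i of (c, e, d) \<Rightarrow> ch e d)" for i :: "nat \<times> nat \<times> nat"
    by (cases i) (simp add: character_V)
  have lt: "e < p \<and> d < p" if "(c, e, d) \<in> reps" for c e d
    using that p_gt_2 by (auto simp: reps_def)
  show "elementary.semidirect (case i of (c, e, d) \<Rightarrow> ch e d) \<cong> Y"
    if "i \<in> {(c, e, d) \<in> reps. P e d}" for i
    using that lt D by auto
  fix i j assume "i \<in> {(c, e, d) \<in> reps. P e d}" "j \<in> {(c, e, d) \<in> reps. P e d}"
    "skew_brace_iso (elementary.model (fst i) (case i of (c, e, d) \<Rightarrow> ch e d))
      (elementary.model (fst j) (case j of (c, e, d) \<Rightarrow> ch e d)) \<noteq> {}"
  then show "i = j"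
    using elementary_reps_distinct[of i j] by (cases i; cases j) simp
next
  fix c k assume k: "elementary.character k" "elementary.semidirect k \<cong> Y"
  obtain i where i: "i \<in> reps" "skew_brace_iso (elementary.model c k) (elementary_model i) \<noteq> {}"
    using elementary_reps_complete[OF k(1)] by blast
  obtain c' e d where ced: "i = (c', e, d)"
    by (cases i)
  have iso: "skew_brace_iso (elementary.model c k) (elementary.model c' (ch e d)) \<noteq> {}"
    using i(2) by (simp add: ced)
  have "elementary.semidirect (ch e d) \<cong> elementary.model c' (ch e d)"
    by (rule is_isoI[OF elementary.semidirect_iso_model])
  also have "elementary.model c' (ch e d) \<cong> elementary.model c k"
    by (rule skew_brace_iso_imp_iso[OF skew_brace_iso_sym[OF elementary.skew_brace_model[OF k(1)] iso]])
  also have "elementary.model c k \<cong> elementary.semidirect k"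
    by (rule elementary.model_iso_semidirect[OF k(1)])
  also note k(2)
  finally have "P e d"
    using D i(1) p_gt_2 by (auto simp: ced reps_def)
  then show "\<exists>i\<in>{(c, e, d) \<in> reps. P e d}. skew_brace_iso (elementary.model c k)
      (elementary.model (fst i) (case i of (c, e, d) \<Rightarrow> ch e d)) \<noteq> {}"
    using i(1) iso by (intro bexI[of _ i]) (simp_all add: ced)
qed

section \<open>Which characters give which multiplicative group\<close>

abbreviation "Zp2q \<equiv> integer_mod_group (p\<^sup>2 * q)"
abbreviation "ZpZpZq \<equiv> (integer_mod_group p \<times>\<times> integer_mod_group p) \<times>\<times> integer_mod_group q"
abbreviation "ZqZp2 \<equiv> cyclic_semidirect q (p\<^sup>2) r"
abbreviation "ZpZqZp \<equiv> integer_mod_group p \<times>\<times> cyclic_semidirect q p r"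

lemma comm_group_ZpZpZq: "comm_group ZpZpZq"
proof (rule group.group_comm_groupI)
  show "group ZpZpZq"
    by (simp add: DirProd_group)
qed (auto simp: add.commute)

lemma cyclic_iso_Zp2q_iff:
  assumes d: "d < p"
  shows "cyclic.semidirect (\<lambda>x. d * nat x) \<cong> Zp2q \<longleftrightarrow> d \<in> {0}"
proof
  have one: "1 \<in> carrier C"
    using p_gt_2 by (simp add: carrier_C)
  assume "cyclic.semidirect (\<lambda>x. d * nat x) \<cong> Zp2q"
  then have "[d * nat 1 = 0] (mod p)"
    by (rule cyclic.semidirect_comm_imp_trivial[OF character_C _ abelian_integer_mod_group one])
  then show "d \<in> {0}"
    using d by (simp add: cong_def)
next
  assume "d \<in> {0}"
  then show "cyclic.semidirect (\<lambda>x. d * nat x) \<cong> Zp2q"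
    using cyclic_trivial_iso by simp
qed

lemma cyclic_iso_ZqZp2_iff:
  assumes d: "d < p"
  shows "cyclic.semidirect (\<lambda>x. d * nat x) \<cong> ZqZp2 \<longleftrightarrow> d \<in> {1..<p}"
proof
  assume iso: "cyclic.semidirect (\<lambda>x. d * nat x) \<cong> ZqZp2"
  have "d \<noteq> 0"
  proof
    assume "d = 0"
    then have "cyclic.semidirect (\<lambda>_. 0) \<cong> cyclic.semidirect nat"
      using iso by (simp add: cyclic_semidirect_eq)
    moreover have "group (cyclic.semidirect (\<lambda>_. 0))"
      using cyclic.group_semidirect[OF character_C[of 0]] by simp
    ultimately have "cyclic.semidirect nat \<cong> cyclic.semidirect (\<lambda>_. 0)"
      using group.iso_sym by blast
    then have "cyclic.semidirect (\<lambda>x. 1 * nat x) \<cong> Zp2q"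
      using iso_trans[OF _ cyclic_trivial_iso] by simp
    then show False
      using cyclic_iso_Zp2q_iff[of 1] p_gt_2 by simp
  qed
  then show "d \<in> {1..<p}"
    using d by simp
next
  assume "d \<in> {1..<p}"
  then show "cyclic.semidirect (\<lambda>x. d * nat x) \<cong> ZqZp2"
    using cyclic_nontrivial_iso by (simp add: cyclic_semidirect_eq)
qed

lemma elementary_iso_ZpZpZq_iff:
  assumes "e < p" "d < p"
  shows "elementary.semidirect (ch e d) \<cong> ZpZpZq \<longleftrightarrow> e = 0 \<and> d = 0"
proof
  have V: "(1, 0) \<in> carrier V" "(0, 1) \<in> carrier V"
    using p_gt_2 by (simp_all add: carrier_integer_mod_group)
  assume "elementary.semidirect (ch e d) \<cong> ZpZpZq"
  note elementary.semidirect_comm_imp_trivial[OF character_V this comm_group_ZpZpZq]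
  from this[OF V(1)] this[OF V(2)] show "e = 0 \<and> d = 0"
    using assms by (simp add: ch_def cong_def)
next
  assume "e = 0 \<and> d = 0"
  then show "elementary.semidirect (ch e d) \<cong> ZpZpZq"
    using elementary_trivial_iso by simp
qed

lemma elementary_iso_ZpZqZp_iff:
  assumes "e < p" "d < p"
  shows "elementary.semidirect (ch e d) \<cong> ZpZqZp \<longleftrightarrow> \<not> (e = 0 \<and> d = 0)"
proof
  assume iso: "elementary.semidirect (ch e d) \<cong> ZpZqZp"
  show "\<not> (e = 0 \<and> d = 0)"
  proof
    assume "e = 0 \<and> d = 0"
    then have "elementary.semidirect (ch e d) \<cong> ZpZpZq"
      using elementary_trivial_iso by simp
    moreover have "ZpZqZp \<cong> elementary.semidirect (ch e d)"
      using group.iso_sym[OF elementary.group_semidirect[OF character_V] iso] .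
    ultimately have "elementary.semidirect h_V \<cong> ZpZpZq"
      using elementary_semidirect_iso iso_trans by blast
    then have "[h_V (0, 1) = 0] (mod p)"
      using p_gt_2
      by (intro elementary.semidirect_comm_imp_trivial[OF elementary.character_h _ comm_group_ZpZpZq])
         (simp_all add: carrier_integer_mod_group)
    then show False
      using p_gt_2 by (simp add: cong_def)
  qed
next
  assume "\<not> (e = 0 \<and> d = 0)"
  then have "elementary.semidirect (ch e d) \<cong> elementary.semidirect h_V"
    using assms by (intro elementary_nontrivial_iso) auto
  then show "elementary.semidirect (ch e d) \<cong> ZpZqZp"
    using elementary_semidirect_iso by (rule iso_trans)
qed

lemma cyclic_not_iso:
  assumes "cyclic.character g"
  shows "\<not> cyclic.semidirect g \<cong> ZpZpZq" "\<not> cyclic.semidirect g \<cong> ZpZqZp"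
proof -
  have "ZpZpZq \<cong> elementary.semidirect (ch 0 0)" "ZpZqZp \<cong> elementary.semidirect h_V"
    using group.iso_sym[OF elementary.group_semidirect[OF character_V] elementary_trivial_iso]
      group.iso_sym[OF elementary.group_semidirect[OF elementary.character_h] elementary_semidirect_iso] .
  then show "\<not> cyclic.semidirect g \<cong> ZpZpZq" "\<not> cyclic.semidirect g \<cong> ZpZqZp"
    using cyclic_not_iso_elementary[OF assms character_V] cyclic_not_iso_elementary[OF assms elementary.character_h]
      iso_trans by blast+
qed

lemma elementary_not_iso:
  assumes g: "elementary.character g"
  shows "\<not> elementary.semidirect g \<cong> Zp2q" "\<not> elementary.semidirect g \<cong> ZqZp2"
proof -
  note sym = group.iso_sym[OF elementary.group_semidirect[OF g]]
  have "cyclic.character (\<lambda>_. 0)"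
    using character_C[of 0] by simp
  then show "\<not> elementary.semidirect g \<cong> Zp2q"
    using cyclic_not_iso_elementary[OF _ g] iso_trans[OF cyclic_trivial_iso sym] by blast
  show "\<not> elementary.semidirect g \<cong> ZqZp2"
    using cyclic_not_iso_elementary[OF cyclic.character_h g] sym by (auto simp: cyclic_semidirect_eq)
qed

lemma card_reps_trivial: "card {(c, e, d) \<in> reps. e = 0 \<and> d = 0} = 2"
proof -
  have "{(c, e, d) \<in> reps. e = 0 \<and> d = 0} = {(0, 0, 0), (1, 0, 0)}"
    using p0 by (auto simp: reps_def)
  then show ?thesis
    by simp
qed

lemma card_reps_nontrivial: "card {(c, e, d) \<in> reps. \<not> (e = 0 \<and> d = 0)} = 3 * p - 2"
proof -
  let ?A = "(\<lambda>d. (0 :: nat, 0 :: nat, d)) ` {1..<p}" and ?B = "{(0 :: nat, 1 :: nat, 0 :: nat)}"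
    and ?C = "(\<lambda>d. (1 :: nat, 0 :: nat, d)) ` {1..<p}" and ?D = "(\<lambda>e. (1 :: nat, e, 0 :: nat)) ` {1..<p}"
  have "{(c, e, d) \<in> reps. \<not> (e = 0 \<and> d = 0)} = ?A \<union> ?B \<union> ?C \<union> ?D"
    by (auto simp: reps_def)
  also have "card \<dots> = card (?A \<union> ?B \<union> ?C) + card ?D"
    by (rule card_Un_disjoint) auto
  also have "card (?A \<union> ?B \<union> ?C) = card (?A \<union> ?B) + card ?C"
    by (rule card_Un_disjoint) auto
  also have "card (?A \<union> ?B) = card ?A + card ?B"
    by (rule card_Un_disjoint) auto
  also have "card ?A = p - 1"
    by (subst card_image) (auto simp: inj_on_def)
  also have "card ?C = p - 1"
    by (subst card_image) (auto simp: inj_on_def)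
  also have "card ?D = p - 1"
    by (subst card_image) (auto simp: inj_on_def)
  finally show ?thesis
    using p_gt_2 by simp
qed

end

theorem mainTheorem5:
  fixes p q r :: nat
  assumes "prime p" "prime q" "p > 2"
    and "[q = 1] (mod p)" "\<not> [q = 1] (mod p\<^sup>2)"
    and "ord q r = p"
  shows
    "let Zp2q = integer_mod_group (p\<^sup>2 * q);
         ZpZpZq = (integer_mod_group p \<times>\<times> integer_mod_group p) \<times>\<times> integer_mod_group q;
         ZqZp2 = cyclic_semidirect q (p\<^sup>2) r;
         ZpZqZp = integer_mod_group p \<times>\<times> cyclic_semidirect q p r
     in
       (num_skew_braces ZqZp2 Zp2q = 2 * p \<and>
        num_skew_braces ZqZp2 ZqZp2 = 2 * p * (p - 1) \<and>
        num_skew_braces ZqZp2 ZpZpZq = 0 \<and>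
        num_skew_braces ZqZp2 ZpZqZp = 0) \<and>
       (num_skew_braces ZpZqZp Zp2q = 0 \<and>
        num_skew_braces ZpZqZp ZqZp2 = 0 \<and>
        num_skew_braces ZpZqZp ZpZpZq = 4 \<and>
        num_skew_braces ZpZqZp ZpZqZp = 6 * p - 4)"
proof -
  interpret p2q_setup p q r
    by unfold_locales (use assms in auto)
  have "num_skew_braces ZqZp2 Zp2q = 2 * p"
    using num_skew_braces_cyclic[where D = "{0}", OF cyclic_iso_Zp2q_iff] p0 by simp
  moreover have "num_skew_braces ZqZp2 ZqZp2 = 2 * p * (p - 1)"
  proof -
    have "{1..<p} \<subseteq> {..<p}"
      by auto
    from num_skew_braces_cyclic[OF cyclic_iso_ZqZp2_iff this] show ?thesis
      by simp
  qed
  moreover have "num_skew_braces ZqZp2 ZpZpZq = 0"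
    using num_skew_braces_cyclic[where D = "{}" and Y = ZpZpZq] cyclic_not_iso(1)[OF character_C] by simp
  moreover have "num_skew_braces ZqZp2 ZpZqZp = 0"
    using num_skew_braces_cyclic[where D = "{}" and Y = ZpZqZp] cyclic_not_iso(2)[OF character_C] by simp
  moreover
  \<comment> \<open>For the two groups with an element of order p^2 no character qualifies, so the
    condition on representatives is constantly false.\<close>
  have none: "{(c, e, d) \<in> reps. False} = {}"
    by auto
  have "num_skew_braces ZpZqZp Zp2q = 2 * card {(c, e, d) \<in> reps. False}"
    by (rule num_skew_braces_elementary) (simp add: elementary_not_iso(1)[OF character_V])
  then have "num_skew_braces ZpZqZp Zp2q = 0"
    by (simp only: none card.empty mult_0_right)
  moreover have "num_skew_braces ZpZqZp ZqZp2 = 2 * card {(c, e, d) \<in> reps. False}"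
    by (rule num_skew_braces_elementary) (simp add: elementary_not_iso(2)[OF character_V])
  then have "num_skew_braces ZpZqZp ZqZp2 = 0"
    by (simp only: none card.empty mult_0_right)
  moreover have "num_skew_braces ZpZqZp ZpZpZq = 4"
    using num_skew_braces_elementary[OF elementary_iso_ZpZpZq_iff] card_reps_trivial by simp
  moreover have "num_skew_braces ZpZqZp ZpZqZp = 6 * p - 4"
    using num_skew_braces_elementary[OF elementary_iso_ZpZqZp_iff] card_reps_nontrivial by simp
  ultimately show ?thesis
    unfolding Let_def by blast
qed

end
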